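(* Let $A$ be a finite-dimensional basic algebra over an algebraically closed field $K$, let $T\in\mathrm{mod}\,A$ be a support $\tau$-tilting module, let $B=\mathrm{End}_A T$, and let $S=S_1\oplus\cdots\oplus S_m$ be the left finite semi-brick corresponding to $T$, with each $S_i$ a brick. Then the functor $$\mathrm{Hom}_A(T,-):\mathrm{Fac}\,T\to\mathrm{Sub}\,\mathbb{D}T$$ induces a bijection between $\{S_1,\dots,S_m\}$ and the set of (isomorphism classes of) simple $B$-modules lying in $\mathrm{Sub}\,\mathbb{D}T$.
   Context: All algebras (including $B$) are finite-dimensional basic algebras over an algebraically closed field $K$; all modules are finitely generated right modules. $\mathbb{D}=\mathrm{Hom}_K(-,K)$ is the ordinary duality, $\tau$ is the Auslander-Reiten translation and $|M|$ is the number of isomorphism classes of indecomposable direct summands of $M$. A module $M$ is $\tau$-rigid if $\mathrm{Hom}_A(M,\tau M)=0$; it is $\tau$-tilting if it is $\tau$-rigid and $|M|=|A|$; it is support $\tau$-tilting if there is an idempotent $e\in A$ such that $M$ is a $\tau$-tilting $(A/\langle e\rangle)$-module. For a full subcategory (or module) $\mathcal{X}$: $\mathrm{add}\,\mathcal{X}$ is the additive closure, $\mathrm{Fac}\,\mathcal{X}$ is the subcategory of factor modules of objects of $\mathrm{add}\,\mathcal{X}$, $\mathrm{Sub}\,\mathcal{X}$ is the subcategory of submodules of objects of $\mathrm{add}\,\mathcal{X}$, and $\mathrm{Filt}(\mathcal{X})$ is the subcategory of modules $M$ having a filtration $0=M_0\subseteq M_1\subseteq\cdots\subseteq M_r=M$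 with $M_i/M_{i-1}\in\mathrm{add}\,\mathcal{X}$. Since $T$ is a $B$-$A$-bimodule, $\mathbb{D}T$ is a right $B$-module, and $\mathrm{Sub}\,\mathbb{D}T$ is a subcategory of $\mathrm{mod}\,B$. A brick is a module whose endomorphism algebra is a division algebra; a semi-brick is a finite direct sum of bricks with no nonzero homomorphisms between distinct summands. Write $T=\bigoplus_{i=1}^n T_i$ with $T_i$ indecomposable (pairwise non-isomorphic). The left finite semi-brick corresponding to $T$ is $S=S_1\oplus\cdots\oplus S_m$, where the $S_i$ are the nonzero modules among $T_i/\sum_{f\in\mathrm{rad}\,\mathrm{Hom}_A(T,T_i)}\mathrm{Im} f$, $1\le i\le n$, the summands $T_i$ being ordered so that these are the ones with $1\le i\le m$; each $S_i$ is a brick and $\mathrm{Fac}\,T=\mathrm{Filt}(\mathrm{Fac}\,S)$. *)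

theory Defs
  imports "HOL-Algebra.Algebra"
begin

section \<open>Finite-dimensional algebras\<close>

text \<open>
  A \<open>K\<close>-algebra is stored in the library record \<^type>\<open>module\<close>, which carries a ring structure
  together with a scalar multiplication.  The library locale \<^locale>\<open>algebra\<close> is not usable, since
  it forces the algebra to be commutative.  The zero algebra is allowed; it is needed because
  \<open>A/\<langle>e\<rangle>\<close> vanishes for \<open>e = 1\<close>.
\<close>

locale fd_algebra = field K + module K A + A?: ring A for K (structure) and A (structure) +
  assumes smult_mult_left:
      "\<lbrakk>c \<in> carrier K; x \<in> carrier A; y \<in> carrier A\<rbrakk>
        \<Longrightarrow> c \<odot>\<^bsub>A\<^esub> (x \<otimes>\<^bsub>A\<^esub> y) = (c \<odot>\<^bsub>A\<^esub> x) \<otimes>\<^bsub>A\<^esub> y"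
    and smult_mult_right:
      "\<lbrakk>c \<in> carrier K; x \<in> carrier A; y \<in> carrier A\<rbrakk>
        \<Longrightarrow> c \<odot>\<^bsub>A\<^esub> (x \<otimes>\<^bsub>A\<^esub> y) = x \<otimes>\<^bsub>A\<^esub> (c \<odot>\<^bsub>A\<^esub> y)"
    and finite_dimensional:
      "\<exists>Z. finite Z \<and> Z \<subseteq> carrier A \<and> \<Inter>{H. submodule H K A \<and> Z \<subseteq> H} = carrier A"

definition opp :: "('k, 'a) module \<Rightarrow> ('k, 'a) module"
  where "opp A = A\<lparr>monoid.mult := (\<lambda>x y. y \<otimes>\<^bsub>A\<^esub> x)\<rparr>"

definition quot_alg :: "('k, 'a) module \<Rightarrow> 'a set \<Rightarrow> ('k, 'a set) module"
  where "quot_alg A I =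
    \<lparr>carrier = carrier (A Quot I), monoid.mult = monoid.mult (A Quot I),
     one = one (A Quot I),
     ring.zero = ring.zero (A Quot I), ring.add = ring.add (A Quot I),
     smult = (\<lambda>c C. \<Union>x\<in>C. I +>\<^bsub>A\<^esub> (c \<odot>\<^bsub>A\<^esub> x))\<rparr>"


section \<open>Right modules\<close>

text \<open>
  As in the library record \<^type>\<open>module\<close>, extending \<^type>\<open>ring\<close> makes the theory of
  \<^locale>\<open>abelian_group\<close> available; the fields \<open>mult\<close> and \<open>one\<close> of a module play no role.
\<close>

record ('a, 'm) rmodule = "'m ring" +
  ract :: "'m \<Rightarrow> 'a \<Rightarrow> 'm" (infixl \<open>\<bullet>\<index>\<close> 70)

locale right_module = A?: ring A + M?: abelian_group M
    for A :: "('a, 'r) ring_scheme" (structure) and M :: "('a, 'm) rmodule" (structure) +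
  assumes ract_closed: "\<lbrakk>x \<in> carrier M; a \<in> carrier A\<rbrakk> \<Longrightarrow> x \<bullet>\<^bsub>M\<^esub> a \<in> carrier M"
    and ract_add_left: "\<lbrakk>x \<in> carrier M; y \<in> carrier M; a \<in> carrier A\<rbrakk>
      \<Longrightarrow> (x \<oplus>\<^bsub>M\<^esub> y) \<bullet>\<^bsub>M\<^esub> a = x \<bullet>\<^bsub>M\<^esub> a \<oplus>\<^bsub>M\<^esub> y \<bullet>\<^bsub>M\<^esub> a"
    and ract_add_right: "\<lbrakk>x \<in> carrier M; a \<in> carrier A; b \<in> carrier A\<rbrakk>
      \<Longrightarrow> x \<bullet>\<^bsub>M\<^esub> (a \<oplus>\<^bsub>A\<^esub> b) = x \<bullet>\<^bsub>M\<^esub> a \<oplus>\<^bsub>M\<^esub> x \<bullet>\<^bsub>M\<^esub> b"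
    and ract_mult: "\<lbrakk>x \<in> carrier M; a \<in> carrier A; b \<in> carrier A\<rbrakk>
      \<Longrightarrow> x \<bullet>\<^bsub>M\<^esub> (a \<otimes>\<^bsub>A\<^esub> b) = (x \<bullet>\<^bsub>M\<^esub> a) \<bullet>\<^bsub>M\<^esub> b"
    and ract_one: "x \<in> carrier M \<Longrightarrow> x \<bullet>\<^bsub>M\<^esub> \<one>\<^bsub>A\<^esub> = x"

definition rsubmodule ::
    "('a, 'r) ring_scheme \<Rightarrow> 'm set \<Rightarrow> ('a, 'm) rmodule \<Rightarrow> bool"
  where "rsubmodule A N M \<longleftrightarrow>
    additive_subgroup N M \<and> (\<forall>x\<in>N. \<forall>a\<in>carrier A. x \<bullet>\<^bsub>M\<^esub> a \<in> N)"

text \<open>For a union of submodules this is their sum.\<close>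

definition gen_submodule ::
    "('a, 'r) ring_scheme \<Rightarrow> ('a, 'm) rmodule \<Rightarrow> 'm set \<Rightarrow> 'm set"
  where "gen_submodule A M Z = \<Inter>{N. rsubmodule A N M \<and> Z \<subseteq> N}"

definition fg_rmodule :: "('a, 'r) ring_scheme \<Rightarrow> ('a, 'm) rmodule \<Rightarrow> bool"
  where "fg_rmodule A M \<longleftrightarrow>
    right_module A M \<and> (\<exists>Z. finite Z \<and> Z \<subseteq> carrier M \<and> gen_submodule A M Z = carrier M)"

definition rhom ::
    "('a, 'r) ring_scheme \<Rightarrow> ('a, 'm) rmodule \<Rightarrow> ('a, 'n) rmodule \<Rightarrow> ('m \<Rightarrow> 'n) set"
  where "rhom A M N =
    {f \<in> carrier M \<rightarrow>\<^sub>E carrier N.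
       (\<forall>x\<in>carrier M. \<forall>y\<in>carrier M. f (x \<oplus>\<^bsub>M\<^esub> y) = f x \<oplus>\<^bsub>N\<^esub> f y) \<and>
       (\<forall>x\<in>carrier M. \<forall>a\<in>carrier A. f (x \<bullet>\<^bsub>M\<^esub> a) = f x \<bullet>\<^bsub>N\<^esub> a)}"

definition rmod_iso ::
    "('a, 'r) ring_scheme \<Rightarrow> ('a, 'm) rmodule \<Rightarrow> ('a, 'n) rmodule \<Rightarrow> bool"
  where "rmod_iso A M N \<longleftrightarrow> (\<exists>f\<in>rhom A M N. bij_betw f (carrier M) (carrier N))"

definition regular :: "('a, 'r) ring_scheme \<Rightarrow> ('a, 'a) rmodule"
  where "regular A =
    \<lparr>carrier = carrier A, monoid.mult = monoid.mult A, one = one A, ring.zero = ring.zero A,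
     ring.add = ring.add A, ract = monoid.mult A\<rparr>"

definition quot_rmod :: "('a, 'm) rmodule \<Rightarrow> 'm set \<Rightarrow> ('a, 'm set) rmodule"
  where "quot_rmod M N =
    \<lparr>carrier = a_rcosets\<^bsub>M\<^esub> N, monoid.mult = undefined, one = undefined,
     ring.zero = N, ring.add = set_add M,
     ract = (\<lambda>C a. \<Union>x\<in>C. N +>\<^bsub>M\<^esub> (x \<bullet>\<^bsub>M\<^esub> a))\<rparr>"

text \<open>The direct sum of \<open>n\<close> copies of \<open>M\<close>.\<close>

definition power_rmod :: "('a, 'm) rmodule \<Rightarrow> nat \<Rightarrow> ('a, nat \<Rightarrow> 'm) rmodule"
  where "power_rmod M n =
    \<lparr>carrier = {..<n} \<rightarrow>\<^sub>E carrier M, monoid.mult = undefined, one = undefined,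
     ring.zero = (\<lambda>i\<in>{..<n}. \<zero>\<^bsub>M\<^esub>),
     ring.add = (\<lambda>f g. \<lambda>i\<in>{..<n}. f i \<oplus>\<^bsub>M\<^esub> g i),
     ract = (\<lambda>f a. \<lambda>i\<in>{..<n}. f i \<bullet>\<^bsub>M\<^esub> a)\<rparr>"

definition direct_summand ::
    "('a, 'r) ring_scheme \<Rightarrow> 'm set \<Rightarrow> ('a, 'm) rmodule \<Rightarrow> bool"
  where "direct_summand A N M \<longleftrightarrow>
    rsubmodule A N M \<and>
    (\<exists>N'. rsubmodule A N' M \<and> N \<inter> N' = {\<zero>\<^bsub>M\<^esub>} \<and> N <+>\<^bsub>M\<^esub> N' = carrier M)"

definition indecomposable :: "('a, 'r) ring_scheme \<Rightarrow> ('a, 'm) rmodule \<Rightarrow> bool"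
  where "indecomposable A M \<longleftrightarrow>
    carrier M \<noteq> {\<zero>\<^bsub>M\<^esub>} \<and> (\<forall>N. direct_summand A N M \<longrightarrow> N = {\<zero>\<^bsub>M\<^esub>} \<or> N = carrier M)"

definition simple_rmodule :: "('a, 'r) ring_scheme \<Rightarrow> ('a, 'm) rmodule \<Rightarrow> bool"
  where "simple_rmodule A M \<longleftrightarrow>
    right_module A M \<and> carrier M \<noteq> {\<zero>\<^bsub>M\<^esub>} \<and>
    (\<forall>N. rsubmodule A N M \<longrightarrow> N = {\<zero>\<^bsub>M\<^esub>} \<or> N = carrier M)"

definition num_summands :: "('a, 'r) ring_scheme \<Rightarrow> ('a, 'm) rmodule \<Rightarrow> nat"
  where "num_summands A M =
    (let D = {N. direct_summand A N M \<and> indecomposable A (M\<lparr>carrier := N\<rparr>)}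
     in card (D // {(N, N'). N \<in> D \<and> N' \<in> D
                        \<and> rmod_iso A (M\<lparr>carrier := N\<rparr>) (M\<lparr>carrier := N'\<rparr>)}))"

definition internal_direct_sum ::
    "('a, 'r) ring_scheme \<Rightarrow> ('a, 'm) rmodule \<Rightarrow> nat \<Rightarrow> (nat \<Rightarrow> 'm set) \<Rightarrow> bool"
  where "internal_direct_sum A M n N \<longleftrightarrow>
    (\<forall>i<n. rsubmodule A (N i) M) \<and>
    (\<forall>x\<in>carrier M. \<exists>!f. f \<in> (\<Pi>\<^sub>E i\<in>{..<n}. N i) \<and> x = (\<Oplus>\<^bsub>M\<^esub>i\<in>{..<n}. f i))"

text \<open>\<open>M = N\<^sub>0 \<oplus> \<dots> \<oplus> N\<^sub>n\<^sub>-\<^sub>1\<close> with pairwise non-isomorphic indecomposable summands.\<close>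

definition basic_decomposition ::
    "('a, 'r) ring_scheme \<Rightarrow> ('a, 'm) rmodule \<Rightarrow> nat \<Rightarrow> (nat \<Rightarrow> 'm set) \<Rightarrow> bool"
  where "basic_decomposition A M n N \<longleftrightarrow>
    internal_direct_sum A M n N \<and>
    (\<forall>i<n. indecomposable A (M\<lparr>carrier := N i\<rparr>)) \<and>
    (\<forall>i<n. \<forall>j<n. i \<noteq> j \<longrightarrow> \<not> rmod_iso A (M\<lparr>carrier := N i\<rparr>) (M\<lparr>carrier := N j\<rparr>))"

definition basic_algebra :: "('a, 'r) ring_scheme \<Rightarrow> bool"
  where "basic_algebra A \<longleftrightarrow> (\<exists>n N. basic_decomposition A (regular A) n N)"


subsection \<open>The subcategories \<open>add\<close>, \<open>Fac\<close> and \<open>Sub\<close> of \<open>mod A\<close>\<close>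

definition in_add ::
    "('a, 'r) ring_scheme \<Rightarrow> ('a, 'x) rmodule \<Rightarrow> ('a, 'm) rmodule \<Rightarrow> bool"
  where "in_add A Z M \<longleftrightarrow> fg_rmodule A M \<and>
    (\<exists>n N. direct_summand A N (power_rmod Z n) \<and>
           rmod_iso A M ((power_rmod Z n)\<lparr>carrier := N\<rparr>))"

definition in_Fac ::
    "('a, 'r) ring_scheme \<Rightarrow> ('a, 'x) rmodule \<Rightarrow> ('a, 'm) rmodule \<Rightarrow> bool"
  where "in_Fac A Z M \<longleftrightarrow> fg_rmodule A M \<and>
    (\<exists>n N. direct_summand A N (power_rmod Z n) \<and>
           (\<exists>f\<in>rhom A ((power_rmod Z n)\<lparr>carrier := N\<rparr>) M. f ` N = carrier M))"

definition in_Sub ::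
    "('a, 'r) ring_scheme \<Rightarrow> ('a, 'x) rmodule \<Rightarrow> ('a, 'm) rmodule \<Rightarrow> bool"
  where "in_Sub A Z M \<longleftrightarrow> fg_rmodule A M \<and>
    (\<exists>n N. direct_summand A N (power_rmod Z n) \<and>
           (\<exists>f\<in>rhom A M ((power_rmod Z n)\<lparr>carrier := N\<rparr>). inj_on f (carrier M)))"


subsection \<open>Duality\<close>

text \<open>
  A right \<open>R\<close>-module is a \<open>K\<close>-vector space through \<open>c y = y (c 1\<^sub>R)\<close>.  The \<open>K\<close>-dual of a right
  \<open>R\<close>-module is a left \<open>R\<close>-module, i.e.\ a right module over the opposite algebra of \<open>R\<close>.
\<close>

definition dual :: "'k ring \<Rightarrow> ('k, 'a) module \<Rightarrow> ('a, 'm) rmodule \<Rightarrow> ('a, 'm \<Rightarrow> 'k) rmodule"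
  where "dual K R N =
    \<lparr>carrier = {\<phi> \<in> carrier N \<rightarrow>\<^sub>E carrier K.
       (\<forall>x\<in>carrier N. \<forall>y\<in>carrier N. \<phi> (x \<oplus>\<^bsub>N\<^esub> y) = \<phi> x \<oplus>\<^bsub>K\<^esub> \<phi> y) \<and>
       (\<forall>y\<in>carrier N. \<forall>c\<in>carrier K. \<phi> (y \<bullet>\<^bsub>N\<^esub> (c \<odot>\<^bsub>R\<^esub> \<one>\<^bsub>R\<^esub>)) = c \<otimes>\<^bsub>K\<^esub> \<phi> y)},
     monoid.mult = undefined, one = undefined,
     ring.zero = (\<lambda>y\<in>carrier N. \<zero>\<^bsub>K\<^esub>),
     ring.add = (\<lambda>\<phi> \<psi>. \<lambda>y\<in>carrier N. \<phi> y \<oplus>\<^bsub>K\<^esub> \<psi> y),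
     ract = (\<lambda>\<phi> a. \<lambda>y\<in>carrier N. \<phi> (y \<bullet>\<^bsub>N\<^esub> a))\<rparr>"


section \<open>The Auslander-Reiten translation and support \<open>\<tau>\<close>-tilting modules\<close>

definition superfluous ::
    "('a, 'r) ring_scheme \<Rightarrow> 'm set \<Rightarrow> ('a, 'm) rmodule \<Rightarrow> bool"
  where "superfluous A N M \<longleftrightarrow> rsubmodule A N M \<and>
    (\<forall>L. rsubmodule A L M \<and> L <+>\<^bsub>M\<^esub> N = carrier M \<longrightarrow> L = carrier M)"

definition rker :: "('a, 'm) rmodule \<Rightarrow> ('a, 'n) rmodule \<Rightarrow> ('m \<Rightarrow> 'n) \<Rightarrow> 'm set"
  where "rker M N f = {x \<in> carrier M. f x = \<zero>\<^bsub>N\<^esub>}"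

text \<open>
  \<open>P\<^sub>1 \<rightarrow> P\<^sub>0 \<rightarrow> M \<rightarrow> 0\<close> exact, with \<open>P\<^sub>0 \<rightarrow> M\<close> and \<open>P\<^sub>1 \<rightarrow> ker p\<^sub>0\<close> projective covers.  The finitely
  generated projectives are the modules in \<open>add A\<close>.
\<close>

definition min_proj_presentation ::
    "('a, 'r) ring_scheme \<Rightarrow> ('a, 'p) rmodule \<Rightarrow> ('a, 'q) rmodule
      \<Rightarrow> ('p \<Rightarrow> 'q) \<Rightarrow> ('q \<Rightarrow> 'm) \<Rightarrow> ('a, 'm) rmodule \<Rightarrow> bool"
  where "min_proj_presentation A P1 P0 p1 p0 M \<longleftrightarrow>
    in_add A (regular A) P1 \<and> in_add A (regular A) P0 \<and>
    p0 \<in> rhom A P0 M \<and> p0 ` carrier P0 = carrier M \<and> superfluous A (rker P0 M p0) P0 \<and>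
    p1 \<in> rhom A P1 P0 \<and> p1 ` carrier P1 = rker P0 M p0 \<and> superfluous A (rker P1 P0 p1) P1"

text \<open>\<open>Hom\<^sub>A(P, A)\<close>, a left \<open>A\<close>-module through \<open>(a f)(x) = a f(x)\<close>, as a right \<open>opp A\<close>-module.\<close>

definition A_dual :: "('k, 'a) module \<Rightarrow> ('a, 'p) rmodule \<Rightarrow> ('a, 'p \<Rightarrow> 'a) rmodule"
  where "A_dual A P =
    \<lparr>carrier = rhom A P (regular A), monoid.mult = undefined, one = undefined,
     ring.zero = (\<lambda>x\<in>carrier P. \<zero>\<^bsub>A\<^esub>),
     ring.add = (\<lambda>f g. \<lambda>x\<in>carrier P. f x \<oplus>\<^bsub>A\<^esub> g x),
     ract = (\<lambda>f a. \<lambda>x\<in>carrier P. a \<otimes>\<^bsub>A\<^esub> f x)\<rparr>"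

text \<open>\<open>Coker (Hom\<^sub>A(P\<^sub>0, A) \<rightarrow> Hom\<^sub>A(P\<^sub>1, A))\<close>.\<close>

definition AR_transpose ::
    "('k, 'a) module \<Rightarrow> ('a, 'p) rmodule \<Rightarrow> ('a, 'q) rmodule \<Rightarrow> ('p \<Rightarrow> 'q)
      \<Rightarrow> ('a, ('p \<Rightarrow> 'a) set) rmodule"
  where "AR_transpose A P1 P0 p1 =
    quot_rmod (A_dual A P1) ((\<lambda>f. compose (carrier P1) f p1) ` rhom A P0 (regular A))"

text \<open>
  \<open>N = \<tau> M\<close>, computed from some minimal projective presentation; \<open>\<tau> M\<close> is unique only up to
  isomorphism.  Objects of \<open>add A\<close> are isomorphic to submodules of some \<open>A\<^sup>n\<close>, so nothing is lost
  by taking the elements of \<open>P\<^sub>0\<close> and \<open>P\<^sub>1\<close> from \<open>nat \<Rightarrow> 'a\<close>.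
\<close>

definition is_AR_translate ::
    "'k ring \<Rightarrow> ('k, 'a) module \<Rightarrow> ('a, 'm) rmodule
      \<Rightarrow> ('a, ((nat \<Rightarrow> 'a) \<Rightarrow> 'a) set \<Rightarrow> 'k) rmodule \<Rightarrow> bool"
  where "is_AR_translate K A M N \<longleftrightarrow>
    (\<exists>(P1 :: ('a, nat \<Rightarrow> 'a) rmodule) (P0 :: ('a, nat \<Rightarrow> 'a) rmodule) p1 p0.
       min_proj_presentation A P1 P0 p1 p0 M \<and> N = dual K (opp A) (AR_transpose A P1 P0 p1))"

definition tau_rigid :: "'k ring \<Rightarrow> ('k, 'a) module \<Rightarrow> ('a, 'm) rmodule \<Rightarrow> bool"
  where "tau_rigid K A M \<longleftrightarrow>
    (\<exists>N. is_AR_translate K A M N \<and> rhom A M N = {\<lambda>x\<in>carrier M. \<zero>\<^bsub>N\<^esub>})"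

definition tau_tilting :: "'k ring \<Rightarrow> ('k, 'a) module \<Rightarrow> ('a, 'm) rmodule \<Rightarrow> bool"
  where "tau_tilting K A M \<longleftrightarrow>
    fg_rmodule A M \<and> tau_rigid K A M \<and> num_summands A M = num_summands A (regular A)"

text \<open>
  A module \<open>M\<close> with \<open>M I = 0\<close>, regarded as a module over \<open>A/I\<close>: a coset acts through any of its
  representatives.
\<close>

definition over_quot :: "('a, 'm) rmodule \<Rightarrow> ('a set, 'm) rmodule"
  where "over_quot M =
    \<lparr>carrier = carrier M, monoid.mult = monoid.mult M, one = one M, ring.zero = ring.zero M,
     ring.add = ring.add M, ract = (\<lambda>x C. x \<bullet>\<^bsub>M\<^esub> (SOME a. a \<in> C))\<rparr>"

definition support_tau_tilting :: "'k ring \<Rightarrow> ('k, 'a) module \<Rightarrow> ('a, 'm) rmodule \<Rightarrow> bool"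
  where "support_tau_tilting K A M \<longleftrightarrow>
    fg_rmodule A M \<and>
    (\<exists>e\<in>carrier A. e \<otimes>\<^bsub>A\<^esub> e = e \<and>
       (\<forall>x\<in>carrier M. \<forall>a\<in>Idl\<^bsub>A\<^esub> {e}. x \<bullet>\<^bsub>M\<^esub> a = \<zero>\<^bsub>M\<^esub>) \<and>
       tau_tilting K (quot_alg A (Idl\<^bsub>A\<^esub> {e})) (over_quot M))"


section \<open>The endomorphism algebra and the functor \<open>Hom\<^sub>A(T, -)\<close>\<close>

text \<open>
  The product is composition, so that \<open>T\<close> is an \<open>End T\<close>-\<open>A\<close>-bimodule and \<open>Hom\<^sub>A(T, Z)\<close> is a
  right \<open>End T\<close>-module by precomposition.
\<close>

definition end_alg :: "('k, 'a) module \<Rightarrow> ('a, 't) rmodule \<Rightarrow> ('k, 't \<Rightarrow> 't) module"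
  where "end_alg A T =
    \<lparr>carrier = rhom A T T, monoid.mult = compose (carrier T), one = (\<lambda>x\<in>carrier T. x),
     ring.zero = (\<lambda>x\<in>carrier T. \<zero>\<^bsub>T\<^esub>),
     ring.add = (\<lambda>f g. \<lambda>x\<in>carrier T. f x \<oplus>\<^bsub>T\<^esub> g x),
     smult = (\<lambda>c f. \<lambda>x\<in>carrier T. f x \<bullet>\<^bsub>T\<^esub> (c \<odot>\<^bsub>A\<^esub> \<one>\<^bsub>A\<^esub>))\<rparr>"

definition hom_rmod ::
    "('k, 'a) module \<Rightarrow> ('a, 't) rmodule \<Rightarrow> ('a, 'x) rmodule \<Rightarrow> ('t \<Rightarrow> 't, 't \<Rightarrow> 'x) rmodule"
  where "hom_rmod A T Z =
    \<lparr>carrier = rhom A T Z, monoid.mult = undefined, one = undefined,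
     ring.zero = (\<lambda>x\<in>carrier T. \<zero>\<^bsub>Z\<^esub>),
     ring.add = (\<lambda>f g. \<lambda>x\<in>carrier T. f x \<oplus>\<^bsub>Z\<^esub> g x),
     ract = (\<lambda>f b. compose (carrier T) f b)\<rparr>"

text \<open>\<open>T\<close> as a left \<open>End T\<close>-module, i.e.\ a right module over \<open>opp (End T)\<close>.\<close>

definition left_end_mod :: "('a, 't) rmodule \<Rightarrow> ('t \<Rightarrow> 't, 't) rmodule"
  where "left_end_mod T =
    \<lparr>carrier = carrier T, monoid.mult = monoid.mult T, one = one T, ring.zero = ring.zero T,
     ring.add = ring.add T, ract = (\<lambda>x b. b x)\<rparr>"

text \<open>The right \<open>End T\<close>-module \<open>\<D>T\<close>.\<close>

definition dual_end_mod ::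
    "'k ring \<Rightarrow> ('k, 'a) module \<Rightarrow> ('a, 't) rmodule \<Rightarrow> ('t \<Rightarrow> 't, 't \<Rightarrow> 'k) rmodule"
  where "dual_end_mod K A T = dual K (opp (end_alg A T)) (left_end_mod T)"


section \<open>The left finite semi-brick of \<open>T\<close>\<close>

text \<open>The radical of the category \<open>mod A\<close>.\<close>

definition rad_hom ::
    "('k, 'a) module \<Rightarrow> ('a, 'm) rmodule \<Rightarrow> ('a, 'n) rmodule \<Rightarrow> ('m \<Rightarrow> 'n) set"
  where "rad_hom A M N =
    {f \<in> rhom A M N. \<forall>g\<in>rhom A N M.
       \<one>\<^bsub>end_alg A M\<^esub> \<ominus>\<^bsub>end_alg A M\<^esub> compose (carrier M) g f \<in> Units (end_alg A M)}"

text \<open>\<open>T\<^sub>i / \<Sum>\<^bsub>f \<in> rad Hom(T, T\<^sub>i)\<^esub> Im f\<close> for a submodule \<open>T\<^sub>i\<close> of \<open>T\<close>.\<close>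

definition rad_quotient ::
    "('k, 'a) module \<Rightarrow> ('a, 't) rmodule \<Rightarrow> 't set \<Rightarrow> ('a, 't set) rmodule"
  where "rad_quotient A T N =
    (let U = T\<lparr>carrier := N\<rparr>
     in quot_rmod U (gen_submodule A U (\<Union>f\<in>rad_hom A T U. f ` carrier T)))"

definition semibrick_summands ::
    "('k, 'a) module \<Rightarrow> ('a, 't) rmodule \<Rightarrow> nat \<Rightarrow> (nat \<Rightarrow> 't set) \<Rightarrow> ('a, 't set) rmodule set"
  where "semibrick_summands A T n N =
    {S. \<exists>i<n. S = rad_quotient A T (N i) \<and> carrier S \<noteq> {\<zero>\<^bsub>S\<^esub>}}"


section \<open>Isomorphism classes\<close>

text \<open>
  HOL has no set of all modules.  Over a finite-dimensional \<open>K\<close>-algebra every finitely generated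
  module is isomorphic to one whose underlying vector space is some \<open>K\<^sup>d\<close>, hence to one with
  elements in \<open>nat \<Rightarrow> 'k\<close>.  The isomorphism class of \<open>Z\<close> is represented by its members of that
  type; it is non-empty, and it determines \<open>Z\<close> up to isomorphism.
\<close>

definition iso_class ::
    "'k ring \<Rightarrow> ('k, 'b) module \<Rightarrow> ('b, 'x) rmodule \<Rightarrow> ('b, nat \<Rightarrow> 'k) rmodule set"
  where "iso_class K B Z = {Y. fg_rmodule B Y \<and> rmod_iso B Z Y}"

end

theory Submission
  imports Defs
begin

text \<open>
  Let \<open>T = T\<^sub>1 \<oplus> \<dots> \<oplus> T\<^sub>n\<close> with indecomposable summands, let \<open>R\<^sub>i\<close> be the sum of the images of all
  radical maps \<open>T \<rightarrow> T\<^sub>i\<close>, and \<open>S\<^sub>i = T\<^sub>i/R\<^sub>i\<close>.  Everything rests on a lifting property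
  (\<open>support_tau_tilting_lift\<close>): as \<open>R\<^sub>i\<close> lies in \<open>Fac T\<close>, every map \<open>T \<rightarrow> S\<^sub>i\<close> lifts to a map
  \<open>T \<rightarrow> T\<^sub>i\<close>.  In other words \<open>Ext\<^sup>1(T, R\<^sub>i) \<rightarrow> Ext\<^sup>1(T, T\<^sub>i)\<close> is injective; in fact
  \<open>Ext\<^sup>1(T, Fac T) = 0\<close> over the factor algebra on which \<open>T\<close> is \<open>\<tau>\<close>-tilting.

  Because of the lifting property \<open>Hom(T, S\<^sub>i)\<close> is \<open>Hom(T, T\<^sub>i)\<close> modulo the maps with image in
  \<open>R\<^sub>i\<close>.  By Fitting's lemma \<open>End T\<^sub>i\<close> is local, so that a map \<open>T \<rightarrow> T\<^sub>i\<close> outside the radical is a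
  split epimorphism (\<open>not_rad_split\<close>).  Hence, if \<open>S\<^sub>i \<noteq> 0\<close>, the maps with image in \<open>R\<^sub>i\<close> are
  exactly the radical ones, and \<open>Hom(T, S\<^sub>i)\<close> is the simple top of the projective \<open>B\<close>-module
  \<open>Hom(T, T\<^sub>i)\<close>.  An isomorphism \<open>Hom(T, S\<^sub>i) \<cong> Hom(T, S\<^sub>j)\<close> lifts to a split epimorphism
  \<open>T\<^sub>i \<rightarrow> T\<^sub>j\<close>, so that \<open>i = j\<close>.

  For every finitely generated \<open>Y\<close> the module \<open>Hom(T, Y)\<close> lies in \<open>Sub \<D>T\<close>: compose with
  finitely many linear functionals on \<open>Y\<close> whose only common zero is \<open>0\<close> (\<open>hom_rmod_in_Sub\<close>).
  Conversely, a simple module \<open>Y\<close> in \<open>Sub \<D>T\<close> is isomorphic to a submodule of \<open>\<D>T\<close> and so contains a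
  linear functional on \<open>T\<close> that vanishes on all \<open>T\<^sub>j\<close> but one, \<open>T\<^sub>i\<close>.  Radical maps act on it by
  zero, so it vanishes on \<open>R\<^sub>i\<close>; as it is not zero, \<open>S\<^sub>i \<noteq> 0\<close>, and \<open>Y\<close> is the top of
  \<open>Hom(T, T\<^sub>i)\<close>, that is, \<open>Hom(T, S\<^sub>i)\<close> (\<open>simple_in_Sub\<close>).

  The lifting property comes from \<open>Hom(T, \<tau>T) = 0\<close> in two steps.  Let
  \<open>P\<^sub>1 \<rightarrow> P\<^sub>0 \<rightarrow> T \<rightarrow> 0\<close> be the presentation that computes \<open>\<tau>T\<close>.  A linear functional on
  \<open>Hom(P\<^sub>1, T)\<close> that vanishes on all maps that factor through \<open>P\<^sub>0\<close> is the same thing as a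
  map \<open>T \<rightarrow> \<tau>T\<close>, so it is zero, and all maps \<open>P\<^sub>1 \<rightarrow> T\<close> factor through \<open>P\<^sub>0\<close>
  (\<open>zero_hom_to_translate_factor\<close>).  As \<open>P\<^sub>1\<close> is projective the same holds with a module in
  \<open>Fac T\<close> in place of the target \<open>T\<close>, and a diagram chase gives the lifting
  (\<open>lift_through_quotient\<close>).
\<close>

section \<open>Right modules over a ring\<close>

lemma (in abelian_group) minus_eq_zero_iff [simp]:
  assumes "x \<in> carrier G" "y \<in> carrier G"
  shows "x \<ominus> y = \<zero> \<longleftrightarrow> x = y"
  using assms add.inv_solve_right[of "\<zero>" x y] by (auto simp: a_minus_def r_neg)

lemma (in abelian_group) minus_self [simp]: "x \<in> carrier G \<Longrightarrow> x \<ominus> x = \<zero>"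
  by simp

lemma (in abelian_group) minus_zero [simp]: "x \<in> carrier G \<Longrightarrow> x \<ominus> \<zero> = x"
  using add.inv_one by (simp add: a_minus_def)

lemma abelian_group_cong:
  assumes "abelian_group G" "carrier H = carrier G" "\<zero>\<^bsub>H\<^esub> = \<zero>\<^bsub>G\<^esub>"
    and "\<And>x y. x \<oplus>\<^bsub>H\<^esub> y = x \<oplus>\<^bsub>G\<^esub> y"
  shows "abelian_group H"
  by (rule abelian_groupI) (use abelian_groupE[OF assms(1)] in \<open>simp_all add: assms(2-4)\<close>)

context right_module
begin

lemma ract_zero_left [simp]:
  assumes "a \<in> carrier A" shows "\<zero>\<^bsub>M\<^esub> \<bullet>\<^bsub>M\<^esub> a = \<zero>\<^bsub>M\<^esub>"
proof -
  have "\<zero>\<^bsub>M\<^esub> \<bullet>\<^bsub>M\<^esub> a = \<zero>\<^bsub>M\<^esub> \<bullet>\<^bsub>M\<^esub> a \<oplus>\<^bsub>M\<^esub> \<zero>\<^bsub>M\<^esub> \<bullet>\<^bsub>M\<^esub> a"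
    using ract_add_left[of "\<zero>\<^bsub>M\<^esub>" "\<zero>\<^bsub>M\<^esub>" a] assms by simp
  then show ?thesis using assms ract_closed by (metis M.add.r_cancel_one' M.zero_closed)
qed

lemma ract_zero_right [simp]:
  assumes "x \<in> carrier M" shows "x \<bullet>\<^bsub>M\<^esub> \<zero>\<^bsub>A\<^esub> = \<zero>\<^bsub>M\<^esub>"
proof -
  have "x \<bullet>\<^bsub>M\<^esub> \<zero>\<^bsub>A\<^esub> = x \<bullet>\<^bsub>M\<^esub> \<zero>\<^bsub>A\<^esub> \<oplus>\<^bsub>M\<^esub> x \<bullet>\<^bsub>M\<^esub> \<zero>\<^bsub>A\<^esub>"
    using ract_add_right[of x "\<zero>\<^bsub>A\<^esub>" "\<zero>\<^bsub>A\<^esub>"] assms by simp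
  then show ?thesis using assms ract_closed by (metis M.add.r_cancel_one' A.zero_closed)
qed

lemma ract_inv_left:
  assumes "x \<in> carrier M" "a \<in> carrier A" shows "(\<ominus>\<^bsub>M\<^esub> x) \<bullet>\<^bsub>M\<^esub> a = \<ominus>\<^bsub>M\<^esub> (x \<bullet>\<^bsub>M\<^esub> a)"
proof -
  have "(\<ominus>\<^bsub>M\<^esub> x) \<bullet>\<^bsub>M\<^esub> a \<oplus>\<^bsub>M\<^esub> x \<bullet>\<^bsub>M\<^esub> a = \<zero>\<^bsub>M\<^esub>"
    using ract_add_left[of "\<ominus>\<^bsub>M\<^esub> x" x a] assms by (simp add: M.l_neg)
  then show ?thesis using assms ract_closed by (metis M.minus_equality M.a_inv_closed)
qed

lemma ract_inv_right:
  assumes "x \<in> carrier M" "a \<in> carrier A" shows "x \<bullet>\<^bsub>M\<^esub> (\<ominus>\<^bsub>A\<^esub> a) = \<ominus>\<^bsub>M\<^esub> (x \<bullet>\<^bsub>M\<^esub> a)"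
proof -
  have "x \<bullet>\<^bsub>M\<^esub> (\<ominus>\<^bsub>A\<^esub> a) \<oplus>\<^bsub>M\<^esub> x \<bullet>\<^bsub>M\<^esub> a = \<zero>\<^bsub>M\<^esub>"
    using ract_add_right[of x "\<ominus>\<^bsub>A\<^esub> a" a] assms by (simp add: A.l_neg)
  then show ?thesis using assms ract_closed by (metis M.minus_equality A.a_inv_closed)
qed

lemma ract_minus_left:
  "x \<in> carrier M \<Longrightarrow> y \<in> carrier M \<Longrightarrow> a \<in> carrier A \<Longrightarrow>
    (x \<ominus>\<^bsub>M\<^esub> y) \<bullet>\<^bsub>M\<^esub> a = x \<bullet>\<^bsub>M\<^esub> a \<ominus>\<^bsub>M\<^esub> y \<bullet>\<^bsub>M\<^esub> a"
  by (simp add: a_minus_def ract_add_left ract_inv_left)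

lemma ract_minus_right:
  "x \<in> carrier M \<Longrightarrow> a \<in> carrier A \<Longrightarrow> b \<in> carrier A \<Longrightarrow>
    x \<bullet>\<^bsub>M\<^esub> (a \<ominus>\<^bsub>A\<^esub> b) = x \<bullet>\<^bsub>M\<^esub> a \<ominus>\<^bsub>M\<^esub> x \<bullet>\<^bsub>M\<^esub> b"
  by (simp add: a_minus_def ract_add_right ract_inv_right)

lemma rsubmoduleI:
  assumes "N \<subseteq> carrier M" "\<zero>\<^bsub>M\<^esub> \<in> N"
    and "\<And>x y. x \<in> N \<Longrightarrow> y \<in> N \<Longrightarrow> x \<oplus>\<^bsub>M\<^esub> y \<in> N"
    and ract: "\<And>x a. x \<in> N \<Longrightarrow> a \<in> carrier A \<Longrightarrow> x \<bullet>\<^bsub>M\<^esub> a \<in> N"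
  shows "rsubmodule A N M"
proof -
  have "\<ominus>\<^bsub>M\<^esub> x \<in> N" if "x \<in> N" for x
    using ract[OF that, of "\<ominus>\<^bsub>A\<^esub> \<one>\<^bsub>A\<^esub>"] ract_inv_right[of x "\<one>\<^bsub>A\<^esub>"] that assms(1)
    by (auto simp: ract_one)
  then have "subgroup N (add_monoid M)"
    using assms by (intro M.add.subgroupI) (auto simp: a_inv_def)
  then show ?thesis
    using ract by (auto simp: rsubmodule_def additive_subgroup_def)
qed

lemma rsubmodule_carrier: "rsubmodule A (carrier M) M"
  by (rule rsubmoduleI) (auto intro: ract_closed)

lemma rsubmodule_zero: "rsubmodule A {\<zero>\<^bsub>M\<^esub>} M"
  by (rule rsubmoduleI) auto

lemma is_right_module: "right_module A M" ..

end

lemma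
  assumes "rsubmodule A N M"
  shows rsubmodule_subset: "N \<subseteq> carrier M"
    and rsubmodule_zero_closed: "\<zero>\<^bsub>M\<^esub> \<in> N"
    and rsubmodule_add_closed: "\<lbrakk>x \<in> N; y \<in> N\<rbrakk> \<Longrightarrow> x \<oplus>\<^bsub>M\<^esub> y \<in> N"
    and rsubmodule_ract_closed: "\<lbrakk>x \<in> N; a \<in> carrier A\<rbrakk> \<Longrightarrow> x \<bullet>\<^bsub>M\<^esub> a \<in> N"
    and rsubmodule_inv_closed: "abelian_group M \<Longrightarrow> x \<in> N \<Longrightarrow> \<ominus>\<^bsub>M\<^esub> x \<in> N"
    and rsubmodule_minus_closed: "abelian_group M \<Longrightarrow> \<lbrakk>x \<in> N; y \<in> N\<rbrakk> \<Longrightarrow> x \<ominus>\<^bsub>M\<^esub> y \<in> N"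
    and rsubmodule_additive: "additive_subgroup N M"
proof -
  show *: "additive_subgroup N M" using assms by (simp add: rsubmodule_def)
  interpret additive_subgroup N M by fact
  show "N \<subseteq> carrier M" by (rule a_subset)
  show "\<zero>\<^bsub>M\<^esub> \<in> N" by simp
  show "\<lbrakk>x \<in> N; y \<in> N\<rbrakk> \<Longrightarrow> x \<oplus>\<^bsub>M\<^esub> y \<in> N" by simp
  show "\<lbrakk>x \<in> N; a \<in> carrier A\<rbrakk> \<Longrightarrow> x \<bullet>\<^bsub>M\<^esub> a \<in> N" using assms by (simp add: rsubmodule_def)
  show inv: "\<ominus>\<^bsub>M\<^esub> x \<in> N" if "abelian_group M" "x \<in> N" for x
  proof -
    interpret abelian_group M by fact
    show ?thesis using \<open>x \<in> N\<close> by simp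
  qed
  show "abelian_group M \<Longrightarrow> \<lbrakk>x \<in> N; y \<in> N\<rbrakk> \<Longrightarrow> x \<ominus>\<^bsub>M\<^esub> y \<in> N"
    by (simp add: a_minus_def inv)
qed

lemma right_moduleI:
  assumes "ring A" "abelian_group M"
    and "\<And>x a. \<lbrakk>x \<in> carrier M; a \<in> carrier A\<rbrakk> \<Longrightarrow> x \<bullet>\<^bsub>M\<^esub> a \<in> carrier M"
    and "\<And>x y a. \<lbrakk>x \<in> carrier M; y \<in> carrier M; a \<in> carrier A\<rbrakk>
      \<Longrightarrow> (x \<oplus>\<^bsub>M\<^esub> y) \<bullet>\<^bsub>M\<^esub> a = x \<bullet>\<^bsub>M\<^esub> a \<oplus>\<^bsub>M\<^esub> y \<bullet>\<^bsub>M\<^esub> a"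
    and "\<And>x a b. \<lbrakk>x \<in> carrier M; a \<in> carrier A; b \<in> carrier A\<rbrakk>
      \<Longrightarrow> x \<bullet>\<^bsub>M\<^esub> (a \<oplus>\<^bsub>A\<^esub> b) = x \<bullet>\<^bsub>M\<^esub> a \<oplus>\<^bsub>M\<^esub> x \<bullet>\<^bsub>M\<^esub> b"
    and "\<And>x a b. \<lbrakk>x \<in> carrier M; a \<in> carrier A; b \<in> carrier A\<rbrakk>
      \<Longrightarrow> x \<bullet>\<^bsub>M\<^esub> (a \<otimes>\<^bsub>A\<^esub> b) = (x \<bullet>\<^bsub>M\<^esub> a) \<bullet>\<^bsub>M\<^esub> b"
    and "\<And>x. x \<in> carrier M \<Longrightarrow> x \<bullet>\<^bsub>M\<^esub> \<one>\<^bsub>A\<^esub> = x"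
  shows "right_module A M"
  using assms by (simp add: right_module_def right_module_axioms_def)

text \<open>
  The module axioms are inherited along a surjection that respects the operations; quotients and
  modules transported along a bijection arise in this way.
\<close>

lemma right_module_image:
  fixes M :: "('a, 'm) rmodule" and Q :: "('a, 'q) rmodule"
  assumes "right_module A M"
    and onto: "\<phi> ` carrier M = carrier Q" and hzero: "\<phi> \<zero>\<^bsub>M\<^esub> = \<zero>\<^bsub>Q\<^esub>"
    and hadd: "\<And>x y. \<lbrakk>x \<in> carrier M; y \<in> carrier M\<rbrakk> \<Longrightarrow> \<phi> (x \<oplus>\<^bsub>M\<^esub> y) = \<phi> x \<oplus>\<^bsub>Q\<^esub> \<phi> y"
    and hract: "\<And>x a. \<lbrakk>x \<in> carrier M; a \<in> carrier A\<rbrakk> \<Longrightarrow> \<phi> (x \<bullet>\<^bsub>M\<^esub> a) = \<phi> x \<bullet>\<^bsub>Q\<^esub> a"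
  shows "right_module A Q"
proof -
  interpret right_module A M by fact
  have surj: "\<exists>x\<in>carrier M. q = \<phi> x" if "q \<in> carrier Q" for q using that onto by auto
  have cl: "\<phi> x \<in> carrier Q" if "x \<in> carrier M" for x using that onto by auto
  show ?thesis
  proof (rule right_moduleI)
    show "abelian_group Q"
    proof (rule abelian_groupI)
      show "\<zero>\<^bsub>Q\<^esub> \<in> carrier Q" using hzero cl[OF M.zero_closed] by simp
      fix x y assume "x \<in> carrier Q" "y \<in> carrier Q"
      then obtain x' y' where x: "x' \<in> carrier M" "x = \<phi> x'" and y: "y' \<in> carrier M" "y = \<phi> y'"
        using surj by blast
      show "x \<oplus>\<^bsub>Q\<^esub> y \<in> carrier Q" using x y hadd[of x' y'] cl[of "x' \<oplus>\<^bsub>M\<^esub> y'"] by simp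
      show "x \<oplus>\<^bsub>Q\<^esub> y = y \<oplus>\<^bsub>Q\<^esub> x"
        using x y hadd[of x' y'] hadd[of y' x'] by (simp add: M.a_comm)
      show "\<zero>\<^bsub>Q\<^esub> \<oplus>\<^bsub>Q\<^esub> x = x" using x hadd[of "\<zero>\<^bsub>M\<^esub>" x'] hzero by simp
      show "\<exists>y\<in>carrier Q. y \<oplus>\<^bsub>Q\<^esub> x = \<zero>\<^bsub>Q\<^esub>"
        using x hadd[of "\<ominus>\<^bsub>M\<^esub> x'" x'] hzero cl[of "\<ominus>\<^bsub>M\<^esub> x'"] by (auto simp: M.l_neg)
      fix z assume "z \<in> carrier Q"
      then obtain z' where z: "z' \<in> carrier M" "z = \<phi> z'" using surj by blast
      show "(x \<oplus>\<^bsub>Q\<^esub> y) \<oplus>\<^bsub>Q\<^esub> z = x \<oplus>\<^bsub>Q\<^esub> (y \<oplus>\<^bsub>Q\<^esub> z)"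
        using x y z hadd[of x' y'] hadd[of y' z'] hadd[of "x' \<oplus>\<^bsub>M\<^esub> y'" z']
          hadd[of x' "y' \<oplus>\<^bsub>M\<^esub> z'"] by (simp add: M.a_assoc)
    qed
    fix x a assume "x \<in> carrier Q" and a: "a \<in> carrier A"
    then obtain x' where x: "x' \<in> carrier M" "x = \<phi> x'" using surj by blast
    show "x \<bullet>\<^bsub>Q\<^esub> a \<in> carrier Q"
      using x a hract[of x' a] cl[of "x' \<bullet>\<^bsub>M\<^esub> a"] by (simp add: ract_closed)
    show "(x \<oplus>\<^bsub>Q\<^esub> y) \<bullet>\<^bsub>Q\<^esub> a = x \<bullet>\<^bsub>Q\<^esub> a \<oplus>\<^bsub>Q\<^esub> y \<bullet>\<^bsub>Q\<^esub> a" if "y \<in> carrier Q" for y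
    proof -
      from surj[OF that] obtain y' where y: "y' \<in> carrier M" "y = \<phi> y'" by blast
      have "(x \<oplus>\<^bsub>Q\<^esub> y) \<bullet>\<^bsub>Q\<^esub> a = \<phi> ((x' \<oplus>\<^bsub>M\<^esub> y') \<bullet>\<^bsub>M\<^esub> a)"
        by (simp only: hadd hract M.a_closed x y a)
      also have "\<dots> = \<phi> (x' \<bullet>\<^bsub>M\<^esub> a \<oplus>\<^bsub>M\<^esub> y' \<bullet>\<^bsub>M\<^esub> a)"
        by (simp only: ract_add_left x y a)
      also have "\<dots> = x \<bullet>\<^bsub>Q\<^esub> a \<oplus>\<^bsub>Q\<^esub> y \<bullet>\<^bsub>Q\<^esub> a"
        by (simp only: hadd hract ract_closed x y a)
      finally show ?thesis .
    qed
    fix b assume b: "b \<in> carrier A"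
    show "x \<bullet>\<^bsub>Q\<^esub> (a \<oplus>\<^bsub>A\<^esub> b) = x \<bullet>\<^bsub>Q\<^esub> a \<oplus>\<^bsub>Q\<^esub> x \<bullet>\<^bsub>Q\<^esub> b"
      using x a b hract[of x' "a \<oplus>\<^bsub>A\<^esub> b"] hract[of x' a] hract[of x' b]
        hadd[of "x' \<bullet>\<^bsub>M\<^esub> a" "x' \<bullet>\<^bsub>M\<^esub> b"] by (simp add: ract_add_right ract_closed)
    show "x \<bullet>\<^bsub>Q\<^esub> (a \<otimes>\<^bsub>A\<^esub> b) = (x \<bullet>\<^bsub>Q\<^esub> a) \<bullet>\<^bsub>Q\<^esub> b"
      using x a b hract[of x' "a \<otimes>\<^bsub>A\<^esub> b"] hract[of x' a] hract[of "x' \<bullet>\<^bsub>M\<^esub> a" b]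
      by (simp add: ract_mult ract_closed)
  next
    fix x assume "x \<in> carrier Q"
    then obtain x' where x: "x' \<in> carrier M" "x = \<phi> x'" using surj by blast
    then show "x \<bullet>\<^bsub>Q\<^esub> \<one>\<^bsub>A\<^esub> = x" using hract[of x' "\<one>\<^bsub>A\<^esub>"] by (simp add: ract_one)
  qed (rule A.ring_axioms)
qed

lemma right_module_submodule:
  assumes "right_module A M" "rsubmodule A N M"
  shows "right_module A (M\<lparr>carrier := N\<rparr>)"
proof -
  interpret right_module A M by fact
  note N = rsubmodule_zero_closed[OF assms(2)] rsubmodule_add_closed[OF assms(2)]
    rsubmodule_ract_closed[OF assms(2)] rsubmodule_inv_closed[OF assms(2) M.abelian_group_axioms]
    subsetD[OF rsubmodule_subset[OF assms(2)]]
  show ?thesis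
  proof (rule right_moduleI)
    show "abelian_group (M\<lparr>carrier := N\<rparr>)"
    proof (rule abelian_groupI; simp)
      fix x assume "x \<in> N"
      then show "\<exists>y\<in>N. y \<oplus>\<^bsub>M\<^esub> x = \<zero>\<^bsub>M\<^esub>" using N by (metis M.l_neg)
    qed (use N in \<open>auto simp: M.a_ac\<close>)
  qed (use N in \<open>auto simp: ract_add_left ract_add_right ract_mult ract_one A.ring_axioms\<close>)
qed

subsection \<open>Generated submodules\<close>

lemma
  assumes "right_module A M" "Z \<subseteq> carrier M"
  shows gen_submodule_rsubmodule: "rsubmodule A (gen_submodule A M Z) M"
    and gen_submodule_incl: "Z \<subseteq> gen_submodule A M Z"
proof -
  interpret right_module A M by fact
  show "Z \<subseteq> gen_submodule A M Z" by (auto simp: gen_submodule_def)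
  show "rsubmodule A (gen_submodule A M Z) M"
  proof (rule rsubmoduleI)
    show "gen_submodule A M Z \<subseteq> carrier M"
      using rsubmodule_carrier assms(2) by (auto simp: gen_submodule_def)
  qed (auto simp: gen_submodule_def rsubmodule_zero_closed rsubmodule_add_closed
      rsubmodule_ract_closed)
qed

lemma gen_submodule_least:
  "rsubmodule A N M \<Longrightarrow> Z \<subseteq> N \<Longrightarrow> gen_submodule A M Z \<subseteq> N"
  by (auto simp: gen_submodule_def)

subsection \<open>Homomorphisms\<close>

lemma
  assumes "f \<in> rhom A M N"
  shows rhom_closed: "x \<in> carrier M \<Longrightarrow> f x \<in> carrier N"
    and rhom_add: "\<lbrakk>x \<in> carrier M; y \<in> carrier M\<rbrakk> \<Longrightarrow> f (x \<oplus>\<^bsub>M\<^esub> y) = f x \<oplus>\<^bsub>N\<^esub> f y"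
    and rhom_ract: "\<lbrakk>x \<in> carrier M; a \<in> carrier A\<rbrakk> \<Longrightarrow> f (x \<bullet>\<^bsub>M\<^esub> a) = f x \<bullet>\<^bsub>N\<^esub> a"
    and rhom_extensional: "f \<in> extensional (carrier M)"
  using assms by (auto simp: rhom_def PiE_def)

lemma rhomI:
  assumes "\<And>x. x \<in> carrier M \<Longrightarrow> f x \<in> carrier N"
    and "\<And>x y. \<lbrakk>x \<in> carrier M; y \<in> carrier M\<rbrakk> \<Longrightarrow> f (x \<oplus>\<^bsub>M\<^esub> y) = f x \<oplus>\<^bsub>N\<^esub> f y"
    and "\<And>x a. \<lbrakk>x \<in> carrier M; a \<in> carrier A\<rbrakk> \<Longrightarrow> f (x \<bullet>\<^bsub>M\<^esub> a) = f x \<bullet>\<^bsub>N\<^esub> a"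
    and "f \<in> extensional (carrier M)"
  shows "f \<in> rhom A M N"
  using assms by (auto simp: rhom_def PiE_def)

lemma restrict_rhomI:
  assumes "right_module A M"
    and "\<And>x. x \<in> carrier M \<Longrightarrow> f x \<in> carrier N"
    and "\<And>x y. \<lbrakk>x \<in> carrier M; y \<in> carrier M\<rbrakk> \<Longrightarrow> f (x \<oplus>\<^bsub>M\<^esub> y) = f x \<oplus>\<^bsub>N\<^esub> f y"
    and "\<And>x a. \<lbrakk>x \<in> carrier M; a \<in> carrier A\<rbrakk> \<Longrightarrow> f (x \<bullet>\<^bsub>M\<^esub> a) = f x \<bullet>\<^bsub>N\<^esub> a"
  shows "restrict f (carrier M) \<in> rhom A M N"
proof -
  interpret right_module A M by fact
  show ?thesis using assms(2-4) by (intro rhomI) (auto simp: ract_closed)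
qed

lemma rhom_eqI:
  assumes "f \<in> rhom A M N" "g \<in> rhom A M N'" "\<And>x. x \<in> carrier M \<Longrightarrow> f x = g x"
  shows "f = g"
  by (rule extensionalityI[OF rhom_extensional[OF assms(1)] rhom_extensional[OF assms(2)] assms(3)])

lemma
  assumes "right_module A M" "right_module A N" "f \<in> rhom A M N"
  shows rhom_zero: "f \<zero>\<^bsub>M\<^esub> = \<zero>\<^bsub>N\<^esub>"
    and rhom_inv: "x \<in> carrier M \<Longrightarrow> f (\<ominus>\<^bsub>M\<^esub> x) = \<ominus>\<^bsub>N\<^esub> f x"
    and rhom_minus: "\<lbrakk>x \<in> carrier M; y \<in> carrier M\<rbrakk> \<Longrightarrow> f (x \<ominus>\<^bsub>M\<^esub> y) = f x \<ominus>\<^bsub>N\<^esub> f y"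
proof -
  interpret M: right_module A M by fact
  interpret N: right_module A N by fact
  note [simp] = rhom_closed[OF assms(3)] rhom_add[OF assms(3)]
  show zero: "f \<zero>\<^bsub>M\<^esub> = \<zero>\<^bsub>N\<^esub>"
    using rhom_add[OF assms(3), of "\<zero>\<^bsub>M\<^esub>" "\<zero>\<^bsub>M\<^esub>"]
    by (metis M.M.l_zero M.M.zero_closed N.M.add.r_cancel_one' rhom_closed[OF assms(3)])
  show inv: "f (\<ominus>\<^bsub>M\<^esub> x) = \<ominus>\<^bsub>N\<^esub> f x" if "x \<in> carrier M" for x
    using rhom_add[OF assms(3), of "\<ominus>\<^bsub>M\<^esub> x" x] that
    by (metis M.M.a_inv_closed M.M.l_neg N.M.minus_equality rhom_closed[OF assms(3)] zero)
  show "\<lbrakk>x \<in> carrier M; y \<in> carrier M\<rbrakk> \<Longrightarrow> f (x \<ominus>\<^bsub>M\<^esub> y) = f x \<ominus>\<^bsub>N\<^esub> f y"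
    by (simp add: a_minus_def inv)
qed

lemma compose_rhom:
  assumes "right_module A M" "f \<in> rhom A M N" "g \<in> rhom A N L"
  shows "compose (carrier M) g f \<in> rhom A M L"
proof -
  interpret right_module A M by fact
  show ?thesis
    using rhom_closed[OF assms(2)] rhom_add[OF assms(2)] rhom_ract[OF assms(2)]
      rhom_closed[OF assms(3)] rhom_add[OF assms(3)] rhom_ract[OF assms(3)]
    by (intro rhomI) (auto simp: compose_def ract_closed)
qed

lemma zero_rhom:
  assumes "right_module A M" "right_module A N"
  shows "(\<lambda>x\<in>carrier M. \<zero>\<^bsub>N\<^esub>) \<in> rhom A M N"
proof -
  interpret N: right_module A N by fact
  show ?thesis by (rule restrict_rhomI[OF assms(1)]) auto
qed

lemma id_rhom: "right_module A M \<Longrightarrow> (\<lambda>x\<in>carrier M. x) \<in> rhom A M M"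
  by (rule restrict_rhomI) auto

lemma add_rhom:
  assumes "right_module A M" "right_module A N" "f \<in> rhom A M N" "g \<in> rhom A M N"
  shows "(\<lambda>x\<in>carrier M. f x \<oplus>\<^bsub>N\<^esub> g x) \<in> rhom A M N"
proof -
  interpret N: right_module A N by fact
  show ?thesis
    using rhom_closed[OF assms(3)] rhom_closed[OF assms(4)] rhom_add[OF assms(3)]
      rhom_add[OF assms(4)] rhom_ract[OF assms(3)] rhom_ract[OF assms(4)]
    by (intro restrict_rhomI[OF assms(1)]) (auto simp: N.M.a_ac N.ract_add_left)
qed

lemma inv_rhom:
  assumes "right_module A M" "right_module A N" "f \<in> rhom A M N"
  shows "(\<lambda>x\<in>carrier M. \<ominus>\<^bsub>N\<^esub> f x) \<in> rhom A M N"
proof -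
  interpret N: right_module A N by fact
  show ?thesis
    using rhom_closed[OF assms(3)] rhom_add[OF assms(3)] rhom_ract[OF assms(3)]
    by (intro restrict_rhomI[OF assms(1)]) (auto simp: N.M.minus_add N.M.a_comm N.ract_inv_left)
qed

lemma minus_rhom:
  assumes "right_module A M" "right_module A N" "f \<in> rhom A M N" "g \<in> rhom A M N"
  shows "(\<lambda>x\<in>carrier M. f x \<ominus>\<^bsub>N\<^esub> g x) \<in> rhom A M N"
  using add_rhom[OF assms(1-3) inv_rhom[OF assms(1,2,4)]]
  by (simp add: a_minus_def cong: restrict_cong)

lemma rhom_submodule:
  assumes "L \<subseteq> carrier N"
  shows "f \<in> rhom A M (N\<lparr>carrier := L\<rparr>) \<longleftrightarrow> f \<in> rhom A M N \<and> f ` carrier M \<subseteq> L"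
  using assms by (fastforce simp: rhom_def PiE_def Pi_def)

lemma restrict_submodule_rhom:
  assumes "f \<in> rhom A M N" "right_module A M" "rsubmodule A L M"
  shows "restrict f L \<in> rhom A (M\<lparr>carrier := L\<rparr>) N"
proof -
  have "restrict f (carrier (M\<lparr>carrier := L\<rparr>)) \<in> rhom A (M\<lparr>carrier := L\<rparr>) N"
    using rsubmodule_subset[OF assms(3)]
    by (intro restrict_rhomI[OF right_module_submodule[OF assms(2,3)]])
      (auto simp: rhom_closed[OF assms(1)] rhom_add[OF assms(1)] rhom_ract[OF assms(1)] subsetD)
  then show ?thesis by simp
qed

lemma rhom_image_rsubmodule:
  assumes "right_module A M" "right_module A N" "f \<in> rhom A M N" "rsubmodule A L M"
  shows "rsubmodule A (f ` L) N"
proof -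
  interpret N: right_module A N by fact
  note L = rsubmodule_subset[OF assms(4)]
  show ?thesis
  proof (rule N.rsubmoduleI)
    show "f ` L \<subseteq> carrier N" using L rhom_closed[OF assms(3)] by auto
    show "\<zero>\<^bsub>N\<^esub> \<in> f ` L"
      using rhom_zero[OF assms(1-3)] rsubmodule_zero_closed[OF assms(4)] by (metis imageI)
    fix x assume "x \<in> f ` L"
    then obtain x' where x: "x' \<in> L" "x = f x'" by auto
    show "x \<oplus>\<^bsub>N\<^esub> y \<in> f ` L" if "y \<in> f ` L" for y
    proof -
      from that obtain y' where y: "y' \<in> L" "y = f y'" by blast
      then show ?thesis
        using x L rhom_add[OF assms(3), of x' y'] rsubmodule_add_closed[OF assms(4) x(1) y(1)]
        by (metis image_eqI subsetD)
    qed
    show "x \<bullet>\<^bsub>N\<^esub> a \<in> f ` L" if "a \<in> carrier A" for a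
      using x L rhom_ract[OF assms(3), of x' a] that rsubmodule_ract_closed[OF assms(4) x(1) that]
      by (metis image_eqI subsetD)
  qed
qed

lemma rhom_vimage_rsubmodule:
  assumes "right_module A M" "right_module A N" "f \<in> rhom A M N" "rsubmodule A L N"
  shows "rsubmodule A {x \<in> carrier M. f x \<in> L} M"
proof -
  interpret M: right_module A M by fact
  show ?thesis
    using rhom_zero[OF assms(1-3)] rsubmodule_zero_closed[OF assms(4)]
    by (intro M.rsubmoduleI) (auto simp: rhom_add[OF assms(3)] rhom_ract[OF assms(3)]
        rsubmodule_add_closed[OF assms(4)] rsubmodule_ract_closed[OF assms(4)] M.ract_closed)
qed

lemma rhom_ker_rsubmodule:
  assumes "right_module A M" "right_module A N" "f \<in> rhom A M N"
  shows "rsubmodule A {x \<in> carrier M. f x = \<zero>\<^bsub>N\<^esub>} M"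
  using rhom_vimage_rsubmodule[OF assms right_module.rsubmodule_zero[OF assms(2)]] by simp

lemma rhom_inj_onI:
  assumes "right_module A M" "right_module A N" "f \<in> rhom A M N"
    and "\<And>x. x \<in> carrier M \<Longrightarrow> f x = \<zero>\<^bsub>N\<^esub> \<Longrightarrow> x = \<zero>\<^bsub>M\<^esub>"
  shows "inj_on f (carrier M)"
proof (rule inj_onI)
  interpret M: right_module A M by fact
  interpret N: right_module A N by fact
  fix x y assume *: "x \<in> carrier M" "y \<in> carrier M" "f x = f y"
  then have "f (x \<ominus>\<^bsub>M\<^esub> y) = \<zero>\<^bsub>N\<^esub>"
    using rhom_closed[OF assms(3)] *(2) by (simp add: rhom_minus[OF assms(1-3)])
  then have "x \<ominus>\<^bsub>M\<^esub> y = \<zero>\<^bsub>M\<^esub>" using * assms(4) by simp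
  then show "x = y" using * by simp
qed

subsection \<open>Isomorphisms\<close>

lemma inv_into_rhom:
  assumes "right_module A M" "right_module A N" "f \<in> rhom A M N" "bij_betw f (carrier M) (carrier N)"
  shows "restrict (inv_into (carrier M) f) (carrier N) \<in> rhom A N M"
proof -
  interpret M: right_module A M by fact
  interpret N: right_module A N by fact
  let ?g = "inv_into (carrier M) f"
  have g: "?g y \<in> carrier M" "f (?g y) = y" if "y \<in> carrier N" for y
    using that assms(4) by (auto simp: bij_betw_def inv_into_into f_inv_into_f)
  have inj: "inj_on f (carrier M)" using assms(4) by (simp add: bij_betw_def)
  show ?thesis
  proof (rule restrict_rhomI[OF assms(2)])
    fix x assume x: "x \<in> carrier N"
    show "?g x \<in> carrier M" using x g by simp
    show "?g (x \<oplus>\<^bsub>N\<^esub> y) = ?g x \<oplus>\<^bsub>M\<^esub> ?g y" if "y \<in> carrier N" for y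
      by (rule inj_onD[OF inj]) (use x that g rhom_add[OF assms(3)] in auto)
    show "?g (x \<bullet>\<^bsub>N\<^esub> a) = ?g x \<bullet>\<^bsub>M\<^esub> a" if "a \<in> carrier A" for a
      by (rule inj_onD[OF inj])
        (use x that g rhom_ract[OF assms(3)] in \<open>auto simp: N.ract_closed M.ract_closed\<close>)
  qed
qed

lemma rmod_iso_sym:
  assumes "right_module A M" "right_module A N" "rmod_iso A M N"
  shows "rmod_iso A N M"
proof -
  obtain f where f: "f \<in> rhom A M N" "bij_betw f (carrier M) (carrier N)"
    using assms(3) by (auto simp: rmod_iso_def)
  have "bij_betw (restrict (inv_into (carrier M) f) (carrier N)) (carrier N) (carrier M)"
    using bij_betw_inv_into[OF f(2)] by (simp add: bij_betw_restrict_eq)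
  then show ?thesis using inv_into_rhom[OF assms(1,2) f] unfolding rmod_iso_def by blast
qed

lemma rmod_iso_trans:
  assumes "right_module A M" "rmod_iso A M N" "rmod_iso A N L"
  shows "rmod_iso A M L"
proof -
  obtain f where f: "f \<in> rhom A M N" "bij_betw f (carrier M) (carrier N)"
    using assms(2) by (auto simp: rmod_iso_def)
  obtain g where g: "g \<in> rhom A N L" "bij_betw g (carrier N) (carrier L)"
    using assms(3) by (auto simp: rmod_iso_def)
  have "bij_betw (compose (carrier M) g f) (carrier M) (carrier L)"
    using bij_betw_trans[OF f(2) g(2)] by (simp add: compose_def bij_betw_restrict_eq comp_def)
  then show ?thesis using compose_rhom[OF assms(1) f(1) g(1)] by (auto simp: rmod_iso_def)
qed

lemma fg_rmodule_image:
  assumes "fg_rmodule A M" "right_module A N" "f \<in> rhom A M N" "f ` carrier M = carrier N"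
  shows "fg_rmodule A N"
proof -
  have M: "right_module A M" using assms(1) by (simp add: fg_rmodule_def)
  obtain Z where Z: "finite Z" "Z \<subseteq> carrier M" "gen_submodule A M Z = carrier M"
    using assms(1) by (auto simp: fg_rmodule_def)
  have fZ: "f ` Z \<subseteq> carrier N" using Z(2) assms(4) by auto
  have "Z \<subseteq> {x \<in> carrier M. f x \<in> gen_submodule A N (f ` Z)}"
    using Z(2) gen_submodule_incl[OF assms(2) fZ] by auto
  then have "gen_submodule A M Z \<subseteq> {x \<in> carrier M. f x \<in> gen_submodule A N (f ` Z)}"
    by (intro gen_submodule_least rhom_vimage_rsubmodule[OF M assms(2,3)]
      gen_submodule_rsubmodule[OF assms(2) fZ])
  then have sub: "f x \<in> gen_submodule A N (f ` Z)" if "x \<in> carrier M" for x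
    using that Z(3) by auto
  have "carrier N \<subseteq> gen_submodule A N (f ` Z)"
  proof
    fix y assume "y \<in> carrier N"
    then obtain x where "x \<in> carrier M" "y = f x" using assms(4) by (metis imageE)
    then show "y \<in> gen_submodule A N (f ` Z)" using sub by simp
  qed
  then have "gen_submodule A N (f ` Z) = carrier N"
    using rsubmodule_subset[OF gen_submodule_rsubmodule[OF assms(2) fZ]] by blast
  then show ?thesis using Z(1) fZ assms(2) by (auto simp: fg_rmodule_def intro!: exI[of _ "f ` Z"])
qed

subsection \<open>Quotients and powers\<close>

lemma (in right_module) quot_rmod_facts:
  assumes "rsubmodule A N M"
  shows quot_rmod_right_module: "right_module A (quot_rmod M N)"
    and quot_rmod_carrier: "carrier (quot_rmod M N) = (\<lambda>x. N +>\<^bsub>M\<^esub> x) ` carrier M"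
    and quot_rmod_rhom: "(\<lambda>x\<in>carrier M. N +>\<^bsub>M\<^esub> x) \<in> rhom A M (quot_rmod M N)"
    and quot_rmod_eq_iff: "\<lbrakk>x \<in> carrier M; y \<in> carrier M\<rbrakk> \<Longrightarrow>
      N +>\<^bsub>M\<^esub> x = N +>\<^bsub>M\<^esub> y \<longleftrightarrow> x \<ominus>\<^bsub>M\<^esub> y \<in> N"
    and quot_rmod_self: "x \<in> carrier M \<Longrightarrow> x \<in> N +>\<^bsub>M\<^esub> x"
proof -
  interpret N: abelian_subgroup N M
    using rsubmodule_additive[OF assms] M.abelian_group_axioms
    by (intro abelian_subgroupI3)
  note Ns = rsubmodule_subset[OF assms]
  show carr: "carrier (quot_rmod M N) = (\<lambda>x. N +>\<^bsub>M\<^esub> x) ` carrier M"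
    by (auto simp: quot_rmod_def A_RCOSETS_def')
  show self: "x \<in> N +>\<^bsub>M\<^esub> x" if "x \<in> carrier M" for x
    using that by (rule N.a_rcos_self)
  show eq: "N +>\<^bsub>M\<^esub> x = N +>\<^bsub>M\<^esub> y \<longleftrightarrow> x \<ominus>\<^bsub>M\<^esub> y \<in> N"
    if "x \<in> carrier M" "y \<in> carrier M" for x y
    using N.a_rcos_module[OF that(2,1)] N.a_repr_independence'[OF _ that(2)]
      self[OF that(1)] by (auto simp: a_minus_def)
  have add: "N +>\<^bsub>M\<^esub> (x \<oplus>\<^bsub>M\<^esub> y) = (N +>\<^bsub>M\<^esub> x) <+>\<^bsub>M\<^esub> (N +>\<^bsub>M\<^esub> y)"
    if "x \<in> carrier M" "y \<in> carrier M" for x y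
    using N.a_rcos_sum[OF that] by simp
  have ract: "N +>\<^bsub>M\<^esub> (x \<bullet>\<^bsub>M\<^esub> a) = (\<Union>z\<in>N +>\<^bsub>M\<^esub> x. N +>\<^bsub>M\<^esub> (z \<bullet>\<^bsub>M\<^esub> a))"
    if x: "x \<in> carrier M" and a: "a \<in> carrier A" for x a
  proof -
    have "N +>\<^bsub>M\<^esub> (z \<bullet>\<^bsub>M\<^esub> a) = N +>\<^bsub>M\<^esub> (x \<bullet>\<^bsub>M\<^esub> a)" if "z \<in> N +>\<^bsub>M\<^esub> x" for z
    proof -
      have z: "z \<in> carrier M" using N.a_elemrcos_carrier[OF x that] .
      have "N +>\<^bsub>M\<^esub> x = N +>\<^bsub>M\<^esub> z" using N.a_repr_independence'[OF that x] by simp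
      then have "z \<ominus>\<^bsub>M\<^esub> x \<in> N" using eq x z by metis
      then have "z \<bullet>\<^bsub>M\<^esub> a \<ominus>\<^bsub>M\<^esub> x \<bullet>\<^bsub>M\<^esub> a \<in> N"
        using rsubmodule_ract_closed[OF assms _ a] x z a by (metis ract_minus_left)
      then show ?thesis using eq x z a by (simp add: ract_closed)
    qed
    then show ?thesis using self[OF x] by blast
  qed
  show rm: "right_module A (quot_rmod M N)"
  proof (rule right_module_image[OF is_right_module, where \<phi> = "\<lambda>x. N +>\<^bsub>M\<^esub> x"])
    show "(\<lambda>x. N +>\<^bsub>M\<^esub> x) ` carrier M = carrier (quot_rmod M N)" using carr by simp
    show "N +>\<^bsub>M\<^esub> \<zero>\<^bsub>M\<^esub> = \<zero>\<^bsub>quot_rmod M N\<^esub>" using Ns by (simp add: quot_rmod_def)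
  qed (use add ract in \<open>simp_all add: quot_rmod_def\<close>)
  show "(\<lambda>x\<in>carrier M. N +>\<^bsub>M\<^esub> x) \<in> rhom A M (quot_rmod M N)"
    by (rule restrict_rhomI[OF is_right_module])
      (use add ract carr in \<open>auto simp add: quot_rmod_def\<close>)
qed

lemma power_rmod_simps [simp]:
  "carrier (power_rmod M n) = {..<n} \<rightarrow>\<^sub>E carrier M"
  "\<zero>\<^bsub>power_rmod M n\<^esub> = (\<lambda>i\<in>{..<n}. \<zero>\<^bsub>M\<^esub>)"
  "f \<oplus>\<^bsub>power_rmod M n\<^esub> g = (\<lambda>i\<in>{..<n}. f i \<oplus>\<^bsub>M\<^esub> g i)"
  "f \<bullet>\<^bsub>power_rmod M n\<^esub> a = (\<lambda>i\<in>{..<n}. f i \<bullet>\<^bsub>M\<^esub> a)"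
  by (simp_all add: power_rmod_def)

lemma power_rmod_right_module:
  fixes M :: "('a, 'b) rmodule"
  assumes "right_module A M" shows "right_module A (power_rmod M n)"
proof -
  interpret M: right_module A M by fact
  show ?thesis
  proof (rule right_moduleI)
    have ext: "x = y" if "x \<in> extensional {..<n}" "y \<in> extensional {..<n}"
      "\<And>i. i < n \<Longrightarrow> x i = y i" for x y :: "nat \<Rightarrow> 'b"
      using that by (intro extensionalityI[of x "{..<n}"]) auto
    show "abelian_group (power_rmod M n)"
    proof (rule abelian_groupI)
      fix x assume x: "x \<in> carrier (power_rmod M n)"
      show "\<exists>y\<in>carrier (power_rmod M n). y \<oplus>\<^bsub>power_rmod M n\<^esub> x = \<zero>\<^bsub>power_rmod M n\<^esub>"
        using x by (intro bexI[of _ "\<lambda>i\<in>{..<n}. \<ominus>\<^bsub>M\<^esub> x i"])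
          (auto simp: M.M.l_neg PiE_iff intro!: restrict_ext)
      show "\<zero>\<^bsub>power_rmod M n\<^esub> \<oplus>\<^bsub>power_rmod M n\<^esub> x = x"
        using x by (intro ext) (auto simp: PiE_iff)
    qed (auto simp: PiE_iff M.M.a_ac intro!: restrict_ext)
    fix x assume x: "x \<in> carrier (power_rmod M n)"
    show "x \<bullet>\<^bsub>power_rmod M n\<^esub> \<one>\<^bsub>A\<^esub> = x"
      using x by (intro ext) (auto simp: PiE_iff M.ract_one)
  qed (auto simp: PiE_iff M.ract_closed M.ract_add_left M.ract_add_right M.ract_mult
        M.A.ring_axioms intro!: restrict_ext)
qed

lemma power_rmod_coordinate_rhom:
  assumes "right_module A M" "i < n"
  shows "(\<lambda>f\<in>carrier (power_rmod M n). f i) \<in> rhom A (power_rmod M n) M"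
  by (rule restrict_rhomI[OF power_rmod_right_module[OF assms(1)]]) (use assms(2) in \<open>auto simp: PiE_iff\<close>)

lemma direct_summand_carrier:
  assumes "right_module A M" shows "direct_summand A (carrier M) M"
proof -
  interpret M: right_module A M by fact
  have "carrier M <+>\<^bsub>M\<^esub> {\<zero>\<^bsub>M\<^esub>} = carrier M"
    by (auto simp: set_add_def')
  then show ?thesis
    using M.rsubmodule_carrier M.rsubmodule_zero by (auto simp: direct_summand_def)
qed

lemma direct_summand_projection:
  assumes "right_module A M" "direct_summand A N M"
  obtains \<pi> where "\<pi> \<in> rhom A M M" "\<pi> ` carrier M \<subseteq> N" "\<And>x. x \<in> N \<Longrightarrow> \<pi> x = x"
proof -
  interpret M: right_module A M by fact
  obtain N' where N: "rsubmodule A N M" and N': "rsubmodule A N' M"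
    and int: "N \<inter> N' = {\<zero>\<^bsub>M\<^esub>}" and sum: "N <+>\<^bsub>M\<^esub> N' = carrier M"
    using assms(2) by (auto simp: direct_summand_def)
  note s = subsetD[OF rsubmodule_subset[OF N]] subsetD[OF rsubmodule_subset[OF N']]
  let ?P = "\<lambda>x a. a \<in> N \<and> (\<exists>b\<in>N'. x = a \<oplus>\<^bsub>M\<^esub> b)"
  have ex: "\<exists>a. ?P x a" if "x \<in> carrier M" for x
    using that unfolding sum[symmetric] by (auto simp: set_add_def')
  have uniq: "a = a'" if "?P x a" "?P x a'" for x a a'
  proof -
    obtain b b' where b: "b \<in> N'" "x = a \<oplus>\<^bsub>M\<^esub> b" "b' \<in> N'" "x = a' \<oplus>\<^bsub>M\<^esub> b'"
      using \<open>?P x a\<close> \<open>?P x a'\<close> by blast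
    have c: "a \<in> carrier M" "a' \<in> carrier M" "b \<in> carrier M" "b' \<in> carrier M"
      using that b s by auto
    have "a \<ominus>\<^bsub>M\<^esub> a' = (a \<oplus>\<^bsub>M\<^esub> b) \<ominus>\<^bsub>M\<^esub> b \<ominus>\<^bsub>M\<^esub> a'"
      using c by (simp add: a_minus_def M.M.a_assoc M.M.r_neg)
    also have "\<dots> = (a' \<oplus>\<^bsub>M\<^esub> b') \<ominus>\<^bsub>M\<^esub> b \<ominus>\<^bsub>M\<^esub> a'" using b by simp
    also have "\<dots> = (a' \<oplus>\<^bsub>M\<^esub> \<ominus>\<^bsub>M\<^esub> a') \<oplus>\<^bsub>M\<^esub> (b' \<ominus>\<^bsub>M\<^esub> b)"
      using c by (simp add: a_minus_def M.M.a_ac)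
    also have "\<dots> = b' \<ominus>\<^bsub>M\<^esub> b" using c by (simp add: M.M.r_neg)
    finally have eq: "a \<ominus>\<^bsub>M\<^esub> a' = b' \<ominus>\<^bsub>M\<^esub> b" .
    have "a \<ominus>\<^bsub>M\<^esub> a' \<in> N"
      using that by (intro rsubmodule_minus_closed[OF N M.M.abelian_group_axioms]) auto
    moreover have "a \<ominus>\<^bsub>M\<^esub> a' \<in> N'"
      unfolding eq using b by (intro rsubmodule_minus_closed[OF N' M.M.abelian_group_axioms]) auto
    ultimately have "a \<ominus>\<^bsub>M\<^esub> a' \<in> N \<inter> N'" by blast
    then have "a \<ominus>\<^bsub>M\<^esub> a' = \<zero>\<^bsub>M\<^esub>" using int by blast
    then show ?thesis using c by simp
  qed
  define p where "p x = (THE a. ?P x a)" for x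
  have p_eq: "p x = a" if "?P x a" for x a
    unfolding p_def using that uniq by (intro the_equality) blast+
  have p_dec: "p x \<in> N" "\<exists>b\<in>N'. x = p x \<oplus>\<^bsub>M\<^esub> b" if "x \<in> carrier M" for x
    using ex[OF that] p_eq by metis+
  have "restrict p (carrier M) \<in> rhom A M M"
  proof (rule restrict_rhomI[OF assms(1)])
    fix x assume x: "x \<in> carrier M"
    obtain b where b: "b \<in> N'" "x = p x \<oplus>\<^bsub>M\<^esub> b" using p_dec(2)[OF x] by blast
    show "p x \<in> carrier M" using p_dec(1)[OF x] s by auto
    show "p (x \<oplus>\<^bsub>M\<^esub> y) = p x \<oplus>\<^bsub>M\<^esub> p y" if y: "y \<in> carrier M" for y
    proof -
      obtain b' where b': "b' \<in> N'" "y = p y \<oplus>\<^bsub>M\<^esub> b'" using p_dec(2)[OF y] by blast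
      have "x \<oplus>\<^bsub>M\<^esub> y = (p x \<oplus>\<^bsub>M\<^esub> b) \<oplus>\<^bsub>M\<^esub> (p y \<oplus>\<^bsub>M\<^esub> b')" using b(2) b'(2) by simp
      also have "\<dots> = (p x \<oplus>\<^bsub>M\<^esub> p y) \<oplus>\<^bsub>M\<^esub> (b \<oplus>\<^bsub>M\<^esub> b')"
        using b(1) b'(1) s p_dec(1)[OF x] p_dec(1)[OF y] by (simp add: M.M.a_ac)
      finally show ?thesis
        using p_dec(1)[OF x] p_dec(1)[OF y] b b' rsubmodule_add_closed[OF N]
          rsubmodule_add_closed[OF N'] by (intro p_eq) blast
    qed
    show "p (x \<bullet>\<^bsub>M\<^esub> a) = p x \<bullet>\<^bsub>M\<^esub> a" if a: "a \<in> carrier A" for a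
    proof -
      have "x \<bullet>\<^bsub>M\<^esub> a = (p x \<oplus>\<^bsub>M\<^esub> b) \<bullet>\<^bsub>M\<^esub> a" using b(2) by simp
      also have "\<dots> = p x \<bullet>\<^bsub>M\<^esub> a \<oplus>\<^bsub>M\<^esub> b \<bullet>\<^bsub>M\<^esub> a"
        using b(1) s p_dec(1)[OF x] a by (simp add: M.ract_add_left)
      finally show ?thesis
        using p_dec(1)[OF x] b a rsubmodule_ract_closed[OF N]
          rsubmodule_ract_closed[OF N'] by (intro p_eq) blast
    qed
  qed
  moreover have "restrict p (carrier M) ` carrier M \<subseteq> N" using p_dec(1) by auto
  moreover have "restrict p (carrier M) x = x" if "x \<in> N" for x
    using that s rsubmodule_zero_closed[OF N'] p_eq[of x x] by (metis M.M.r_zero restrict_apply)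
  ultimately show thesis using that by blast
qed

lemma rhom_finsum:
  assumes "right_module A M" "right_module A N" "f \<in> rhom A M N" "finite I"
    and "\<And>i. i \<in> I \<Longrightarrow> x i \<in> carrier M"
  shows "f (\<Oplus>\<^bsub>M\<^esub>i\<in>I. x i) = (\<Oplus>\<^bsub>N\<^esub>i\<in>I. f (x i))"
proof -
  interpret M: right_module A M by fact
  interpret N: right_module A N by fact
  show ?thesis using assms(4,5)
  proof (induction I)
    case empty
    then show ?case by (simp add: rhom_zero[OF assms(1-3)] M.M.finsum_empty N.M.finsum_empty)
  next
    case (insert i I)
    then show ?case
      by (simp add: M.M.finsum_insert N.M.finsum_insert Pi_def rhom_closed[OF assms(3)]
          rhom_add[OF assms(3)] M.M.finsum_closed)
  qed
qed

lemma regular_simps [simp]: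
  "carrier (regular R) = carrier R" "\<zero>\<^bsub>regular R\<^esub> = \<zero>\<^bsub>R\<^esub>"
  "x \<oplus>\<^bsub>regular R\<^esub> y = x \<oplus>\<^bsub>R\<^esub> y" "x \<bullet>\<^bsub>regular R\<^esub> y = x \<otimes>\<^bsub>R\<^esub> y"
  "a_minus (regular R) = a_minus R"
  by (auto simp: regular_def a_minus_def a_inv_def m_inv_def fun_eq_iff)

lemma regular_right_module:
  assumes "ring R" shows "right_module R (regular R)"
proof -
  interpret R: ring R by fact
  show ?thesis
  proof (rule right_moduleI)
    show "abelian_group (regular R)" by (rule abelian_group_cong[OF R.abelian_group_axioms]) simp_all
  qed (auto simp: R.l_distr R.r_distr R.m_assoc R.ring_axioms)
qed

lemma finsum_regular: "(\<Oplus>\<^bsub>regular R\<^esub>i\<in>I. x i) = (\<Oplus>\<^bsub>R\<^esub>i\<in>I. x i)"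
  by (simp add: finsum_def finprod_def regular_def)

text \<open>
  The maps \<open>\<psi> k\<close> are the coordinates of an embedding of \<open>P\<close> as a direct summand of \<open>A\<^sup>n\<close>, and the
  \<open>p k\<close> are the images of the unit vectors under the projection back to \<open>P\<close>.  This is the only form
  in which projectivity enters.
\<close>

lemma dual_basis:
  fixes P :: "('a, 'p) rmodule"
  assumes "ring A" "in_add A (regular A) P"
  obtains n p \<psi> where "\<And>k. k < n \<Longrightarrow> p k \<in> carrier P"
    and "\<And>k. k < n \<Longrightarrow> \<psi> k \<in> rhom A P (regular A)"
    and "\<And>y. y \<in> carrier P \<Longrightarrow> y = (\<Oplus>\<^bsub>P\<^esub>k\<in>{..<n::nat}. p k \<bullet>\<^bsub>P\<^esub> \<psi> k y)"
proof -
  interpret A: ring A by fact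
  have P: "right_module A P" using assms(2) by (simp add: in_add_def fg_rmodule_def)
  interpret P: right_module A P by fact
  obtain n N f where N: "direct_summand A N (power_rmod (regular A) n)"
    and f: "f \<in> rhom A P ((power_rmod (regular A) n)\<lparr>carrier := N\<rparr>)" "bij_betw f (carrier P) N"
    using assms(2) by (auto simp: in_add_def rmod_iso_def)
  let ?F = "power_rmod (regular A) n"
  have R: "right_module A (regular A)" using assms(1) by (rule regular_right_module)
  have F: "right_module A ?F" by (rule power_rmod_right_module[OF R])
  interpret F: right_module A ?F by fact
  have N_sub: "rsubmodule A N ?F" using N by (simp add: direct_summand_def)
  have f': "f \<in> rhom A P ?F"
    using f(1) rhom_submodule[OF rsubmodule_subset[OF N_sub]] by blast
  obtain \<pi> where \<pi>: "\<pi> \<in> rhom A ?F ?F" "\<pi> ` carrier ?F \<subseteq> N" "\<And>x. x \<in> N \<Longrightarrow> \<pi> x = x"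
    using direct_summand_projection[OF F N] by blast
  define g where "g = restrict (inv_into (carrier P) f) N"
  have g: "g \<in> rhom A (?F\<lparr>carrier := N\<rparr>) P"
    unfolding g_def using inv_into_rhom[OF P right_module_submodule[OF F N_sub] f(1)] f(2) by simp
  have gf: "g (f y) = y" if "y \<in> carrier P" for y
    using that f(2) unfolding g_def by (metis bij_betwE bij_betw_inv_into_left restrict_apply')
  have \<pi>': "\<pi> \<in> rhom A ?F (?F\<lparr>carrier := N\<rparr>)"
    using \<pi>(1,2) rhom_submodule[OF rsubmodule_subset[OF N_sub]] by blast
  define h where "h = compose (carrier ?F) g \<pi>"
  have h: "h \<in> rhom A ?F P" unfolding h_def by (rule compose_rhom[OF F \<pi>' g])
  have hf: "h (f y) = y" if "y \<in> carrier P" for y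
    using that gf f(2) \<pi>(3) rhom_closed[OF f'] unfolding h_def
    by (metis bij_betwE compose_eq)
  define e where "e k = (\<lambda>i\<in>{..<n}. if i = k then \<one>\<^bsub>A\<^esub> else \<zero>\<^bsub>A\<^esub>)" for k
  have e: "e k \<in> carrier ?F" for k by (auto simp: e_def)
  have expand: "x = (\<Oplus>\<^bsub>?F\<^esub>k\<in>{..<n}. e k \<bullet>\<^bsub>?F\<^esub> x k)" if x: "x \<in> carrier ?F" for x
  proof (rule PiE_ext)
    have xc: "x k \<in> carrier A" if "k < n" for k using x that by auto
    have ex: "e k \<bullet>\<^bsub>?F\<^esub> x k \<in> carrier ?F" if "k \<in> {..<n}" for k
      using e xc that by (intro F.ract_closed) auto
    show "x \<in> {..<n} \<rightarrow>\<^sub>E carrier A" using x by simp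
    show s: "(\<Oplus>\<^bsub>?F\<^esub>k\<in>{..<n}. e k \<bullet>\<^bsub>?F\<^esub> x k) \<in> {..<n} \<rightarrow>\<^sub>E carrier A"
      using F.M.finsum_closed[of "\<lambda>k. e k \<bullet>\<^bsub>?F\<^esub> x k" "{..<n}"] ex by auto
    fix j assume j: "j \<in> {..<n}"
    have "(\<Oplus>\<^bsub>?F\<^esub>k\<in>{..<n}. e k \<bullet>\<^bsub>?F\<^esub> x k) j
        = (\<lambda>f\<in>carrier ?F. f j) (\<Oplus>\<^bsub>?F\<^esub>k\<in>{..<n}. e k \<bullet>\<^bsub>?F\<^esub> x k)" using s by simp
    also have "\<dots> = (\<Oplus>\<^bsub>regular A\<^esub>k\<in>{..<n}. (\<lambda>f\<in>carrier ?F. f j) (e k \<bullet>\<^bsub>?F\<^esub> x k))"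
      using j ex by (intro rhom_finsum[OF F R power_rmod_coordinate_rhom[OF R]]) auto
    also have "\<dots> = (\<Oplus>\<^bsub>A\<^esub>k\<in>{..<n}. if j = k then x k else \<zero>\<^bsub>A\<^esub>)"
      unfolding finsum_regular using j ex xc
      by (intro A.finsum_cong') (auto simp: e_def)
    also have "\<dots> = x j" using j xc by (intro A.finsum_singleton) auto
    finally show "x j = (\<Oplus>\<^bsub>?F\<^esub>k\<in>{..<n}. e k \<bullet>\<^bsub>?F\<^esub> x k) j" by simp
  qed
  show thesis
  proof (rule that)
    show "h (e k) \<in> carrier P" if "k < n" for k using rhom_closed[OF h e] .
    show "compose (carrier P) (\<lambda>f\<in>carrier ?F. f k) f \<in> rhom A P (regular A)" if "k < n" for k
      by (rule compose_rhom[OF P f' power_rmod_coordinate_rhom[OF R that]])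
    fix y assume y: "y \<in> carrier P"
    have fy: "f y \<in> carrier ?F" using rhom_closed[OF f' y] .
    then have fyk: "f y k \<in> carrier A" if "k < n" for k using that by auto
    have "y = h (f y)" using hf[OF y] by simp
    also have "\<dots> = h (\<Oplus>\<^bsub>?F\<^esub>k\<in>{..<n}. e k \<bullet>\<^bsub>?F\<^esub> f y k)" using expand[OF fy] by simp
    also have "\<dots> = (\<Oplus>\<^bsub>P\<^esub>k\<in>{..<n}. h (e k \<bullet>\<^bsub>?F\<^esub> f y k))"
      using e fyk by (intro rhom_finsum[OF F P h] F.ract_closed) auto
    also have "\<dots> = (\<Oplus>\<^bsub>P\<^esub>k\<in>{..<n}. h (e k) \<bullet>\<^bsub>P\<^esub> compose (carrier P) (\<lambda>f\<in>carrier ?F. f k) f y)"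
      using e fyk fy y rhom_closed[OF h] rhom_ract[OF h]
      by (intro P.M.finsum_cong') (auto simp del: power_rmod_simps simp: compose_eq P.ract_closed)
    finally show "y = (\<Oplus>\<^bsub>P\<^esub>k\<in>{..<n}. h (e k) \<bullet>\<^bsub>P\<^esub> compose (carrier P) (\<lambda>f\<in>carrier ?F. f k) f y)" .
  qed
qed

subsection \<open>Membership in \<open>Fac\<close> and \<open>Sub\<close>\<close>

lemma in_FacI:
  fixes Z :: "('a, 'x) rmodule" and M :: "('a, 'm) rmodule"
  assumes "right_module A Z" "fg_rmodule A M" "f \<in> rhom A Z M" "f ` carrier Z = carrier M"
  shows "in_Fac A Z M"
proof -
  let ?F = "power_rmod Z 1" and ?p = "\<lambda>x\<in>carrier (power_rmod Z 1). x 0"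
  have F: "right_module A ?F" by (rule power_rmod_right_module[OF assms(1)])
  have p: "?p \<in> rhom A ?F Z" using power_rmod_coordinate_rhom[OF assms(1), of 0 1] by simp
  have "compose (carrier ?F) f ?p ` carrier ?F = carrier M"
  proof -
    have "?p ` carrier ?F = carrier Z"
    proof (intro equalityI subsetI)
      fix z assume "z \<in> carrier Z"
      then show "z \<in> ?p ` carrier ?F" by (intro image_eqI[of _ _ "\<lambda>i\<in>{..<1}. z"]) auto
    qed auto
    then show ?thesis using assms(4) by (rule surj_compose)
  qed
  moreover have "compose (carrier ?F) f ?p \<in> rhom A (?F\<lparr>carrier := carrier ?F\<rparr>) M"
    using compose_rhom[OF F p assms(3)] by (simp add: rhom_def)
  ultimately show ?thesis
    unfolding in_Fac_def using assms(2) direct_summand_carrier[OF F]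
    by (intro conjI exI[of _ 1] exI[of _ "carrier ?F"] bexI[of _ "compose (carrier ?F) f ?p"])
qed

lemma in_SubI:
  fixes Z :: "('a, 'x) rmodule" and M :: "('a, 'm) rmodule"
  assumes Z: "right_module A Z" and M: "fg_rmodule A M"
    and "finite W" "W \<subseteq> rhom A M Z"
    and inj: "\<And>x. x \<in> carrier M \<Longrightarrow> (\<And>\<theta>. \<theta> \<in> W \<Longrightarrow> \<theta> x = \<zero>\<^bsub>Z\<^esub>) \<Longrightarrow> x = \<zero>\<^bsub>M\<^esub>"
  shows "in_Sub A Z M"
proof -
  obtain \<theta> where \<theta>: "bij_betw \<theta> {0..<card W} W"
    using ex_bij_betw_nat_finite[OF assms(3)] by blast
  let ?F = "power_rmod Z (card W)"
  have F: "right_module A ?F" by (rule power_rmod_right_module[OF Z])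
  have M': "right_module A M" using M by (simp add: fg_rmodule_def)
  have \<theta>W: "\<theta> i \<in> rhom A M Z" if "i < card W" for i
    using \<theta> that assms(4) by (auto simp: bij_betw_def)
  define f where "f = (\<lambda>x\<in>carrier M. \<lambda>i\<in>{..<card W}. \<theta> i x)"
  have f: "f \<in> rhom A M ?F" unfolding f_def
    using rhom_closed[OF \<theta>W] rhom_add[OF \<theta>W] rhom_ract[OF \<theta>W]
    by (intro restrict_rhomI[OF M']) (auto intro!: restrict_ext)
  have "inj_on f (carrier M)"
  proof (rule rhom_inj_onI[OF M' F f])
    fix x assume x: "x \<in> carrier M" "f x = \<zero>\<^bsub>?F\<^esub>"
    show "x = \<zero>\<^bsub>M\<^esub>"
    proof (rule inj[OF x(1)])
      fix t assume "t \<in> W"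
      then have "t \<in> \<theta> ` {0..<card W}" using \<theta> by (simp add: bij_betw_def)
      then obtain i where i: "i < card W" "t = \<theta> i" by auto
      have "f x i = \<theta> i x" using i x(1) by (simp add: f_def)
      then show "t x = \<zero>\<^bsub>Z\<^esub>" using i x(2) by simp
    qed
  qed
  moreover have "f \<in> rhom A M (?F\<lparr>carrier := carrier ?F\<rparr>)" using f by (simp add: rhom_def)
  ultimately show ?thesis using M direct_summand_carrier[OF F] unfolding in_Sub_def by blast
qed

lemma in_SubD:
  fixes Z :: "('a, 'x) rmodule" and M :: "('a, 'm) rmodule"
  assumes Z: "right_module A Z" and "in_Sub A Z M" and x: "x \<in> carrier M" "x \<noteq> \<zero>\<^bsub>M\<^esub>"
  obtains \<theta> where "\<theta> \<in> rhom A M Z" "\<theta> x \<noteq> \<zero>\<^bsub>Z\<^esub>"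
proof -
  obtain n N f where M: "right_module A M" and N: "direct_summand A N (power_rmod Z n)"
    and f: "f \<in> rhom A M ((power_rmod Z n)\<lparr>carrier := N\<rparr>)" "inj_on f (carrier M)"
    using assms(2) by (auto simp: in_Sub_def fg_rmodule_def)
  interpret M: right_module A M by fact
  have F: "right_module A (power_rmod Z n)" by (rule power_rmod_right_module[OF Z])
  have f': "f \<in> rhom A M (power_rmod Z n)"
    using f(1) N rhom_submodule[OF rsubmodule_subset] unfolding direct_summand_def by blast
  have "f x \<noteq> \<zero>\<^bsub>power_rmod Z n\<^esub>"
    using f(2) x rhom_zero[OF M F f'] by (metis M.M.zero_closed inj_onD)
  moreover have "f x \<in> {..<n} \<rightarrow>\<^sub>E carrier Z" using rhom_closed[OF f' x(1)] by simp
  moreover have "f x = \<zero>\<^bsub>power_rmod Z n\<^esub>" if "\<forall>i<n. f x i = \<zero>\<^bsub>Z\<^esub>" "f x \<in> {..<n} \<rightarrow>\<^sub>E carrier Z"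
    using that by (intro extensionalityI[of "f x" "{..<n}"]) (auto simp: PiE_iff)
  ultimately obtain i where i: "i < n" "f x i \<noteq> \<zero>\<^bsub>Z\<^esub>" by blast
  show thesis
  proof (rule that)
    show "compose (carrier M) (\<lambda>f\<in>carrier (power_rmod Z n). f i) f \<in> rhom A M Z"
      by (rule compose_rhom[OF M f' power_rmod_coordinate_rhom[OF Z i(1)]])
    show "compose (carrier M) (\<lambda>f\<in>carrier (power_rmod Z n). f i) f x \<noteq> \<zero>\<^bsub>Z\<^esub>"
      using i x rhom_closed[OF f' x(1)] by (simp add: compose_eq)
  qed
qed

section \<open>Linear functionals\<close>

text \<open>
  The set in question is the span of \<open>U\<close> and \<open>x\<close>.
\<close>

lemma adjoin_rsubmodule:
  assumes "cring K" "right_module K V" "rsubmodule K U V" and x: "x \<in> carrier V"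
  shows "rsubmodule K {y \<in> carrier V. \<exists>c\<in>carrier K. y \<ominus>\<^bsub>V\<^esub> x \<bullet>\<^bsub>V\<^esub> c \<in> U} V"
    and "U \<subseteq> {y \<in> carrier V. \<exists>c\<in>carrier K. y \<ominus>\<^bsub>V\<^esub> x \<bullet>\<^bsub>V\<^esub> c \<in> U}"
    and "x \<in> {y \<in> carrier V. \<exists>c\<in>carrier K. y \<ominus>\<^bsub>V\<^esub> x \<bullet>\<^bsub>V\<^esub> c \<in> U}"
proof -
  interpret K: cring K by fact
  interpret V: right_module K V by fact
  note U = rsubmodule_zero_closed[OF assms(3)] rsubmodule_add_closed[OF assms(3)]
    rsubmodule_ract_closed[OF assms(3)] subsetD[OF rsubmodule_subset[OF assms(3)]]
  let ?U = "{y \<in> carrier V. \<exists>c\<in>carrier K. y \<ominus>\<^bsub>V\<^esub> x \<bullet>\<^bsub>V\<^esub> c \<in> U}"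
  have *: "y \<ominus>\<^bsub>V\<^esub> x \<bullet>\<^bsub>V\<^esub> \<zero>\<^bsub>K\<^esub> = y" if "y \<in> carrier V" for y
    using that x by (simp add: a_minus_def)
  show "U \<subseteq> ?U" using U * by (auto intro!: bexI[of _ "\<zero>\<^bsub>K\<^esub>"])
  show "x \<in> ?U" using U x by (auto intro!: bexI[of _ "\<one>\<^bsub>K\<^esub>"] simp: V.ract_one)
  show "rsubmodule K ?U V"
  proof (rule V.rsubmoduleI)
    show "\<zero>\<^bsub>V\<^esub> \<in> ?U" using U *[of "\<zero>\<^bsub>V\<^esub>"] by (auto intro!: bexI[of _ "\<zero>\<^bsub>K\<^esub>"])
    fix y assume "y \<in> ?U"
    then obtain c where y: "y \<in> carrier V" "c \<in> carrier K" "y \<ominus>\<^bsub>V\<^esub> x \<bullet>\<^bsub>V\<^esub> c \<in> U" by blast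
    show "y \<oplus>\<^bsub>V\<^esub> z \<in> ?U" if "z \<in> ?U" for z
    proof -
      from that obtain d where z: "z \<in> carrier V" "d \<in> carrier K" "z \<ominus>\<^bsub>V\<^esub> x \<bullet>\<^bsub>V\<^esub> d \<in> U" by blast
      have "(y \<oplus>\<^bsub>V\<^esub> z) \<ominus>\<^bsub>V\<^esub> x \<bullet>\<^bsub>V\<^esub> (c \<oplus>\<^bsub>K\<^esub> d) = (y \<ominus>\<^bsub>V\<^esub> x \<bullet>\<^bsub>V\<^esub> c) \<oplus>\<^bsub>V\<^esub> (z \<ominus>\<^bsub>V\<^esub> x \<bullet>\<^bsub>V\<^esub> d)"
        using x y z by (simp add: a_minus_def V.ract_add_right V.ract_closed V.M.minus_add V.M.a_ac)
      then show ?thesis using U(2)[OF y(3) z(3)] y z by (auto intro!: bexI[of _ "c \<oplus>\<^bsub>K\<^esub> d"])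
    qed
    show "y \<bullet>\<^bsub>V\<^esub> a \<in> ?U" if a: "a \<in> carrier K" for a
    proof -
      have "y \<bullet>\<^bsub>V\<^esub> a \<ominus>\<^bsub>V\<^esub> x \<bullet>\<^bsub>V\<^esub> (c \<otimes>\<^bsub>K\<^esub> a) = (y \<ominus>\<^bsub>V\<^esub> x \<bullet>\<^bsub>V\<^esub> c) \<bullet>\<^bsub>V\<^esub> a"
        using x y a by (simp add: V.ract_minus_left V.ract_closed V.ract_mult)
      then show ?thesis
        using U(3)[OF y(3) a] y a by (auto intro!: bexI[of _ "c \<otimes>\<^bsub>K\<^esub> a"] V.ract_closed)
    qed
  qed auto
qed

text \<open>
  By Zorn's lemma there is a maximal subspace \<open>U\<close> that contains \<open>W\<close> but not \<open>v\<close>.  By maximality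
  every vector is congruent modulo \<open>U\<close> to a unique multiple of \<open>v\<close>, and \<open>\<phi>\<close> takes the coefficient.
\<close>

lemma separating_functional:
  assumes "field K" "right_module K V" "rsubmodule K W V" "v \<in> carrier V" "v \<notin> W"
  obtains \<phi> where "\<phi> \<in> rhom K V (regular K)" "\<phi> v = \<one>\<^bsub>K\<^esub>" "\<And>w. w \<in> W \<Longrightarrow> \<phi> w = \<zero>\<^bsub>K\<^esub>"
proof -
  interpret K: field K by fact
  interpret V: right_module K V by fact
  let ?S = "{U. rsubmodule K U V \<and> W \<subseteq> U \<and> v \<notin> U}"
  have "\<exists>U\<in>?S. \<forall>U'\<in>?S. U \<subseteq> U' \<longrightarrow> U' = U"
  proof (rule subset_Zorn_nonempty)
    show "?S \<noteq> {}" using assms(3,5) by blast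
    fix C assume C: "C \<noteq> {}" "subset.chain ?S C"
    have sub: "rsubmodule K U V" if "U \<in> C" for U
      using C(2) that by (auto simp: subset.chain_def)
    have "rsubmodule K (\<Union>C) V"
    proof (rule V.rsubmoduleI)
      show "\<Union>C \<subseteq> carrier V" using rsubmodule_subset[OF sub] by blast
      show "\<zero>\<^bsub>V\<^esub> \<in> \<Union>C" using rsubmodule_zero_closed[OF sub] C(1) by blast
      fix x assume x: "x \<in> \<Union>C"
      show "x \<bullet>\<^bsub>V\<^esub> a \<in> \<Union>C" if "a \<in> carrier K" for a
        using rsubmodule_ract_closed[OF sub _ that] x by blast
      show "x \<oplus>\<^bsub>V\<^esub> y \<in> \<Union>C" if "y \<in> \<Union>C" for y
      proof -
        obtain U U' where U: "U \<in> C" "x \<in> U" "U' \<in> C" "y \<in> U'" using x \<open>y \<in> \<Union>C\<close> by blast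
        have "U \<subseteq> U' \<or> U' \<subseteq> U" using C(2) U by (auto simp: subset.chain_def)
        then obtain U'' where "U'' \<in> C" "x \<in> U''" "y \<in> U''" using U by blast
        then show ?thesis using rsubmodule_add_closed[OF sub] by blast
      qed
    qed
    moreover have "W \<subseteq> U \<and> v \<notin> U" if "U \<in> C" for U
      using C(2) that by (auto simp: subset.chain_def)
    then have "W \<subseteq> \<Union>C" "v \<notin> \<Union>C" using C(1) by blast+
    ultimately show "\<Union>C \<in> ?S" by blast
  qed
  then obtain U where U: "rsubmodule K U V" "W \<subseteq> U" "v \<notin> U" and max': "\<forall>U'\<in>?S. U \<subseteq> U' \<longrightarrow> U' = U"
    by auto
  have max: "U' = U" if "rsubmodule K U' V" "U \<subseteq> U'" "v \<notin> U'" for U'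
    using max' U(2) that by simp
  note Uc = rsubmodule_zero_closed[OF U(1)] rsubmodule_add_closed[OF U(1)]
    rsubmodule_ract_closed[OF U(1)] subsetD[OF rsubmodule_subset[OF U(1)]]
    rsubmodule_minus_closed[OF U(1) V.M.abelian_group_axioms]
    rsubmodule_inv_closed[OF U(1) V.M.abelian_group_axioms]
  let ?P = "\<lambda>x c. c \<in> carrier K \<and> x \<ominus>\<^bsub>V\<^esub> v \<bullet>\<^bsub>V\<^esub> c \<in> U"
  have ex: "\<exists>c. ?P x c" if x: "x \<in> carrier V" for x
  proof (cases "x \<in> U")
    case True
    then show ?thesis using x assms(4) by (intro exI[of _ "\<zero>\<^bsub>K\<^esub>"]) simp
  next
    case False
    note adj = adjoin_rsubmodule[OF K.cring_axioms assms(2) U(1) x]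
    have "v \<in> {y \<in> carrier V. \<exists>c\<in>carrier K. y \<ominus>\<^bsub>V\<^esub> x \<bullet>\<^bsub>V\<^esub> c \<in> U}"
      using max[OF adj(1,2)] adj(3) False by blast
    then obtain c where c: "c \<in> carrier K" "v \<ominus>\<^bsub>V\<^esub> x \<bullet>\<^bsub>V\<^esub> c \<in> U" by blast
    have "c \<noteq> \<zero>\<^bsub>K\<^esub>"
      using c U(3) x assms(4) by auto
    then have i: "inv\<^bsub>K\<^esub> c \<in> carrier K" "c \<otimes>\<^bsub>K\<^esub> inv\<^bsub>K\<^esub> c = \<one>\<^bsub>K\<^esub>"
      using c K.field_Units by auto
    have "\<ominus>\<^bsub>V\<^esub> ((v \<ominus>\<^bsub>V\<^esub> x \<bullet>\<^bsub>V\<^esub> c) \<bullet>\<^bsub>V\<^esub> inv\<^bsub>K\<^esub> c) = x \<ominus>\<^bsub>V\<^esub> v \<bullet>\<^bsub>V\<^esub> inv\<^bsub>K\<^esub> c"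
      using c i x assms(4)
      by (simp add: V.ract_minus_left V.ract_closed V.ract_mult[symmetric] V.ract_one)
        (simp add: a_minus_def V.M.minus_add V.ract_closed V.M.a_comm)
    then show ?thesis using Uc(3,6) c i by metis
  qed
  have uniq: "c = d" if "?P x c" "?P x d" "x \<in> carrier V" for x c d
  proof (rule ccontr)
    assume "c \<noteq> d"
    define e where "e = d \<ominus>\<^bsub>K\<^esub> c"
    have e: "e \<in> carrier K" "e \<noteq> \<zero>\<^bsub>K\<^esub>" using that \<open>c \<noteq> d\<close> by (auto simp: e_def)
    then have i: "inv\<^bsub>K\<^esub> e \<in> carrier K" "e \<otimes>\<^bsub>K\<^esub> inv\<^bsub>K\<^esub> e = \<one>\<^bsub>K\<^esub>"
      using K.field_Units by auto
    have "(x \<ominus>\<^bsub>V\<^esub> v \<bullet>\<^bsub>V\<^esub> c) \<ominus>\<^bsub>V\<^esub> (x \<ominus>\<^bsub>V\<^esub> v \<bullet>\<^bsub>V\<^esub> d) = (x \<oplus>\<^bsub>V\<^esub> \<ominus>\<^bsub>V\<^esub> x) \<oplus>\<^bsub>V\<^esub> v \<bullet>\<^bsub>V\<^esub> e"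
      using that assms(4) unfolding e_def
      by (simp only: V.ract_minus_right)
        (simp add: a_minus_def V.M.minus_add V.ract_closed V.M.a_ac)
    also have "\<dots> = v \<bullet>\<^bsub>V\<^esub> e" using that assms(4) e by (simp add: V.M.r_neg V.ract_closed)
    finally have "v \<bullet>\<^bsub>V\<^esub> e \<in> U" using Uc(5) that by metis
    then have "(v \<bullet>\<^bsub>V\<^esub> e) \<bullet>\<^bsub>V\<^esub> inv\<^bsub>K\<^esub> e \<in> U" using Uc(3) i by blast
    then show False
      using U(3) assms(4) e i by (simp add: V.ract_mult[symmetric] V.ract_one)
  qed
  define p where "p x = (THE c. ?P x c)" for x
  have p_eq: "p x = c" if "?P x c" "x \<in> carrier V" for x c
    unfolding p_def using that uniq by (intro the_equality) blast+
  have p: "p x \<in> carrier K" "x \<ominus>\<^bsub>V\<^esub> v \<bullet>\<^bsub>V\<^esub> p x \<in> U" if x: "x \<in> carrier V" for x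
    using ex[OF x] p_eq[OF _ x] by metis+
  have "restrict p (carrier V) \<in> rhom K V (regular K)"
  proof (rule restrict_rhomI[OF assms(2)])
    fix x assume x: "x \<in> carrier V"
    note px = p[OF x]
    show "p x \<in> carrier (regular K)" using px by simp
    show "p (x \<oplus>\<^bsub>V\<^esub> y) = p x \<oplus>\<^bsub>regular K\<^esub> p y" if y: "y \<in> carrier V" for y
    proof -
      note py = p[OF y]
      have "(x \<oplus>\<^bsub>V\<^esub> y) \<ominus>\<^bsub>V\<^esub> v \<bullet>\<^bsub>V\<^esub> (p x \<oplus>\<^bsub>K\<^esub> p y)
          = (x \<ominus>\<^bsub>V\<^esub> v \<bullet>\<^bsub>V\<^esub> p x) \<oplus>\<^bsub>V\<^esub> (y \<ominus>\<^bsub>V\<^esub> v \<bullet>\<^bsub>V\<^esub> p y)"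
        using x y px(1) py(1) assms(4)
        by (simp add: a_minus_def V.ract_add_right V.ract_closed V.M.minus_add V.M.a_ac)
      then show ?thesis using Uc(2)[OF px(2) py(2)] px(1) py(1) x y by (intro p_eq) auto
    qed
    show "p (x \<bullet>\<^bsub>V\<^esub> a) = p x \<bullet>\<^bsub>regular K\<^esub> a" if a: "a \<in> carrier K" for a
    proof -
      have "x \<bullet>\<^bsub>V\<^esub> a \<ominus>\<^bsub>V\<^esub> v \<bullet>\<^bsub>V\<^esub> (p x \<otimes>\<^bsub>K\<^esub> a) = (x \<ominus>\<^bsub>V\<^esub> v \<bullet>\<^bsub>V\<^esub> p x) \<bullet>\<^bsub>V\<^esub> a"
        using x px(1) a assms(4) by (simp add: V.ract_minus_left V.ract_closed V.ract_mult)
      then show ?thesis using Uc(3)[OF px(2) a] px(1) a x by (intro p_eq) (auto simp: V.ract_closed)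
    qed
  qed
  moreover have "p v = \<one>\<^bsub>K\<^esub>"
    using assms(4) Uc(1) by (intro p_eq) (auto simp: V.ract_one)
  moreover have "p w = \<zero>\<^bsub>K\<^esub>" "w \<in> carrier V" if "w \<in> W" for w
    using that U(2) Uc(4) assms(4) by (auto simp: subsetD intro!: p_eq)
  ultimately show thesis using assms(4) by (intro that[of "restrict p (carrier V)"]) auto
qed

section \<open>Finite dimension\<close>

text \<open>
  A finite set of linear functionals whose only common zero is \<open>0\<close>, that is, linear coordinates, which may be
  redundant.  This form of finite dimension yields directly the embeddings into powers of \<open>\<D>T\<close> and the
  models of modules on the type \<open>nat \<Rightarrow> 'k\<close>.
\<close>

definition separating :: "('k, 'r) ring_scheme \<Rightarrow> ('k, 'v) rmodule \<Rightarrow> ('v \<Rightarrow> 'k) set \<Rightarrow> bool"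
  where "separating K V F \<longleftrightarrow> finite F \<and> F \<subseteq> rhom K V (regular K) \<and>
    (\<forall>x\<in>carrier V. (\<forall>\<phi>\<in>F. \<phi> x = \<zero>\<^bsub>K\<^esub>) \<longrightarrow> x = \<zero>\<^bsub>V\<^esub>)"

text \<open>
  Generators are adjoined one at a time; each one that is independent of the earlier ones
  contributes a functional that is \<open>1\<close> on it and vanishes on their span.
\<close>

lemma fg_imp_separating:
  assumes "field K" "fg_rmodule K V"
  obtains F where "separating K V F"
proof -
  interpret K: field K by fact
  have V: "right_module K V" using assms(2) by (simp add: fg_rmodule_def)
  interpret V: right_module K V by fact
  obtain Z where Z: "finite Z" "Z \<subseteq> carrier V" "gen_submodule K V Z = carrier V"
    using assms(2) by (auto simp: fg_rmodule_def)
  have "\<exists>F. finite F \<and> F \<subseteq> rhom K V (regular K) \<and>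
    (\<forall>x\<in>gen_submodule K V Z. (\<forall>\<phi>\<in>F. \<phi> x = \<zero>\<^bsub>K\<^esub>) \<longrightarrow> x = \<zero>\<^bsub>V\<^esub>)" using Z(1,2)
  proof (induction Z)
    case empty
    have "gen_submodule K V {} \<subseteq> {\<zero>\<^bsub>V\<^esub>}" by (rule gen_submodule_least[OF V.rsubmodule_zero]) simp
    then show ?case by (intro exI[of _ "{}"]) auto
  next
    case (insert z Z)
    have z: "z \<in> carrier V" and ZV: "Z \<subseteq> carrier V" using insert.prems by auto
    obtain F where F: "finite F" "F \<subseteq> rhom K V (regular K)"
      "\<forall>x\<in>gen_submodule K V Z. (\<forall>\<phi>\<in>F. \<phi> x = \<zero>\<^bsub>K\<^esub>) \<longrightarrow> x = \<zero>\<^bsub>V\<^esub>"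
      using insert.IH[OF ZV] by blast
    note G = gen_submodule_rsubmodule[OF V ZV] gen_submodule_incl[OF V ZV]
    show ?case
    proof (cases "z \<in> gen_submodule K V Z")
      case True
      then have "gen_submodule K V (insert z Z) \<subseteq> gen_submodule K V Z"
        using G by (intro gen_submodule_least) auto
      then show ?thesis using F by blast
    next
      case False
      obtain \<phi> where \<phi>: "\<phi> \<in> rhom K V (regular K)" "\<phi> z = \<one>\<^bsub>K\<^esub>"
        "\<And>w. w \<in> gen_submodule K V Z \<Longrightarrow> \<phi> w = \<zero>\<^bsub>K\<^esub>"
        using separating_functional[OF assms(1) V G(1) z False] by blast
      note adj = adjoin_rsubmodule[OF K.cring_axioms V G(1) z]
      have "x = \<zero>\<^bsub>V\<^esub>" if x: "x \<in> gen_submodule K V (insert z Z)"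
        and ann: "\<And>\<psi>. \<psi> \<in> insert \<phi> F \<Longrightarrow> \<psi> x = \<zero>\<^bsub>K\<^esub>" for x
      proof -
        have "x \<in> {y \<in> carrier V. \<exists>c\<in>carrier K. y \<ominus>\<^bsub>V\<^esub> z \<bullet>\<^bsub>V\<^esub> c \<in> gen_submodule K V Z}"
          by (rule subsetD[OF gen_submodule_least[OF adj(1)] x]) (use adj(2,3) G(2) in simp)
        then obtain c where c: "x \<in> carrier V" "c \<in> carrier K" "x \<ominus>\<^bsub>V\<^esub> z \<bullet>\<^bsub>V\<^esub> c \<in> gen_submodule K V Z"
          by blast
        have "\<zero>\<^bsub>K\<^esub> = \<phi> (x \<ominus>\<^bsub>V\<^esub> z \<bullet>\<^bsub>V\<^esub> c)" using \<phi>(3) c(3) by simp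
        also have "\<dots> = \<phi> x \<ominus>\<^bsub>regular K\<^esub> \<phi> (z \<bullet>\<^bsub>V\<^esub> c)"
          using rhom_minus[OF V regular_right_module \<phi>(1)] c z V.ract_closed K.ring_axioms by simp
        finally have "\<phi> x \<ominus>\<^bsub>K\<^esub> \<phi> (z \<bullet>\<^bsub>V\<^esub> c) = \<zero>\<^bsub>K\<^esub>" by simp
        then have "\<phi> x = \<phi> (z \<bullet>\<^bsub>V\<^esub> c)"
          using rhom_closed[OF \<phi>(1)] c z V.ract_closed by simp
        then have "c = \<zero>\<^bsub>K\<^esub>"
          using rhom_ract[OF \<phi>(1) z c(2)] \<phi>(2) ann[of \<phi>] c(2) by simp
        then have "x \<in> gen_submodule K V Z" using c z by simp
        then show ?thesis using F(3) ann by blast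
      qed
      then show ?thesis using F(1,2) \<phi>(1) by (intro exI[of _ "insert \<phi> F"]) blast
    qed
  qed
  then show thesis using that Z(3) by (auto simp: separating_def)
qed

text \<open>
  The positions of the leading coordinates of the vectors in \<open>W\<close>, as in an echelon form; their
  number is the dimension of \<open>W\<close>.
\<close>

definition pivots :: "('k, 'r) ring_scheme \<Rightarrow> nat \<Rightarrow> (nat \<Rightarrow> 'v \<Rightarrow> 'k) \<Rightarrow> 'v set \<Rightarrow> nat set"
  where "pivots K n \<chi> W = {i. i < n \<and> (\<exists>w\<in>W. (\<forall>j<i. \<chi> j w = \<zero>\<^bsub>K\<^esub>) \<and> \<chi> i w \<noteq> \<zero>\<^bsub>K\<^esub>)}"

lemma pivots_mono: "U \<subseteq> W \<Longrightarrow> pivots K n \<chi> U \<subseteq> pivots K n \<chi> W"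
  by (auto simp: pivots_def)

lemma pivots_finite: "finite (pivots K n \<chi> U)"
  by (rule finite_subset[of _ "{..<n}"]) (auto simp: pivots_def)

text \<open>
  Elimination: subtracting multiples of elements of \<open>U\<close> from \<open>w \<in> W\<close> moves its leading position to
  the right until nothing is left.  The induction runs over the number of leading zeros, downwards.
\<close>

lemma pivots_eq_imp_eq:
  assumes "field K" "right_module K V"
    and \<chi>: "\<And>i. i < n \<Longrightarrow> \<chi> i \<in> rhom K V (regular K)"
    and sep: "\<And>x. x \<in> carrier V \<Longrightarrow> (\<And>i. i < n \<Longrightarrow> \<chi> i x = \<zero>\<^bsub>K\<^esub>) \<Longrightarrow> x = \<zero>\<^bsub>V\<^esub>"
    and U: "rsubmodule K U V" and W: "rsubmodule K W V" "U \<subseteq> W"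
    and piv: "pivots K n \<chi> W \<subseteq> pivots K n \<chi> U"
  shows "U = W"
proof -
  interpret K: field K by fact
  interpret V: right_module K V by fact
  have rK: "right_module K (regular K)" using regular_right_module K.ring_axioms .
  interpret rK: right_module K "regular K" by fact
  have "\<forall>w\<in>W. (\<forall>j<i. \<chi> j w = \<zero>\<^bsub>K\<^esub>) \<longrightarrow> w \<in> U" if "i \<le> n" for i using that
  proof (induction rule: inc_induct)
    case base
    then show ?case
      using sep rsubmodule_subset[OF W(1)] rsubmodule_zero_closed[OF U] by (metis subsetD)
  next
    case (step i)
    show ?case
    proof (intro ballI impI)
      fix w assume w: "w \<in> W" "\<forall>j<i. \<chi> j w = \<zero>\<^bsub>K\<^esub>"
      show "w \<in> U"
      proof (cases "\<chi> i w = \<zero>\<^bsub>K\<^esub>")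
        case True
        then show ?thesis using step.IH w by (auto simp: less_Suc_eq)
      next
        case False
        then have "i \<in> pivots K n \<chi> W" using w step.hyps by (auto simp: pivots_def)
        then have "i \<in> pivots K n \<chi> U" using piv by blast
        then obtain u where u: "u \<in> U" "\<forall>j<i. \<chi> j u = \<zero>\<^bsub>K\<^esub>" "\<chi> i u \<noteq> \<zero>\<^bsub>K\<^esub>"
          by (auto simp: pivots_def)
        have wu: "w \<in> carrier V" "u \<in> carrier V" "u \<in> W"
          using w u W rsubmodule_subset[OF W(1)] by auto
        have c: "\<chi> j x \<in> carrier K" if "j < n" "x \<in> carrier V" for j x
          using rhom_closed[OF \<chi>] that by simp
        have inv: "inv\<^bsub>K\<^esub> (\<chi> i u) \<in> carrier K" "\<chi> i u \<otimes>\<^bsub>K\<^esub> inv\<^bsub>K\<^esub> (\<chi> i u) = \<one>\<^bsub>K\<^esub>"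
          using u(3) c[OF step.hyps(2) wu(2)] K.field_Units by auto
        define d where "d = inv\<^bsub>K\<^esub> (\<chi> i u) \<otimes>\<^bsub>K\<^esub> \<chi> i w"
        have d: "d \<in> carrier K" "\<chi> i u \<otimes>\<^bsub>K\<^esub> d = \<chi> i w"
          using inv c[OF step.hyps(2)] wu by (auto simp: d_def K.m_assoc[symmetric])
        have ud: "u \<bullet>\<^bsub>V\<^esub> d \<in> U" using rsubmodule_ract_closed[OF U u(1) d(1)] .
        define w' where "w' = w \<ominus>\<^bsub>V\<^esub> u \<bullet>\<^bsub>V\<^esub> d"
        have w'W: "w' \<in> W"
          unfolding w'_def using rsubmodule_minus_closed[OF W(1) V.M.abelian_group_axioms w(1)] ud W(2)
          by blast
        have "\<chi> j w' = \<zero>\<^bsub>K\<^esub>" if "j < Suc i" for j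
        proof -
          have j: "j < n" using that step.hyps by simp
          have "\<chi> j w' = \<chi> j w \<ominus>\<^bsub>regular K\<^esub> \<chi> j u \<otimes>\<^bsub>K\<^esub> d"
            unfolding w'_def using rhom_minus[OF assms(2) rK \<chi>[OF j]] wu d rhom_ract[OF \<chi>[OF j]]
            by (simp add: V.ract_closed)
          moreover have "\<chi> j w = \<chi> j u \<otimes>\<^bsub>K\<^esub> d"
            using that w(2) u(2) d by (cases "j = i") auto
          ultimately show ?thesis
            using c[OF j wu(1)] by simp
        qed
        then have "w' \<in> U" using step.IH w'W by blast
        then have "w' \<oplus>\<^bsub>V\<^esub> u \<bullet>\<^bsub>V\<^esub> d \<in> U" using rsubmodule_add_closed[OF U] ud by blast
        moreover have "w' \<oplus>\<^bsub>V\<^esub> u \<bullet>\<^bsub>V\<^esub> d = w"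
          using wu d by (simp add: w'_def a_minus_def V.M.a_assoc V.M.l_neg V.ract_closed)
        ultimately show ?thesis by simp
      qed
    qed
  qed
  from this[of 0] W(2) show ?thesis by auto
qed

lemma separating_enum:
  assumes "separating K V F"
  obtains \<chi> :: "nat \<Rightarrow> _" where "\<And>i. i < card F \<Longrightarrow> \<chi> i \<in> rhom K V (regular K)"
    and "\<And>x. x \<in> carrier V \<Longrightarrow> (\<And>i. i < card F \<Longrightarrow> \<chi> i x = \<zero>\<^bsub>K\<^esub>) \<Longrightarrow> x = \<zero>\<^bsub>V\<^esub>"
proof -
  have F: "finite F" "F \<subseteq> rhom K V (regular K)"
    "\<And>x. x \<in> carrier V \<Longrightarrow> (\<And>\<phi>. \<phi> \<in> F \<Longrightarrow> \<phi> x = \<zero>\<^bsub>K\<^esub>) \<Longrightarrow> x = \<zero>\<^bsub>V\<^esub>"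
    using assms by (auto simp: separating_def)
  obtain \<chi> where "bij_betw \<chi> {0..<card F} F" using ex_bij_betw_nat_finite[OF F(1)] by blast
  then have \<chi>: "\<chi> ` {0..<card F} = F" by (simp add: bij_betw_def)
  show thesis
  proof (rule that)
    show "\<chi> i \<in> rhom K V (regular K)" if "i < card F" for i using F(2) \<chi> that by auto
    fix x assume x: "x \<in> carrier V" "\<And>i. i < card F \<Longrightarrow> \<chi> i x = \<zero>\<^bsub>K\<^esub>"
    show "x = \<zero>\<^bsub>V\<^esub>"
    proof (rule F(3)[OF x(1)])
      fix \<phi> assume "\<phi> \<in> F"
      then have "\<phi> \<in> \<chi> ` {0..<card F}" by (simp only: \<chi>)
      then show "\<phi> x = \<zero>\<^bsub>K\<^esub>" using x(2) by auto
    qed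
  qed
qed

text \<open>
  The rank \<open>r\<close> is the number of pivots.  Being bounded and strictly monotone, it provides both chain
  conditions for subspaces.
\<close>

lemma separating_rank:
  fixes V :: "('k, 'v) rmodule"
  assumes "field K" "right_module K V" "separating K V F"
  obtains r :: "'v set \<Rightarrow> nat" and b :: nat where
    "\<And>U W. rsubmodule K U V \<Longrightarrow> rsubmodule K W V \<Longrightarrow> U \<subseteq> W \<Longrightarrow> r U \<le> r W"
    "\<And>U W. rsubmodule K U V \<Longrightarrow> rsubmodule K W V \<Longrightarrow> U \<subseteq> W \<Longrightarrow> r W \<le> r U \<Longrightarrow> U = W"
    "\<And>U. r U \<le> b"
proof -
  obtain \<chi> where \<chi>: "\<And>i. i < card F \<Longrightarrow> \<chi> i \<in> rhom K V (regular K)"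
    and sep: "\<And>x. x \<in> carrier V \<Longrightarrow> (\<And>i. i < card F \<Longrightarrow> \<chi> i x = \<zero>\<^bsub>K\<^esub>) \<Longrightarrow> x = \<zero>\<^bsub>V\<^esub>"
    using separating_enum[OF assms(3)] by blast
  let ?P = "pivots K (card F) \<chi>"
  show thesis
  proof (rule that[of "\<lambda>U. card (?P U)" "card F"])
    fix U :: "'v set"
    have "card (?P U) \<le> card {..<card F}"
      by (rule card_mono) (auto simp: pivots_def)
    then show "card (?P U) \<le> card F" by simp
  next
    fix U W :: "'v set" assume "U \<subseteq> W"
    then show "card (?P U) \<le> card (?P W)" by (intro card_mono pivots_finite pivots_mono)
  next
    fix U W :: "'v set" assume *: "rsubmodule K U V" "rsubmodule K W V" "U \<subseteq> W" "card (?P W) \<le> card (?P U)"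
    have "?P U = ?P W"
      using card_seteq[OF pivots_finite pivots_mono[OF *(3)] *(4)] .
    then show "U = W"
      using \<chi> * sep by (intro pivots_eq_imp_eq[OF assms(1,2), of "card F" \<chi>]) auto
  qed
qed

text \<open>
  One vector for each pivot of \<open>V\<close> suffices, for their span has the same pivots as \<open>V\<close>.
\<close>

lemma separating_imp_fg:
  assumes "field K" "right_module K V" "separating K V F"
  shows "fg_rmodule K V"
proof -
  interpret V: right_module K V by fact
  obtain \<chi> where \<chi>: "\<And>i. i < card F \<Longrightarrow> \<chi> i \<in> rhom K V (regular K)"
    and sep: "\<And>x. x \<in> carrier V \<Longrightarrow> (\<And>i. i < card F \<Longrightarrow> \<chi> i x = \<zero>\<^bsub>K\<^esub>) \<Longrightarrow> x = \<zero>\<^bsub>V\<^esub>"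
    using separating_enum[OF assms(3)] by blast
  let ?P = "pivots K (card F) \<chi>"
  have "\<forall>i\<in>?P (carrier V). \<exists>w\<in>carrier V. (\<forall>j<i. \<chi> j w = \<zero>\<^bsub>K\<^esub>) \<and> \<chi> i w \<noteq> \<zero>\<^bsub>K\<^esub>"
    by (auto simp: pivots_def)
  then obtain w where w: "\<And>i. i \<in> ?P (carrier V) \<Longrightarrow>
      w i \<in> carrier V \<and> (\<forall>j<i. \<chi> j (w i) = \<zero>\<^bsub>K\<^esub>) \<and> \<chi> i (w i) \<noteq> \<zero>\<^bsub>K\<^esub>"
    by metis
  let ?Z = "w ` ?P (carrier V)"
  have Z: "finite ?Z" "?Z \<subseteq> carrier V" using w by (simp add: pivots_finite, blast)
  note G = gen_submodule_rsubmodule[OF assms(2) Z(2)] gen_submodule_incl[OF assms(2) Z(2)]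
  have "?P (carrier V) \<subseteq> ?P (gen_submodule K V ?Z)"
  proof
    fix i assume i: "i \<in> ?P (carrier V)"
    then have "w i \<in> gen_submodule K V ?Z" using G(2) by blast
    then show "i \<in> ?P (gen_submodule K V ?Z)" using w[OF i] i by (auto simp: pivots_def)
  qed
  then have "gen_submodule K V ?Z = carrier V"
    using \<chi> sep V.rsubmodule_carrier rsubmodule_subset[OF G(1)]
    by (intro pivots_eq_imp_eq[OF assms(1,2) _ _ G(1), of "card F" \<chi>]) auto
  then show ?thesis using Z assms(2) by (auto simp: fg_rmodule_def)
qed

section \<open>Modules of homomorphisms and endomorphism rings\<close>

text \<open>
  The endomorphism algebra, the modules \<open>Hom(T, Z)\<close> and \<open>Hom(P, A)\<close>, and \<open>\<D>T\<close> share this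
  additive structure, each in a different record.
\<close>

lemma rhom_pointwise_group:
  fixes H :: "('m \<Rightarrow> 'n, 'z) ring_scheme" and M :: "('a, 'm) rmodule" and N :: "('a, 'n) rmodule"
  assumes M: "right_module A M" and N: "right_module A N"
    and carr: "carrier H = rhom A M N" and zero: "\<zero>\<^bsub>H\<^esub> = (\<lambda>x\<in>carrier M. \<zero>\<^bsub>N\<^esub>)"
    and add: "\<And>f g. f \<oplus>\<^bsub>H\<^esub> g = (\<lambda>x\<in>carrier M. f x \<oplus>\<^bsub>N\<^esub> g x)"
  shows "abelian_group H"
    and "\<lbrakk>f \<in> rhom A M N; g \<in> rhom A M N; x \<in> carrier M\<rbrakk> \<Longrightarrow> (f \<ominus>\<^bsub>H\<^esub> g) x = f x \<ominus>\<^bsub>N\<^esub> g x"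
proof -
  interpret N: right_module A N by fact
  note c = rhom_closed[of _ A M N]
  show H: "abelian_group H"
  proof (rule abelian_groupI)
    fix f g assume f: "f \<in> carrier H" and g: "g \<in> carrier H"
    show "f \<oplus>\<^bsub>H\<^esub> g \<in> carrier H" using add_rhom[OF M N] f g by (simp add: carr add)
    show "f \<oplus>\<^bsub>H\<^esub> g = g \<oplus>\<^bsub>H\<^esub> f"
      using f g c by (auto simp: carr add N.M.a_comm intro!: restrict_ext)
    show "\<zero>\<^bsub>H\<^esub> \<oplus>\<^bsub>H\<^esub> f = f"
      using f c add_rhom[OF M N zero_rhom[OF M N], of f]
      by (intro rhom_eqI[of _ A M N f N]) (auto simp: carr add zero)
    show "\<exists>y\<in>carrier H. y \<oplus>\<^bsub>H\<^esub> f = \<zero>\<^bsub>H\<^esub>"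
      using f c inv_rhom[OF M N, of f]
      by (intro bexI[of _ "\<lambda>x\<in>carrier M. \<ominus>\<^bsub>N\<^esub> f x"])
        (auto simp: carr add zero N.M.l_neg intro!: restrict_ext)
    fix h assume h: "h \<in> carrier H"
    show "(f \<oplus>\<^bsub>H\<^esub> g) \<oplus>\<^bsub>H\<^esub> h = f \<oplus>\<^bsub>H\<^esub> (g \<oplus>\<^bsub>H\<^esub> h)"
      using f g h c by (auto simp: carr add N.M.a_assoc intro!: restrict_ext)
  qed (use zero_rhom[OF M N] in \<open>auto simp: carr zero\<close>)
  interpret H: abelian_group H by fact
  show "(f \<ominus>\<^bsub>H\<^esub> g) x = f x \<ominus>\<^bsub>N\<^esub> g x"
    if f: "f \<in> rhom A M N" and g: "g \<in> rhom A M N" and x: "x \<in> carrier M"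
  proof -
    have "f \<ominus>\<^bsub>H\<^esub> g \<in> carrier H" using f g by (intro H.minus_closed) (simp_all add: carr)
    then have k: "(f \<ominus>\<^bsub>H\<^esub> g) x \<in> carrier N" using x c by (simp add: carr)
    have "(f \<ominus>\<^bsub>H\<^esub> g) \<oplus>\<^bsub>H\<^esub> g = f"
      using f g by (simp add: a_minus_def H.a_assoc H.l_neg carr[symmetric])
    then have "((f \<ominus>\<^bsub>H\<^esub> g) \<oplus>\<^bsub>H\<^esub> g) x = f x" by simp
    then have "(f \<ominus>\<^bsub>H\<^esub> g) x \<oplus>\<^bsub>N\<^esub> g x = f x" using x by (simp add: add)
    then show ?thesis
      using k c[OF f x] c[OF g x] N.M.add.inv_solve_right by (simp add: a_minus_def)
  qed
qed

lemma end_alg_simps [simp]: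
  "carrier (end_alg A T) = rhom A T T"
  "f \<otimes>\<^bsub>end_alg A T\<^esub> g = compose (carrier T) f g"
  "\<one>\<^bsub>end_alg A T\<^esub> = (\<lambda>x\<in>carrier T. x)"
  "\<zero>\<^bsub>end_alg A T\<^esub> = (\<lambda>x\<in>carrier T. \<zero>\<^bsub>T\<^esub>)"
  "f \<oplus>\<^bsub>end_alg A T\<^esub> g = (\<lambda>x\<in>carrier T. f x \<oplus>\<^bsub>T\<^esub> g x)"
  by (simp_all add: end_alg_def)

lemma hom_rmod_simps [simp]:
  "carrier (hom_rmod A T Z) = rhom A T Z"
  "\<zero>\<^bsub>hom_rmod A T Z\<^esub> = (\<lambda>x\<in>carrier T. \<zero>\<^bsub>Z\<^esub>)"
  "f \<oplus>\<^bsub>hom_rmod A T Z\<^esub> g = (\<lambda>x\<in>carrier T. f x \<oplus>\<^bsub>Z\<^esub> g x)"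
  "f \<bullet>\<^bsub>hom_rmod A T Z\<^esub> b = compose (carrier T) f b"
  by (simp_all add: hom_rmod_def)

lemma end_alg_ring:
  assumes T: "right_module A T" shows "ring (end_alg A T)"
proof (rule ringI)
  interpret T: right_module A T by fact
  note c = rhom_closed[of _ A T T]
  show "abelian_group (end_alg A T)" by (rule rhom_pointwise_group(1)[OF T T]) simp_all
  show "monoid (end_alg A T)"
  proof (rule monoidI)
    fix f g h assume *: "f \<in> carrier (end_alg A T)" "g \<in> carrier (end_alg A T)" "h \<in> carrier (end_alg A T)"
    show "(f \<otimes>\<^bsub>end_alg A T\<^esub> g) \<otimes>\<^bsub>end_alg A T\<^esub> h = f \<otimes>\<^bsub>end_alg A T\<^esub> (g \<otimes>\<^bsub>end_alg A T\<^esub> h)"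
      using * c by (auto simp: compose_def intro!: restrict_ext)
  next
    fix f assume f: "f \<in> carrier (end_alg A T)"
    show "\<one>\<^bsub>end_alg A T\<^esub> \<otimes>\<^bsub>end_alg A T\<^esub> f = f"
      using f compose_rhom[OF T _ id_rhom[OF T], of f] c
      by (intro rhom_eqI[of _ A T T f T]) (auto simp: compose_eq)
    show "f \<otimes>\<^bsub>end_alg A T\<^esub> \<one>\<^bsub>end_alg A T\<^esub> = f"
      using f compose_rhom[OF T id_rhom[OF T], of f] c
      by (intro rhom_eqI[of _ A T T f T]) (auto simp: compose_eq)
  qed (use compose_rhom[OF T] id_rhom[OF T] in auto)
  fix f g h assume *: "f \<in> carrier (end_alg A T)" "g \<in> carrier (end_alg A T)" "h \<in> carrier (end_alg A T)"
  show "(f \<oplus>\<^bsub>end_alg A T\<^esub> g) \<otimes>\<^bsub>end_alg A T\<^esub> h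
      = f \<otimes>\<^bsub>end_alg A T\<^esub> h \<oplus>\<^bsub>end_alg A T\<^esub> g \<otimes>\<^bsub>end_alg A T\<^esub> h"
    using * c by (auto simp: compose_def intro!: restrict_ext)
  show "h \<otimes>\<^bsub>end_alg A T\<^esub> (f \<oplus>\<^bsub>end_alg A T\<^esub> g)
      = h \<otimes>\<^bsub>end_alg A T\<^esub> f \<oplus>\<^bsub>end_alg A T\<^esub> h \<otimes>\<^bsub>end_alg A T\<^esub> g"
    using * c rhom_add[of h A T T] by (auto simp: compose_def intro!: restrict_ext)
qed

lemma hom_rmod_right_module:
  assumes T: "right_module A T" and Y: "right_module A Y"
  shows "right_module (end_alg A T) (hom_rmod A T Y)"
proof (rule right_moduleI)
  interpret T: right_module A T by fact
  interpret Y: right_module A Y by fact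
  note c = rhom_closed[of _ A T T] rhom_closed[of _ A T Y]
  show "ring (end_alg A T)" by (rule end_alg_ring[OF T])
  show "abelian_group (hom_rmod A T Y)" by (rule rhom_pointwise_group(1)[OF T Y]) simp_all
  fix x assume x: "x \<in> carrier (hom_rmod A T Y)"
  show "x \<bullet>\<^bsub>hom_rmod A T Y\<^esub> \<one>\<^bsub>end_alg A T\<^esub> = x"
    using x compose_rhom[OF T id_rhom[OF T], of x] c
    by (intro rhom_eqI[of _ A T Y x Y]) (auto simp: compose_eq)
next
  note c = rhom_closed[of _ A T T] rhom_closed[of _ A T Y]
  fix x a assume x: "x \<in> carrier (hom_rmod A T Y)" and a: "a \<in> carrier (end_alg A T)"
  show "x \<bullet>\<^bsub>hom_rmod A T Y\<^esub> a \<in> carrier (hom_rmod A T Y)" using x a compose_rhom[OF T] by auto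
  show "(x \<oplus>\<^bsub>hom_rmod A T Y\<^esub> y) \<bullet>\<^bsub>hom_rmod A T Y\<^esub> a
      = x \<bullet>\<^bsub>hom_rmod A T Y\<^esub> a \<oplus>\<^bsub>hom_rmod A T Y\<^esub> y \<bullet>\<^bsub>hom_rmod A T Y\<^esub> a" for y
    using a c by (auto simp: compose_def intro!: restrict_ext)
  fix b assume b: "b \<in> carrier (end_alg A T)"
  show "x \<bullet>\<^bsub>hom_rmod A T Y\<^esub> (a \<oplus>\<^bsub>end_alg A T\<^esub> b)
      = x \<bullet>\<^bsub>hom_rmod A T Y\<^esub> a \<oplus>\<^bsub>hom_rmod A T Y\<^esub> x \<bullet>\<^bsub>hom_rmod A T Y\<^esub> b"
    using x a b c rhom_add[of x A T Y] by (auto simp: compose_def intro!: restrict_ext)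
  show "x \<bullet>\<^bsub>hom_rmod A T Y\<^esub> (a \<otimes>\<^bsub>end_alg A T\<^esub> b)
      = (x \<bullet>\<^bsub>hom_rmod A T Y\<^esub> a) \<bullet>\<^bsub>hom_rmod A T Y\<^esub> b"
    using x a b c by (auto simp: compose_def intro!: restrict_ext)
qed

lemma Units_end_alg:
  assumes T: "right_module A T"
  shows "f \<in> Units (end_alg A T) \<longleftrightarrow> f \<in> rhom A T T \<and> bij_betw f (carrier T) (carrier T)"
proof
  assume "f \<in> Units (end_alg A T)"
  then obtain g where f: "f \<in> rhom A T T" and g: "g \<in> rhom A T T"
    and eq: "compose (carrier T) g f = (\<lambda>x\<in>carrier T. x)" "compose (carrier T) f g = (\<lambda>x\<in>carrier T. x)"
    by (auto simp: Units_def)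
  have gf: "g (f x) = x" "f (g x) = x" if "x \<in> carrier T" for x
    using that fun_cong[OF eq(1), of x] fun_cong[OF eq(2), of x] by (auto simp: compose_eq)
  have "bij_betw f (carrier T) (carrier T)"
    using gf rhom_closed[OF f] rhom_closed[OF g] by (intro bij_betw_byWitness[where f' = g]) auto
  then show "f \<in> rhom A T T \<and> bij_betw f (carrier T) (carrier T)" using f by blast
next
  assume *: "f \<in> rhom A T T \<and> bij_betw f (carrier T) (carrier T)"
  let ?g = "restrict (inv_into (carrier T) f) (carrier T)"
  have g: "?g \<in> rhom A T T" using inv_into_rhom[OF T T] * by blast
  have "?g (f x) = x" "f (?g x) = x" if "x \<in> carrier T" for x
    using * that rhom_closed[of f A T T x] bij_betw_inv_into_left[OF conjunct2[OF *] that]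
      bij_betw_inv_into_right[OF conjunct2[OF *] that] by simp_all
  then have "compose (carrier T) ?g f = (\<lambda>x\<in>carrier T. x)" "compose (carrier T) f ?g = (\<lambda>x\<in>carrier T. x)"
    unfolding compose_def by (metis (no_types, lifting) restrict_ext)+
  then show "f \<in> Units (end_alg A T)"
    using * g unfolding Units_def by (simp, intro bexI[of _ ?g]) simp_all
qed

lemma end_alg_minus:
  assumes "right_module A T" "f \<in> rhom A T T" "g \<in> rhom A T T" "x \<in> carrier T"
  shows "(f \<ominus>\<^bsub>end_alg A T\<^esub> g) x = f x \<ominus>\<^bsub>T\<^esub> g x"
  by (rule rhom_pointwise_group(2)[OF assms(1,1)]) (use assms in simp_all)

lemma one_minus_Units_iff:
  assumes T: "right_module A T" and f: "f \<in> rhom A T T"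
  shows "\<one>\<^bsub>end_alg A T\<^esub> \<ominus>\<^bsub>end_alg A T\<^esub> f \<in> Units (end_alg A T)
    \<longleftrightarrow> bij_betw (\<lambda>x. x \<ominus>\<^bsub>T\<^esub> f x) (carrier T) (carrier T)"
proof -
  interpret B: ring "end_alg A T" by (rule end_alg_ring[OF T])
  have "\<one>\<^bsub>end_alg A T\<^esub> \<ominus>\<^bsub>end_alg A T\<^esub> f \<in> carrier (end_alg A T)"
    using f B.one_closed by (intro B.minus_closed) simp_all
  moreover have "(\<one>\<^bsub>end_alg A T\<^esub> \<ominus>\<^bsub>end_alg A T\<^esub> f) x = x \<ominus>\<^bsub>T\<^esub> f x" if "x \<in> carrier T" for x
    using end_alg_minus[OF T id_rhom[OF T] f that] that by simp
  ultimately show ?thesis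
    unfolding Units_end_alg[OF T] by (simp cong: bij_betw_cong)
qed

text \<open>
  The inverse of \<open>1 - v u\<close> is \<open>1 + v (1 - u v)\<^sup>-\<^sup>1 u\<close>.
\<close>

lemma one_minus_swap_bij:
  assumes M: "right_module A M" and N: "right_module A N"
    and u: "u \<in> rhom A M N" and v: "v \<in> rhom A N M"
    and bij: "bij_betw (\<lambda>y. y \<ominus>\<^bsub>N\<^esub> u (v y)) (carrier N) (carrier N)"
  shows "bij_betw (\<lambda>x. x \<ominus>\<^bsub>M\<^esub> v (u x)) (carrier M) (carrier M)"
proof -
  interpret M: right_module A M by fact
  interpret N: right_module A N by fact
  note c = rhom_closed[OF u] rhom_closed[OF v]
  note uv = rhom_minus[OF M N u] rhom_minus[OF N M v] rhom_zero[OF M N u] rhom_zero[OF N M v]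
    rhom_add[OF u] rhom_add[OF v]
  have ker: "y = \<zero>\<^bsub>N\<^esub>" if "y \<in> carrier N" "y \<ominus>\<^bsub>N\<^esub> u (v y) = \<zero>\<^bsub>N\<^esub>" for y
    by (rule inj_onD[OF bij_betw_imp_inj_on[OF bij]]) (use that c uv in auto)
  let ?f = "\<lambda>x\<in>carrier M. x \<ominus>\<^bsub>M\<^esub> v (u x)"
  have "compose (carrier M) v u \<in> rhom A M M" by (rule compose_rhom[OF M u v])
  from minus_rhom[OF M M id_rhom[OF M] this]
  have f: "?f \<in> rhom A M M" by (simp add: compose_eq cong: restrict_cong)
  have "inj_on ?f (carrier M)"
  proof (rule rhom_inj_onI[OF M M f])
    fix x assume x: "x \<in> carrier M" "?f x = \<zero>\<^bsub>M\<^esub>"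
    then have "x = v (u x)" using c by simp
    then have "u x \<ominus>\<^bsub>N\<^esub> u (v (u x)) = \<zero>\<^bsub>N\<^esub>" using c x by simp
    then have "u x = \<zero>\<^bsub>N\<^esub>" using ker c x by simp
    then show "x = \<zero>\<^bsub>M\<^esub>" using \<open>x = v (u x)\<close> uv by simp
  qed
  moreover have "?f ` carrier M = carrier M"
  proof (intro equalityI subsetI)
    fix y assume y: "y \<in> carrier M"
    have "u y \<in> (\<lambda>y. y \<ominus>\<^bsub>N\<^esub> u (v y)) ` carrier N" using bij c y by (simp add: bij_betw_def)
    then obtain z where z: "z \<in> carrier N" "u y = z \<ominus>\<^bsub>N\<^esub> u (v z)" by blast
    have "v (u (y \<oplus>\<^bsub>M\<^esub> v z)) = v (u y \<oplus>\<^bsub>N\<^esub> u (v z))" using y z c by (simp add: uv)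
    also have "u y \<oplus>\<^bsub>N\<^esub> u (v z) = z" unfolding z(2)
      using z(1) c by (simp add: a_minus_def N.M.a_assoc N.M.l_neg)
    finally have "(y \<oplus>\<^bsub>M\<^esub> v z) \<ominus>\<^bsub>M\<^esub> v (u (y \<oplus>\<^bsub>M\<^esub> v z)) = y"
      using y z c by (simp add: a_minus_def M.M.a_assoc M.M.r_neg)
    then show "y \<in> ?f ` carrier M" using y z c by (intro image_eqI[of _ _ "y \<oplus>\<^bsub>M\<^esub> v z"]) auto
  qed (use c in auto)
  ultimately have "bij_betw ?f (carrier M) (carrier M)" by (simp add: bij_betw_def)
  then show ?thesis by (simp cong: bij_betw_cong)
qed

section \<open>Scalars\<close>

definition scalar :: "('k, 'a) module \<Rightarrow> 'k \<Rightarrow> 'a"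
  where "scalar A c = c \<odot>\<^bsub>A\<^esub> \<one>\<^bsub>A\<^esub>"

text \<open>
  The part of the notion of a \<open>K\<close>-algebra that concerns the scalars: \<open>c \<mapsto> c 1\<close> is a ring
  homomorphism from \<open>K\<close> to the centre.  It passes from \<open>A\<close> to factor algebras and to endomorphism
  algebras, and it makes every right module a vector space.
\<close>

locale central_scalars = K: field K + A: ring A
    for K :: "'k ring" and A :: "('k, 'a) module" +
  assumes scalar_closed: "c \<in> carrier K \<Longrightarrow> scalar A c \<in> carrier A"
    and scalar_add: "\<lbrakk>c \<in> carrier K; d \<in> carrier K\<rbrakk> \<Longrightarrow>
      scalar A (c \<oplus>\<^bsub>K\<^esub> d) = scalar A c \<oplus>\<^bsub>A\<^esub> scalar A d"
    and scalar_mult: "\<lbrakk>c \<in> carrier K; d \<in> carrier K\<rbrakk> \<Longrightarrow>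
      scalar A (c \<otimes>\<^bsub>K\<^esub> d) = scalar A c \<otimes>\<^bsub>A\<^esub> scalar A d"
    and scalar_one: "scalar A \<one>\<^bsub>K\<^esub> = \<one>\<^bsub>A\<^esub>"
    and scalar_central: "\<lbrakk>c \<in> carrier K; a \<in> carrier A\<rbrakk> \<Longrightarrow>
      scalar A c \<otimes>\<^bsub>A\<^esub> a = a \<otimes>\<^bsub>A\<^esub> scalar A c"

lemma fd_algebra_central_scalars:
  fixes K :: "'k ring"
  assumes "fd_algebra K A" shows "central_scalars K A"
proof -
  interpret fd_algebra K A by fact
  show ?thesis
  proof (unfold_locales, unfold scalar_def)
    fix c d assume c: "c \<in> carrier K" "d \<in> carrier K"
    have "(c \<odot>\<^bsub>A\<^esub> \<one>\<^bsub>A\<^esub>) \<otimes>\<^bsub>A\<^esub> (d \<odot>\<^bsub>A\<^esub> \<one>\<^bsub>A\<^esub>) = c \<odot>\<^bsub>A\<^esub> (\<one>\<^bsub>A\<^esub> \<otimes>\<^bsub>A\<^esub> (d \<odot>\<^bsub>A\<^esub> \<one>\<^bsub>A\<^esub>))"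
      using c by (subst smult_mult_left) auto
    then show "(c \<otimes>\<^bsub>K\<^esub> d) \<odot>\<^bsub>A\<^esub> \<one>\<^bsub>A\<^esub> = (c \<odot>\<^bsub>A\<^esub> \<one>\<^bsub>A\<^esub>) \<otimes>\<^bsub>A\<^esub> (d \<odot>\<^bsub>A\<^esub> \<one>\<^bsub>A\<^esub>)"
      using c by (simp add: smult_assoc1)
  next
    fix c a assume "c \<in> carrier K" "a \<in> carrier A"
    then show "(c \<odot>\<^bsub>A\<^esub> \<one>\<^bsub>A\<^esub>) \<otimes>\<^bsub>A\<^esub> a = a \<otimes>\<^bsub>A\<^esub> (c \<odot>\<^bsub>A\<^esub> \<one>\<^bsub>A\<^esub>)"
      using smult_mult_left[of c "\<one>\<^bsub>A\<^esub>" a] smult_mult_right[of c a "\<one>\<^bsub>A\<^esub>"] by simp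
  qed (auto simp: smult_l_distr)
qed

text \<open>
  Restriction of scalars: a vector space is a right module over \<open>K\<close>, so that the theory of right
  modules covers subspaces, linear maps and linear functionals too.
\<close>

definition vect :: "('k, 'a) module \<Rightarrow> ('a, 'm) rmodule \<Rightarrow> ('k, 'm) rmodule"
  where "vect A M =
    \<lparr>carrier = carrier M, monoid.mult = monoid.mult M, one = one M, ring.zero = ring.zero M,
     ring.add = ring.add M, ract = (\<lambda>x c. x \<bullet>\<^bsub>M\<^esub> scalar A c)\<rparr>"

lemma vect_simps [simp]:
  "carrier (vect A M) = carrier M" "\<zero>\<^bsub>vect A M\<^esub> = \<zero>\<^bsub>M\<^esub>"
  "x \<oplus>\<^bsub>vect A M\<^esub> y = x \<oplus>\<^bsub>M\<^esub> y" "x \<bullet>\<^bsub>vect A M\<^esub> c = x \<bullet>\<^bsub>M\<^esub> scalar A c"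
  "a_minus (vect A M) = a_minus M"
  by (auto simp: vect_def a_minus_def a_inv_def m_inv_def fun_eq_iff)

context central_scalars
begin

lemma vect_right_module:
  assumes "right_module A M" shows "right_module K (vect A M)"
proof -
  interpret M: right_module A M by fact
  show ?thesis
  proof (rule right_moduleI)
    show "abelian_group (vect A M)" by (rule abelian_group_cong[OF M.M.abelian_group_axioms]) simp_all
  qed (auto simp: scalar_closed scalar_add scalar_mult scalar_one M.ract_closed M.ract_add_left
        M.ract_add_right M.ract_mult M.ract_one K.ring_axioms)
qed

lemma vect_rhom: "f \<in> rhom A M N \<Longrightarrow> f \<in> rhom K (vect A M) (vect A N)"
  by (auto simp: rhom_def scalar_closed)

lemma vect_rsubmodule:
  assumes "right_module A M" "rsubmodule A L M" shows "rsubmodule K L (vect A M)"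
  by (rule right_module.rsubmoduleI[OF vect_right_module[OF assms(1)]])
    (use rsubmodule_subset[OF assms(2)] rsubmodule_zero_closed[OF assms(2)]
      rsubmodule_add_closed[OF assms(2)] rsubmodule_ract_closed[OF assms(2)]
      in \<open>auto simp: scalar_closed\<close>)

lemma fg_rmodule_if_vect:
  assumes M: "right_module A M" and "fg_rmodule K (vect A M)" shows "fg_rmodule A M"
proof -
  obtain Z where Z: "finite Z" "Z \<subseteq> carrier M" "gen_submodule K (vect A M) Z = carrier M"
    using assms(2) by (auto simp: fg_rmodule_def)
  have "gen_submodule K (vect A M) Z \<subseteq> gen_submodule A M Z"
    by (intro gen_submodule_least vect_rsubmodule[OF M] gen_submodule_rsubmodule[OF M Z(2)]
      gen_submodule_incl[OF M Z(2)])
  then have "gen_submodule A M Z = carrier M"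
    using Z(3) rsubmodule_subset[OF gen_submodule_rsubmodule[OF M Z(2)]] by auto
  then show ?thesis using M Z by (auto simp: fg_rmodule_def)
qed

lemma scalar_end_alg: "scalar (end_alg A T) c = (\<lambda>x\<in>carrier T. x \<bullet>\<^bsub>T\<^esub> scalar A c)"
  by (auto simp: scalar_def end_alg_def intro!: restrict_ext)

lemma end_alg_central_scalars:
  assumes T: "right_module A T" shows "central_scalars K (end_alg A T)"
proof -
  interpret T: right_module A T by fact
  interpret B: ring "end_alg A T" by (rule end_alg_ring[OF T])
  have closed: "(\<lambda>x\<in>carrier T. x \<bullet>\<^bsub>T\<^esub> scalar A c) \<in> rhom A T T" if "c \<in> carrier K" for c
    by (rule restrict_rhomI[OF T])
      (use that in \<open>auto simp: scalar_closed T.ract_closed T.ract_add_left T.ract_mult[symmetric] scalar_central\<close>)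
  show ?thesis
  proof (unfold_locales, unfold scalar_end_alg)
    fix c d assume c: "c \<in> carrier K" "d \<in> carrier K"
    show "(\<lambda>x\<in>carrier T. x \<bullet>\<^bsub>T\<^esub> scalar A (c \<oplus>\<^bsub>K\<^esub> d)) =
      (\<lambda>x\<in>carrier T. x \<bullet>\<^bsub>T\<^esub> scalar A c) \<oplus>\<^bsub>end_alg A T\<^esub> (\<lambda>x\<in>carrier T. x \<bullet>\<^bsub>T\<^esub> scalar A d)"
      using c by (auto simp: scalar_add scalar_closed T.ract_add_right intro!: restrict_ext)
    have "scalar A (c \<otimes>\<^bsub>K\<^esub> d) = scalar A d \<otimes>\<^bsub>A\<^esub> scalar A c"
      using c scalar_mult[of d c] K.m_comm by simp
    then show "(\<lambda>x\<in>carrier T. x \<bullet>\<^bsub>T\<^esub> scalar A (c \<otimes>\<^bsub>K\<^esub> d)) =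
      (\<lambda>x\<in>carrier T. x \<bullet>\<^bsub>T\<^esub> scalar A c) \<otimes>\<^bsub>end_alg A T\<^esub> (\<lambda>x\<in>carrier T. x \<bullet>\<^bsub>T\<^esub> scalar A d)"
      using c by (auto simp: scalar_closed T.ract_mult T.ract_closed compose_def intro!: restrict_ext)
  next
    show "(\<lambda>x\<in>carrier T. x \<bullet>\<^bsub>T\<^esub> scalar A \<one>\<^bsub>K\<^esub>) = \<one>\<^bsub>end_alg A T\<^esub>"
      by (auto simp: scalar_one T.ract_one intro!: restrict_ext)
    fix c assume c: "c \<in> carrier K"
    show "(\<lambda>x\<in>carrier T. x \<bullet>\<^bsub>T\<^esub> scalar A c) \<in> carrier (end_alg A T)" using closed c by simp
    fix f assume f: "f \<in> carrier (end_alg A T)"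
    show "(\<lambda>x\<in>carrier T. x \<bullet>\<^bsub>T\<^esub> scalar A c) \<otimes>\<^bsub>end_alg A T\<^esub> f =
      f \<otimes>\<^bsub>end_alg A T\<^esub> (\<lambda>x\<in>carrier T. x \<bullet>\<^bsub>T\<^esub> scalar A c)"
      using c f rhom_closed[of f A T T] rhom_ract[of f A T T]
      by (auto simp: scalar_closed compose_def T.ract_closed intro!: restrict_ext)
  qed
qed

text \<open>
  Functionals on \<open>Hom(T, Y)\<close>: evaluate at a generator of the vector space \<open>T\<close>, then apply a
  coordinate of \<open>Y\<close>.
\<close>

lemma hom_rmod_separating:
  assumes T: "right_module A T" and Y: "right_module A Y"
    and fg: "fg_rmodule K (vect A T)" and sep: "separating K (vect A Y) F"
  obtains F' where "separating K (vect (end_alg A T) (hom_rmod A T Y)) F'"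
proof -
  interpret T: right_module A T by fact
  interpret Y: right_module A Y by fact
  interpret B: central_scalars K "end_alg A T" by (rule end_alg_central_scalars[OF T])
  have H: "right_module K (vect (end_alg A T) (hom_rmod A T Y))"
    by (rule B.vect_right_module[OF hom_rmod_right_module[OF T Y]])
  obtain Z where Z: "finite Z" "Z \<subseteq> carrier T" "gen_submodule K (vect A T) Z = carrier T"
    using fg by (auto simp: fg_rmodule_def)
  let ?ev = "\<lambda>(\<phi>, z). \<lambda>h\<in>rhom A T Y. \<phi> (h z)"
  have F: "finite F" "F \<subseteq> rhom K (vect A Y) (regular K)"
    "\<And>x. x \<in> carrier Y \<Longrightarrow> \<forall>\<phi>\<in>F. \<phi> x = \<zero>\<^bsub>K\<^esub> \<Longrightarrow> x = \<zero>\<^bsub>Y\<^esub>"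
    using sep by (auto simp: separating_def)
  have "separating K (vect (end_alg A T) (hom_rmod A T Y)) (?ev ` (F \<times> Z))"
    unfolding separating_def
  proof (intro conjI ballI impI)
    show "finite (?ev ` (F \<times> Z))" using F(1) Z(1) by simp
    show "?ev ` (F \<times> Z) \<subseteq> rhom K (vect (end_alg A T) (hom_rmod A T Y)) (regular K)"
    proof safe
      fix \<phi> z assume *: "\<phi> \<in> F" "z \<in> Z"
      then have \<phi>: "\<phi> \<in> rhom K (vect A Y) (regular K)" and z: "z \<in> carrier T" using F(2) Z(2) by auto
      have sc: "h (z \<bullet>\<^bsub>T\<^esub> scalar A c) = h z \<bullet>\<^bsub>Y\<^esub> scalar A c"
        if "h \<in> rhom A T Y" "c \<in> carrier K" for h c
        using rhom_ract[OF that(1) z scalar_closed[OF that(2)]] .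
      have "restrict (\<lambda>h. \<phi> (h z)) (carrier (vect (end_alg A T) (hom_rmod A T Y)))
          \<in> rhom K (vect (end_alg A T) (hom_rmod A T Y)) (regular K)"
      proof (rule restrict_rhomI[OF H])
        fix h c assume "h \<in> carrier (vect (end_alg A T) (hom_rmod A T Y))" and c: "c \<in> carrier K"
        then have h: "h \<in> rhom A T Y" by simp
        have "(h \<bullet>\<^bsub>vect (end_alg A T) (hom_rmod A T Y)\<^esub> c) z = h z \<bullet>\<^bsub>Y\<^esub> scalar A c"
          using z sc[OF h c] by (simp add: scalar_end_alg compose_def)
        then show "\<phi> ((h \<bullet>\<^bsub>vect (end_alg A T) (hom_rmod A T Y)\<^esub> c) z) = \<phi> (h z) \<bullet>\<^bsub>regular K\<^esub> c"
          using rhom_ract[OF \<phi>, of "h z" c] rhom_closed[OF h z] c by simp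
      qed (use z rhom_closed[OF \<phi>] rhom_add[OF \<phi>] rhom_closed[of _ A T Y] in auto)
      then show "(\<lambda>h\<in>rhom A T Y. \<phi> (h z)) \<in> rhom K (vect (end_alg A T) (hom_rmod A T Y)) (regular K)"
        by simp
    qed
    fix h assume h: "h \<in> carrier (vect (end_alg A T) (hom_rmod A T Y))"
      and ann: "\<forall>\<theta>\<in>?ev ` (F \<times> Z). \<theta> h = \<zero>\<^bsub>K\<^esub>"
    have h': "h \<in> rhom A T Y" using h by simp
    have "h z = \<zero>\<^bsub>Y\<^esub>" if "z \<in> Z" for z
      using F(3)[of "h z"] rhom_closed[OF h'] Z(2) that ann h' by auto
    then have "Z \<subseteq> {x \<in> carrier T. h x = \<zero>\<^bsub>Y\<^esub>}" using Z(2) by auto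
    then have "gen_submodule K (vect A T) Z \<subseteq> {x \<in> carrier T. h x = \<zero>\<^bsub>Y\<^esub>}"
      by (intro gen_submodule_least vect_rsubmodule[OF T] rhom_ker_rsubmodule[OF T Y h'])
    then have "h x = \<zero>\<^bsub>Y\<^esub>" if "x \<in> carrier T" for x using Z(3) that by auto
    then show "h = \<zero>\<^bsub>vect (end_alg A T) (hom_rmod A T Y)\<^esub>"
      using rhom_eqI[OF h' zero_rhom[OF T Y]] by simp
  qed
  then show thesis by (rule that)
qed

end

text \<open>
  The products of generators of the module \<open>M\<close> with generators of the vector space \<open>A\<close> span \<open>M\<close>.
\<close>

lemma fd_algebra_fg_vect:
  fixes K :: "'k ring"
  assumes "fd_algebra K A" "fg_rmodule A M"
  shows "fg_rmodule K (vect A M)"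
proof -
  interpret fd_algebra K A by fact
  interpret S: central_scalars K A by (rule fd_algebra_central_scalars[OF assms(1)])
  have M: "right_module A M" using assms(2) by (simp add: fg_rmodule_def)
  interpret M: right_module A M by fact
  obtain W where W: "finite W" "W \<subseteq> carrier A" "\<Inter>{H. submodule H K A \<and> W \<subseteq> H} = carrier A"
    using finite_dimensional by blast
  obtain Z where Z: "finite Z" "Z \<subseteq> carrier M" "gen_submodule A M Z = carrier M"
    using assms(2) by (auto simp: fg_rmodule_def)
  have V: "right_module K (vect A M)" by (rule S.vect_right_module[OF M])
  let ?Z = "(\<lambda>(z, w). z \<bullet>\<^bsub>M\<^esub> w) ` (Z \<times> W)" and ?G = "gen_submodule K (vect A M) ((\<lambda>(z, w). z \<bullet>\<^bsub>M\<^esub> w) ` (Z \<times> W))"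
  have Z': "finite ?Z" "?Z \<subseteq> carrier (vect A M)" using W Z by (auto intro!: M.ract_closed)
  note G = gen_submodule_rsubmodule[OF V Z'(2)] gen_submodule_incl[OF V Z'(2)]
  note Gc = rsubmodule_zero_closed[OF G(1)] rsubmodule_add_closed[OF G(1)]
    rsubmodule_ract_closed[OF G(1)] subsetD[OF rsubmodule_subset[OF G(1)]]
  have Ginv: "\<ominus>\<^bsub>M\<^esub> x \<in> ?G" if "x \<in> ?G" for x
  proof -
    interpret V: right_module K "vect A M" by fact
    have "\<zero>\<^bsub>M\<^esub> \<ominus>\<^bsub>M\<^esub> x \<in> ?G"
      using rsubmodule_minus_closed[OF G(1) V.M.abelian_group_axioms Gc(1) that] by simp
    then show ?thesis using Gc(4)[OF that] by (simp add: a_minus_def)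
  qed
  have zA: "z \<bullet>\<^bsub>M\<^esub> a \<in> ?G" if z: "z \<in> Z" and a: "a \<in> carrier A" for z a
  proof -
    have zM: "z \<in> carrier M" using z Z by auto
    have "submodule {a \<in> carrier A. z \<bullet>\<^bsub>M\<^esub> a \<in> ?G} K A"
    proof (rule submoduleI)
      fix c x assume c: "c \<in> carrier K" and "x \<in> {a \<in> carrier A. z \<bullet>\<^bsub>M\<^esub> a \<in> ?G}"
      then have x: "x \<in> carrier A" "z \<bullet>\<^bsub>M\<^esub> x \<in> ?G" by auto
      have "c \<odot>\<^bsub>A\<^esub> x = x \<otimes>\<^bsub>A\<^esub> scalar A c"
        using c x smult_mult_right[of c x "\<one>\<^bsub>A\<^esub>"] by (simp add: scalar_def)
      then have "z \<bullet>\<^bsub>M\<^esub> (c \<odot>\<^bsub>A\<^esub> x) = (z \<bullet>\<^bsub>M\<^esub> x) \<bullet>\<^bsub>vect A M\<^esub> c"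
        using c x zM by (simp add: M.ract_mult S.scalar_closed)
      then show "c \<odot>\<^bsub>A\<^esub> x \<in> {a \<in> carrier A. z \<bullet>\<^bsub>M\<^esub> a \<in> ?G}"
        using c x Gc(3)[OF x(2) c] by simp
    qed (use zM Gc(1,2) Ginv in \<open>auto simp: M.ract_add_right M.ract_inv_right\<close>)
    moreover have "W \<subseteq> {a \<in> carrier A. z \<bullet>\<^bsub>M\<^esub> a \<in> ?G}" using W(2) z G(2) by auto
    ultimately have "carrier A \<subseteq> {a \<in> carrier A. z \<bullet>\<^bsub>M\<^esub> a \<in> ?G}" using W(3) by blast
    then show ?thesis using a by blast
  qed
  have "rsubmodule A {x \<in> carrier M. \<forall>a\<in>carrier A. x \<bullet>\<^bsub>M\<^esub> a \<in> ?G} M"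
    by (rule M.rsubmoduleI)
      (use Gc(1,2) in \<open>auto simp: M.ract_closed M.ract_add_left M.ract_mult[symmetric]\<close>)
  then have "carrier M \<subseteq> {x \<in> carrier M. \<forall>a\<in>carrier A. x \<bullet>\<^bsub>M\<^esub> a \<in> ?G}"
    using gen_submodule_least[of A _ M Z] Z(2,3) zA by blast
  then have one: "x \<bullet>\<^bsub>M\<^esub> \<one>\<^bsub>A\<^esub> \<in> ?G" if "x \<in> carrier M" for x
    using that A.one_closed by blast
  have "x \<in> ?G" if "x \<in> carrier M" for x
    using one[OF that] unfolding M.ract_one[OF that] .
  then have "?G = carrier (vect A M)" using rsubmodule_subset[OF G(1)] by auto
  then show ?thesis using V Z' unfolding fg_rmodule_def by blast
qed

section \<open>Endomorphisms of indecomposable modules\<close>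

lemma funpow_rhom:
  assumes M: "right_module A M" and h: "h \<in> rhom A M M"
  shows "restrict (h ^^ k) (carrier M) \<in> rhom A M M"
proof (induction k)
  case 0
  have "restrict (h ^^ 0) (carrier M) = (\<lambda>x\<in>carrier M. x)" by (auto intro!: restrict_ext)
  then show ?case using id_rhom[OF M] by (simp only:)
next
  case (Suc k)
  have "restrict (h ^^ Suc k) (carrier M) = compose (carrier M) h (restrict (h ^^ k) (carrier M))"
    by (auto simp: compose_def intro!: restrict_ext)
  then show ?case using compose_rhom[OF M Suc h] by (simp only:)
qed

lemma funpow_closed: "h \<in> rhom A M M \<Longrightarrow> x \<in> carrier M \<Longrightarrow> (h ^^ k) x \<in> carrier M"
  by (induction k) (auto simp: rhom_closed)

text \<open>
  The images and the kernels of the powers of \<open>h\<close> stabilise; from then on \<open>M\<close> is the direct sum of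
  the image and the kernel of \<open>h\<^sup>k\<close>, and one of them is zero.
\<close>

lemma (in central_scalars) Fitting:
  assumes M: "right_module A M" and fg: "fg_rmodule K (vect A M)" and h: "h \<in> rhom A M M"
    and indec: "indecomposable A M"
  shows "bij_betw h (carrier M) (carrier M) \<or> (\<exists>k. \<forall>x\<in>carrier M. (h ^^ k) x = \<zero>\<^bsub>M\<^esub>)"
proof -
  interpret M: right_module A M by fact
  obtain F where F: "separating K (vect A M) F"
    using fg_imp_separating[OF K.field_axioms fg] by blast
  obtain r :: "_ \<Rightarrow> nat" and b where
    r_mono: "\<And>U W. rsubmodule K U (vect A M) \<Longrightarrow> rsubmodule K W (vect A M) \<Longrightarrow> U \<subseteq> W \<Longrightarrow> r U \<le> r W"
    and r_eq: "\<And>U W. rsubmodule K U (vect A M) \<Longrightarrow> rsubmodule K W (vect A M) \<Longrightarrow> U \<subseteq> W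
      \<Longrightarrow> r W \<le> r U \<Longrightarrow> U = W"
    and r_bound: "\<And>U. r U \<le> b"
    using separating_rank[OF K.field_axioms vect_right_module[OF M] F] by blast
  note hk = funpow_rhom[OF M h]
  define I where "I k = (h ^^ k) ` carrier M" for k
  define N where "N k = {x \<in> carrier M. (h ^^ k) x = \<zero>\<^bsub>M\<^esub>}" for k
  have I_sub: "rsubmodule A (I k) M" for k
    using rhom_image_rsubmodule[OF M M hk[of k] M.rsubmodule_carrier] by (simp add: I_def)
  have N_sub: "rsubmodule A (N k) M" for k
    using rhom_ker_rsubmodule[OF M M hk[of k]] by (simp add: N_def cong: conj_cong)
  have I_anti: "I (k + m) \<subseteq> I k" for k m
    using funpow_closed[OF h] by (auto simp: I_def funpow_add)
  have zero: "(h ^^ m) \<zero>\<^bsub>M\<^esub> = \<zero>\<^bsub>M\<^esub>" for m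
    using rhom_zero[OF M M hk[of m]] by simp
  have N_mono: "N k \<subseteq> N (k + m)" for k m
    using zero by (auto simp: N_def funpow_add add.commute[of k])
  obtain i where i: "\<And>k. r (I i) \<le> r (I k)"
    using ex_has_least_nat[of "\<lambda>_. True" 0 "\<lambda>k. r (I k)"] by auto
  obtain j where j: "\<And>k. r (N k) \<le> r (N j)"
    using ex_has_greatest_nat[of "\<lambda>_. True" 0 "\<lambda>k. r (N k)" "Suc b"] r_bound by (auto simp: less_Suc_eq_le)
  have I_eq: "I (i + m) = I i" for m
    by (rule r_eq) (use vect_rsubmodule[OF M I_sub] I_anti i in auto)
  have N_eq: "N j = N (j + m)" for m
    by (rule r_eq) (use vect_rsubmodule[OF M N_sub] N_mono j in auto)
  \<comment> \<open>\<open>k\<close> is past both stabilisation points, and positive so that \<open>h\<close> is bijective if \<open>h\<^sup>k\<close> is\<close>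
  define k where "k = Suc (i + j)"
  have Ik: "I (k + k) = I k" using I_eq[of "Suc j"] I_eq[of "Suc j + k"] by (simp add: k_def add_ac)
  have Nk: "N (k + k) = N k" using N_eq[of "Suc i"] N_eq[of "Suc i + k"] by (simp add: k_def add_ac)
  have "direct_summand A (I k) M"
    unfolding direct_summand_def
  proof (intro conjI exI[of _ "N k"] I_sub N_sub equalityI subsetI)
    fix x assume "x \<in> I k \<inter> N k"
    then obtain y where y: "y \<in> carrier M" "x = (h ^^ k) y" "(h ^^ k) x = \<zero>\<^bsub>M\<^esub>"
      by (auto simp: I_def N_def)
    then have "y \<in> N (k + k)" by (simp add: N_def funpow_add)
    then show "x \<in> {\<zero>\<^bsub>M\<^esub>}" unfolding Nk using y by (simp add: N_def)
  next
    fix x assume x: "x \<in> carrier M"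
    then have "(h ^^ k) x \<in> I (k + k)" unfolding Ik by (simp add: I_def)
    then obtain y where y: "y \<in> carrier M" "(h ^^ k) x = (h ^^ (k + k)) y" by (auto simp: I_def)
    let ?z = "(h ^^ k) y"
    have z: "?z \<in> carrier M" using funpow_closed[OF h y(1)] .
    have "(h ^^ k) (x \<ominus>\<^bsub>M\<^esub> ?z) = \<zero>\<^bsub>M\<^esub>"
      using rhom_minus[OF M M hk[of k] x z] x z y funpow_closed[OF h z] by (simp add: funpow_add)
    then have "x \<ominus>\<^bsub>M\<^esub> ?z \<in> N k" using x z by (simp add: N_def)
    moreover have "?z \<in> I k" using y by (simp add: I_def)
    moreover have "x = ?z \<oplus>\<^bsub>M\<^esub> (x \<ominus>\<^bsub>M\<^esub> ?z)"
      using x z by (simp add: a_minus_def M.M.a_lcomm[of ?z x] M.M.r_neg)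
    ultimately show "x \<in> I k <+>\<^bsub>M\<^esub> N k" unfolding set_add_def' by blast
  qed (use rsubmodule_zero_closed[OF I_sub] rsubmodule_zero_closed[OF N_sub]
      subsetD[OF rsubmodule_subset[OF I_sub]] subsetD[OF rsubmodule_subset[OF N_sub]]
      in \<open>auto simp: set_add_def'\<close>)
  then consider "I k = {\<zero>\<^bsub>M\<^esub>}" | "I k = carrier M"
    using indec by (auto simp: indecomposable_def)
  then show ?thesis
  proof cases
    case 1
    then show ?thesis by (auto simp: I_def intro!: exI[of _ k])
  next
    case 2
    have Suc_k: "(h ^^ k) x = (h ^^ (i + j)) (h x)" "(h ^^ k) x = h ((h ^^ (i + j)) x)" for x
      by (simp_all add: k_def funpow_swap1)
    have "carrier M \<subseteq> h ` carrier M"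
    proof
      fix x assume "x \<in> carrier M"
      then have "x \<in> I k" using 2 by simp
      then show "x \<in> h ` carrier M" using Suc_k(2) funpow_closed[OF h] by (auto simp: I_def)
    qed
    then have "h ` carrier M = carrier M" using rhom_closed[OF h] by blast
    moreover have "N k = {\<zero>\<^bsub>M\<^esub>}"
    proof -
      have "x = \<zero>\<^bsub>M\<^esub>" if x: "x \<in> N k" for x
      proof -
        have "x \<in> I k" using 2 x rsubmodule_subset[OF N_sub] by blast
        then obtain y where y: "y \<in> carrier M" "x = (h ^^ k) y" by (auto simp: I_def)
        then have "y \<in> N (k + k)" using x by (simp add: N_def funpow_add)
        then show ?thesis unfolding Nk using y by (simp add: N_def)
      qed
      then show ?thesis using rsubmodule_zero_closed[OF N_sub] by blast
    qed
    then have "x = \<zero>\<^bsub>M\<^esub>" if "x \<in> carrier M" "h x = \<zero>\<^bsub>M\<^esub>" for x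
      using that Suc_k(1)[of x] zero by (auto simp: N_def)
    then have "inj_on h (carrier M)" by (rule rhom_inj_onI[OF M M h])
    ultimately show ?thesis by (simp add: bij_betw_def)
  qed
qed

lemma (in central_scalars) indecomposable_local:
  assumes M: "right_module A M" and fg: "fg_rmodule K (vect A M)" and h: "h \<in> rhom A M M"
    and indec: "indecomposable A M"
  shows "bij_betw h (carrier M) (carrier M) \<or> bij_betw (\<lambda>x. x \<ominus>\<^bsub>M\<^esub> h x) (carrier M) (carrier M)"
proof -
  interpret M: right_module A M by fact
  define g where "g = (\<lambda>x\<in>carrier M. x \<ominus>\<^bsub>M\<^esub> h x)"
  have g_eq: "g x = x \<ominus>\<^bsub>M\<^esub> h x" if "x \<in> carrier M" for x
    using that by (simp add: g_def)
  have g: "g \<in> rhom A M M"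
    using minus_rhom[OF M M id_rhom[OF M] h] by (simp add: g_def cong: restrict_cong)
  consider "bij_betw h (carrier M) (carrier M)" | "bij_betw g (carrier M) (carrier M)"
    | k m where "\<forall>x\<in>carrier M. (h ^^ k) x = \<zero>\<^bsub>M\<^esub>" "\<forall>x\<in>carrier M. (g ^^ m) x = \<zero>\<^bsub>M\<^esub>"
    using Fitting[OF M fg h indec] Fitting[OF M fg g indec] by blast
  then show ?thesis
  proof cases
    case 3
    \<comment> \<open>a nilpotent \<open>h\<close> makes \<open>1 - h\<close> injective, so \<open>1 - h\<close> is not nilpotent as well\<close>
    have inj: "x = \<zero>\<^bsub>M\<^esub>" if x: "x \<in> carrier M" "g x = \<zero>\<^bsub>M\<^esub>" for x
    proof -
      have "h x = x" using x rhom_closed[OF h] by (simp add: g_eq)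
      then have "(h ^^ k) x = x" by (induction k) auto
      then show ?thesis using 3(1) x by simp
    qed
    have "x = \<zero>\<^bsub>M\<^esub>" if "x \<in> carrier M" "(g ^^ m) x = \<zero>\<^bsub>M\<^esub>" for x using that
    proof (induction m)
      case (Suc m)
      then show ?case using inj[of "(g ^^ m) x"] funpow_closed[OF g, of x m] by simp
    qed simp
    then have "carrier M = {\<zero>\<^bsub>M\<^esub>}" using 3(2) M.M.zero_closed by blast
    then show ?thesis using indec by (simp add: indecomposable_def)
  qed (simp_all add: g_eq cong: bij_betw_cong)
qed

text \<open>
  If \<open>f\<close> is not in the radical, then \<open>1 - g f\<close> is not invertible for some \<open>g\<close>, hence neither is
  the endomorphism \<open>1 - f g\<close> of \<open>U\<close>.  The ring \<open>End U\<close> is local, so \<open>f g\<close> is invertible, and its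
  inverse corrects \<open>g\<close> to a section of \<open>f\<close>.
\<close>

lemma (in central_scalars) not_rad_split:
  assumes T: "right_module A T" and U: "right_module A U" and fg: "fg_rmodule K (vect A U)"
    and indec: "indecomposable A U" and f: "f \<in> rhom A T U" "f \<notin> rad_hom A T U"
  obtains g where "g \<in> rhom A U T" "\<And>x. x \<in> carrier U \<Longrightarrow> f (g x) = x"
proof -
  obtain g where g: "g \<in> rhom A U T"
    "\<one>\<^bsub>end_alg A T\<^esub> \<ominus>\<^bsub>end_alg A T\<^esub> compose (carrier T) g f \<notin> Units (end_alg A T)"
    using f by (auto simp: rad_hom_def)
  have gf: "compose (carrier T) g f \<in> rhom A T T" by (rule compose_rhom[OF T f(1) g(1)])
  have "\<not> bij_betw (\<lambda>x. x \<ominus>\<^bsub>T\<^esub> g (f x)) (carrier T) (carrier T)"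
    using g(2) unfolding one_minus_Units_iff[OF T gf] by (simp add: compose_eq cong: bij_betw_cong)
  then have "\<not> bij_betw (\<lambda>y. y \<ominus>\<^bsub>U\<^esub> f (g y)) (carrier U) (carrier U)"
    using one_minus_swap_bij[OF T U f(1) g(1)] by blast
  moreover have fg': "compose (carrier U) f g \<in> rhom A U U" by (rule compose_rhom[OF U g(1) f(1)])
  ultimately have bij: "bij_betw (compose (carrier U) f g) (carrier U) (carrier U)"
    using indecomposable_local[OF U fg fg' indec] by (simp add: compose_eq cong: bij_betw_cong)
  let ?k = "restrict (inv_into (carrier U) (compose (carrier U) f g)) (carrier U)"
  have k: "?k \<in> rhom A U U" by (rule inv_into_rhom[OF U U fg' bij])
  have "f (compose (carrier U) g ?k x) = x" if x: "x \<in> carrier U" for x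
  proof -
    have "f (g (?k x)) = compose (carrier U) f g (?k x)"
      using rhom_closed[OF k x] by (simp only: compose_eq)
    also have "\<dots> = x" using x bij_betw_inv_into_right[OF bij x] by simp
    finally show ?thesis using x by (simp only: compose_eq)
  qed
  then show thesis using compose_rhom[OF U k g(1)] by (rule that[rotated])
qed

lemma rad_hom_one_minus_Units:
  assumes T: "right_module A T" and N: "rsubmodule A N T"
    and f: "f \<in> rad_hom A T (T\<lparr>carrier := N\<rparr>)" and b: "b \<in> rhom A T T"
  shows "\<one>\<^bsub>end_alg A T\<^esub> \<ominus>\<^bsub>end_alg A T\<^esub> compose (carrier T) f b \<in> Units (end_alg A T)"
proof -
  have "f \<in> rhom A T (T\<lparr>carrier := N\<rparr>)" using f by (simp add: rad_hom_def)
  then have "f \<in> rhom A T T \<and> f ` carrier T \<subseteq> N"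
    by (simp only: rhom_submodule[OF rsubmodule_subset[OF N]])
  then have f': "f \<in> rhom A T T" and fN: "f ` carrier T \<subseteq> N" by simp_all
  have eq: "compose (carrier T) (restrict b N) f = compose (carrier T) b f"
    using fN by (auto simp: compose_def intro!: restrict_ext)
  have "\<one>\<^bsub>end_alg A T\<^esub> \<ominus>\<^bsub>end_alg A T\<^esub> compose (carrier T) (restrict b N) f \<in> Units (end_alg A T)"
    using f restrict_submodule_rhom[OF b T N] by (simp add: rad_hom_def)
  then have "bij_betw (\<lambda>x. x \<ominus>\<^bsub>T\<^esub> b (f x)) (carrier T) (carrier T)"
    unfolding eq one_minus_Units_iff[OF T compose_rhom[OF T f' b]]
    by (simp add: compose_eq cong: bij_betw_cong)
  then have "bij_betw (\<lambda>x. x \<ominus>\<^bsub>T\<^esub> f (b x)) (carrier T) (carrier T)"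
    by (rule one_minus_swap_bij[OF T T b f'])
  then show ?thesis
    unfolding one_minus_Units_iff[OF T compose_rhom[OF T b f']]
    by (simp add: compose_eq cong: bij_betw_cong)
qed

section \<open>Lifting along quotients in \<open>Fac T\<close>\<close>

lemma pointwise_finsum_closed:
  assumes N: "right_module A N" and "finite I" "\<And>k. k \<in> I \<Longrightarrow> f k \<in> S" and S: "S \<subseteq> rhom A P N"
    and zero: "(\<lambda>y\<in>carrier P. \<zero>\<^bsub>N\<^esub>) \<in> S"
    and add: "\<And>g h. g \<in> S \<Longrightarrow> h \<in> S \<Longrightarrow> (\<lambda>y\<in>carrier P. g y \<oplus>\<^bsub>N\<^esub> h y) \<in> S"
  shows "(\<lambda>y\<in>carrier P. \<Oplus>\<^bsub>N\<^esub>k\<in>I. f k y) \<in> S"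
  using assms(2,3)
proof (induction I)
  interpret N: right_module A N by fact
  case empty
  show ?case unfolding N.M.finsum_empty by (rule zero)
next
  interpret N: right_module A N by fact
  case (insert i I)
  have c: "f k y \<in> carrier N" if "k \<in> insert i I" "y \<in> carrier P" for k y
    using rhom_closed[OF subsetD[OF S insert.prems[OF that(1)]] that(2)] .
  have "(\<lambda>y\<in>carrier P. f i y \<oplus>\<^bsub>N\<^esub> (\<lambda>y\<in>carrier P. \<Oplus>\<^bsub>N\<^esub>k\<in>I. f k y) y) \<in> S"
    using insert by (intro add) auto
  moreover have "(\<lambda>y\<in>carrier P. f i y \<oplus>\<^bsub>N\<^esub> (\<lambda>y\<in>carrier P. \<Oplus>\<^bsub>N\<^esub>k\<in>I. f k y) y)
      = (\<lambda>y\<in>carrier P. \<Oplus>\<^bsub>N\<^esub>k\<in>insert i I. f k y)"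
    using insert.hyps c by (intro restrict_ext) (simp add: N.M.finsum_insert Pi_def)
  ultimately show ?case by (simp only:)
qed

lemma rhom_factor:
  assumes P: "right_module A P" and T: "right_module A T" and U: "right_module A U"
    and p: "p \<in> rhom A P T" "p ` carrier P = carrier T" and w: "w \<in> rhom A P U"
    and ker: "\<And>y. y \<in> carrier P \<Longrightarrow> p y = \<zero>\<^bsub>T\<^esub> \<Longrightarrow> w y = \<zero>\<^bsub>U\<^esub>"
  obtains v where "v \<in> rhom A T U" "\<And>y. y \<in> carrier P \<Longrightarrow> v (p y) = w y"
proof -
  interpret P: right_module A P by fact
  interpret T: right_module A T by fact
  interpret U: right_module A U by fact
  have eq: "w y = w y'" if "y \<in> carrier P" "y' \<in> carrier P" "p y = p y'" for y y'
  proof -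
    have "p (y \<ominus>\<^bsub>P\<^esub> y') = \<zero>\<^bsub>T\<^esub>" using that rhom_closed[OF p(1)] by (simp add: rhom_minus[OF P T p(1)])
    then have "w y \<ominus>\<^bsub>U\<^esub> w y' = \<zero>\<^bsub>U\<^esub>"
      using ker[of "y \<ominus>\<^bsub>P\<^esub> y'"] that by (simp add: rhom_minus[OF P U w])
    then show ?thesis using that rhom_closed[OF w] by simp
  qed
  define s where "s t = (SOME y. y \<in> carrier P \<and> p y = t)" for t
  have s: "s t \<in> carrier P" "p (s t) = t" if "t \<in> carrier T" for t
  proof -
    have "t \<in> p ` carrier P" using p(2) \<open>t \<in> carrier T\<close> by simp
    then have "\<exists>y. y \<in> carrier P \<and> p y = t" by auto
    then have "s t \<in> carrier P \<and> p (s t) = t" unfolding s_def by (rule someI_ex)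
    then show "s t \<in> carrier P" "p (s t) = t" by auto
  qed
  have vp: "w (s (p y)) = w y" if "y \<in> carrier P" for y
    by (rule eq) (use s[OF rhom_closed[OF p(1) that]] that in simp_all)
  have "restrict (\<lambda>t. w (s t)) (carrier T) \<in> rhom A T U"
  proof (rule restrict_rhomI[OF T])
    fix t assume t: "t \<in> carrier T"
    show "w (s t) \<in> carrier U" using s t rhom_closed[OF w] by simp
    show "w (s (t \<oplus>\<^bsub>T\<^esub> t')) = w (s t) \<oplus>\<^bsub>U\<^esub> w (s t')" if t': "t' \<in> carrier T" for t'
      using vp[of "s t \<oplus>\<^bsub>P\<^esub> s t'"] s t t' rhom_add[OF p(1)] rhom_add[OF w] by simp
    show "w (s (t \<bullet>\<^bsub>T\<^esub> a)) = w (s t) \<bullet>\<^bsub>U\<^esub> a" if a: "a \<in> carrier A" for a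
      using vp[of "s t \<bullet>\<^bsub>P\<^esub> a"] s t a rhom_ract[OF p(1)] rhom_ract[OF w] by (simp add: P.ract_closed)
  qed
  then show thesis using vp rhom_closed[OF p(1)] by (intro that[of "restrict (\<lambda>t. w (s t)) (carrier T)"]) auto
qed

lemma opp_simps [simp]:
  "carrier (opp A) = carrier A" "\<one>\<^bsub>opp A\<^esub> = \<one>\<^bsub>A\<^esub>" "\<zero>\<^bsub>opp A\<^esub> = \<zero>\<^bsub>A\<^esub>"
  "x \<oplus>\<^bsub>opp A\<^esub> y = x \<oplus>\<^bsub>A\<^esub> y" "x \<otimes>\<^bsub>opp A\<^esub> y = y \<otimes>\<^bsub>A\<^esub> x" "c \<odot>\<^bsub>opp A\<^esub> x = c \<odot>\<^bsub>A\<^esub> x"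
  by (simp_all add: opp_def)

lemma opp_ring:
  assumes "ring A" shows "ring (opp A)"
proof -
  interpret ring A by fact
  show ?thesis
  proof (rule ringI)
    show "abelian_group (opp A)" by (rule abelian_group_cong[OF abelian_group_axioms]) simp_all
    show "monoid (opp A)" by (rule monoidI) (auto simp: m_assoc)
  qed (auto simp: l_distr r_distr)
qed

lemma A_dual_simps [simp]:
  "carrier (A_dual A P) = rhom A P (regular A)"
  "\<zero>\<^bsub>A_dual A P\<^esub> = (\<lambda>x\<in>carrier P. \<zero>\<^bsub>A\<^esub>)"
  "f \<oplus>\<^bsub>A_dual A P\<^esub> g = (\<lambda>x\<in>carrier P. f x \<oplus>\<^bsub>A\<^esub> g x)"
  "f \<bullet>\<^bsub>A_dual A P\<^esub> a = (\<lambda>x\<in>carrier P. a \<otimes>\<^bsub>A\<^esub> f x)"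
  by (simp_all add: A_dual_def)

lemma A_dual_right_module:
  assumes "ring A" and P: "right_module A P"
  shows "right_module (opp A) (A_dual A P)"
proof (rule right_moduleI)
  interpret A: ring A by fact
  have R: "right_module A (regular A)" by (rule regular_right_module[OF assms(1)])
  show "ring (opp A)" by (rule opp_ring[OF assms(1)])
  show "abelian_group (A_dual A P)" by (rule rhom_pointwise_group(1)[OF P R]) simp_all
  note c = rhom_closed[of _ A P "regular A", unfolded regular_simps]
  fix f assume f: "f \<in> carrier (A_dual A P)"
  have fm: "(\<lambda>x\<in>carrier P. a \<otimes>\<^bsub>A\<^esub> f x) \<in> rhom A P (regular A)" if "a \<in> carrier A" for a
    using f that c rhom_add[of f A P "regular A"] rhom_ract[of f A P "regular A"]
    by (intro restrict_rhomI[OF P]) (auto simp: A.r_distr A.m_assoc)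
  show "f \<bullet>\<^bsub>A_dual A P\<^esub> \<one>\<^bsub>opp A\<^esub> = f"
    using f fm c by (intro rhom_eqI[of _ A P "regular A" f "regular A"]) auto
  fix a assume a: "a \<in> carrier (opp A)"
  show "f \<bullet>\<^bsub>A_dual A P\<^esub> a \<in> carrier (A_dual A P)" using fm a by simp
  show "(f \<oplus>\<^bsub>A_dual A P\<^esub> g) \<bullet>\<^bsub>A_dual A P\<^esub> a = f \<bullet>\<^bsub>A_dual A P\<^esub> a \<oplus>\<^bsub>A_dual A P\<^esub> g \<bullet>\<^bsub>A_dual A P\<^esub> a"
    if "g \<in> carrier (A_dual A P)" for g
    using f a that c by (auto simp: A.r_distr intro!: restrict_ext)
  fix b assume b: "b \<in> carrier (opp A)"
  show "f \<bullet>\<^bsub>A_dual A P\<^esub> (a \<oplus>\<^bsub>opp A\<^esub> b) = f \<bullet>\<^bsub>A_dual A P\<^esub> a \<oplus>\<^bsub>A_dual A P\<^esub> f \<bullet>\<^bsub>A_dual A P\<^esub> b"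
    using f a b c by (auto simp: A.l_distr intro!: restrict_ext)
  show "f \<bullet>\<^bsub>A_dual A P\<^esub> (a \<otimes>\<^bsub>opp A\<^esub> b) = (f \<bullet>\<^bsub>A_dual A P\<^esub> a) \<bullet>\<^bsub>A_dual A P\<^esub> b"
    using f a b c by (auto simp: A.m_assoc intro!: restrict_ext)
qed

lemma ract_form_rhom:
  assumes M: "right_module A M" and P: "right_module A P" and x: "x \<in> carrier M"
    and \<psi>: "\<psi> \<in> rhom A P (regular A)"
  shows "(\<lambda>y\<in>carrier P. x \<bullet>\<^bsub>M\<^esub> \<psi> y) \<in> rhom A P M"
proof -
  interpret M: right_module A M by fact
  show ?thesis
    using x rhom_closed[OF \<psi>] rhom_add[OF \<psi>] rhom_ract[OF \<psi>]
    by (intro restrict_rhomI[OF P]) (auto simp: M.ract_closed M.ract_add_right M.ract_mult)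
qed

lemma dual_basis_expansion:
  assumes P: "right_module A P" and N: "right_module A N" and h: "h \<in> rhom A P N"
    and p: "\<And>k. k < n \<Longrightarrow> p k \<in> carrier P" and \<psi>: "\<And>k. k < n \<Longrightarrow> \<psi> k \<in> rhom A P (regular A)"
    and basis: "\<And>y. y \<in> carrier P \<Longrightarrow> y = (\<Oplus>\<^bsub>P\<^esub>k\<in>{..<n::nat}. p k \<bullet>\<^bsub>P\<^esub> \<psi> k y)"
    and y: "y \<in> carrier P"
  shows "h y = (\<Oplus>\<^bsub>N\<^esub>k\<in>{..<n}. h (p k) \<bullet>\<^bsub>N\<^esub> \<psi> k y)"
proof -
  interpret P: right_module A P by fact
  interpret N: right_module A N by fact
  have c: "\<psi> k y \<in> carrier A" if "k < n" for k using rhom_closed[OF \<psi>[OF that] y] by simp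
  have "h y = h (\<Oplus>\<^bsub>P\<^esub>k\<in>{..<n}. p k \<bullet>\<^bsub>P\<^esub> \<psi> k y)" using basis[OF y] by simp
  also have "\<dots> = (\<Oplus>\<^bsub>N\<^esub>k\<in>{..<n}. h (p k \<bullet>\<^bsub>P\<^esub> \<psi> k y))"
    using p c by (intro rhom_finsum[OF P N h]) (auto intro!: P.ract_closed)
  also have "\<dots> = (\<Oplus>\<^bsub>N\<^esub>k\<in>{..<n}. h (p k) \<bullet>\<^bsub>N\<^esub> \<psi> k y)"
    using p c rhom_closed[OF h] rhom_ract[OF h]
    by (intro N.M.finsum_cong') (auto intro!: N.ract_closed)
  finally show ?thesis .
qed

lemma
  assumes P0: "right_module A P0" and N: "right_module A N" and p: "p \<in> rhom A P1 P0"
    and I: "I = (\<lambda>u. compose (carrier P1) u p) ` rhom A P0 N"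
  shows precompose_image_zero: "(\<lambda>y\<in>carrier P1. \<zero>\<^bsub>N\<^esub>) \<in> I"
    and precompose_image_add: "f \<in> I \<Longrightarrow> g \<in> I \<Longrightarrow> (\<lambda>y\<in>carrier P1. f y \<oplus>\<^bsub>N\<^esub> g y) \<in> I"
proof -
  note c = rhom_closed[OF p]
  show "(\<lambda>y\<in>carrier P1. \<zero>\<^bsub>N\<^esub>) \<in> I" unfolding I
    using zero_rhom[OF P0 N] by (rule image_eqI[rotated]) (simp add: compose_def c cong: restrict_cong)
  assume "f \<in> I" "g \<in> I"
  then obtain u v where u: "u \<in> rhom A P0 N" "f = compose (carrier P1) u p"
    and v: "v \<in> rhom A P0 N" "g = compose (carrier P1) v p" unfolding I by auto
  show "(\<lambda>y\<in>carrier P1. f y \<oplus>\<^bsub>N\<^esub> g y) \<in> I" unfolding I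
    using add_rhom[OF P0 N u(1) v(1)]
    by (rule image_eqI[rotated]) (simp add: u(2) v(2) compose_def c cong: restrict_cong)
qed

text \<open>
  The maps \<open>P1 \<rightarrow> M\<close> that factor through \<open>p1\<close> form a subspace \<open>W\<close> of \<open>Hom(P1, M)\<close>.  If \<open>h\<close>
  were not in it, there would be a functional \<open>l\<close> with \<open>l h = 1\<close> that vanishes on \<open>W\<close>.  Sending \<open>x\<close>
  to \<open>\<psi> \<mapsto> l (y \<mapsto> x \<psi>(y))\<close> defines a map from \<open>M\<close> to the dual of the cokernel of
  \<open>Hom(P0, A) \<rightarrow> Hom(P1, A)\<close>, which is zero by assumption.  By the dual basis lemma \<open>h\<close> is a sum of
  maps \<open>y \<mapsto> x \<psi>(y)\<close>, so \<open>l h = 0\<close>, a contradiction.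
\<close>

lemma (in central_scalars) zero_hom_to_translate_factor:
  assumes M: "right_module A M" and P1: "in_add A (regular A) P1" and P0: "right_module A P0"
    and p1: "p1 \<in> rhom A P1 P0"
    and rigid: "rhom A M (dual K (opp A) (AR_transpose A P1 P0 p1))
      = {\<lambda>x\<in>carrier M. \<zero>\<^bsub>dual K (opp A) (AR_transpose A P1 P0 p1)\<^esub>}"
    and h: "h \<in> rhom A P1 M"
  shows "\<exists>u\<in>rhom A P0 M. \<forall>y\<in>carrier P1. h y = u (p1 y)"
proof (rule ccontr)
  assume no: "\<not> (\<exists>u\<in>rhom A P0 M. \<forall>y\<in>carrier P1. h y = u (p1 y))"
  have P1': "right_module A P1" using P1 by (simp add: in_add_def fg_rmodule_def)
  interpret M: right_module A M by fact
  have R: "right_module A (regular A)" by (rule regular_right_module[OF A.ring_axioms])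
  interpret E: central_scalars K "end_alg A P1" by (rule end_alg_central_scalars[OF P1'])
  define V where "V = vect (end_alg A P1) (hom_rmod A P1 M)"
  have V: "right_module K V"
    unfolding V_def by (rule E.vect_right_module[OF hom_rmod_right_module[OF P1' M]])
  interpret V: right_module K V by fact
  have V_simps [simp]: "carrier V = rhom A P1 M" "\<zero>\<^bsub>V\<^esub> = (\<lambda>y\<in>carrier P1. \<zero>\<^bsub>M\<^esub>)"
    "f \<oplus>\<^bsub>V\<^esub> g = (\<lambda>y\<in>carrier P1. f y \<oplus>\<^bsub>M\<^esub> g y)" for f g by (simp_all add: V_def)
  have V_ract: "f \<bullet>\<^bsub>V\<^esub> c = (\<lambda>y\<in>carrier P1. f y \<bullet>\<^bsub>M\<^esub> scalar A c)"
    if f: "f \<in> rhom A P1 M" and c: "c \<in> carrier K" for f c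
    using rhom_ract[OF f _ scalar_closed[OF c]]
    by (auto simp: V_def scalar_end_alg compose_def intro!: restrict_ext)
  define W where "W = (\<lambda>u. compose (carrier P1) u p1) ` rhom A P0 M"
  have W: "rsubmodule K W V"
  proof (rule V.rsubmoduleI)
    show "W \<subseteq> carrier V" using compose_rhom[OF P1' p1] by (auto simp: W_def)
    show "\<zero>\<^bsub>V\<^esub> \<in> W" using precompose_image_zero[OF P0 M p1 W_def] by simp
    fix f assume f: "f \<in> W"
    show "f \<oplus>\<^bsub>V\<^esub> g \<in> W" if "g \<in> W" for g
      using precompose_image_add[OF P0 M p1 W_def f that] by simp
    obtain u where u: "u \<in> rhom A P0 M" "f = compose (carrier P1) u p1" using f by (auto simp: W_def)
    show "f \<bullet>\<^bsub>V\<^esub> c \<in> W" if c: "c \<in> carrier K" for c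
    proof -
      have "(\<lambda>x\<in>carrier P0. u x \<bullet>\<^bsub>M\<^esub> scalar A c) \<in> rhom A P0 M"
        using rhom_closed[OF u(1)] rhom_add[OF u(1)] rhom_ract[OF u(1)] scalar_closed[OF c]
          scalar_central[OF c]
        by (intro restrict_rhomI[OF P0]) (auto simp: M.ract_closed M.ract_add_left M.ract_mult[symmetric])
      moreover have "f \<bullet>\<^bsub>V\<^esub> c = (\<lambda>y\<in>carrier P1. f y \<bullet>\<^bsub>M\<^esub> scalar A c)"
        using V_ract[OF compose_rhom[OF P1' p1 u(1)] c] u(2) by simp
      ultimately show ?thesis unfolding W_def
        using rhom_closed[OF p1] u(2)
        by (intro image_eqI[of _ _ "\<lambda>x\<in>carrier P0. u x \<bullet>\<^bsub>M\<^esub> scalar A c"])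
          (auto simp: compose_def intro!: restrict_ext)
    qed
  qed
  have "h \<notin> W" using no by (auto simp: W_def compose_eq)
  then obtain l where l: "l \<in> rhom K V (regular K)" "l h = \<one>\<^bsub>K\<^esub>" "\<And>w. w \<in> W \<Longrightarrow> l w = \<zero>\<^bsub>K\<^esub>"
    using separating_functional[OF K.field_axioms V W] h by auto
  have lc: "l f \<in> carrier K" if "f \<in> rhom A P1 M" for f using rhom_closed[OF l(1)] that by simp
  have ladd: "l (\<lambda>y\<in>carrier P1. f y \<oplus>\<^bsub>M\<^esub> g y) = l f \<oplus>\<^bsub>K\<^esub> l g"
    if "f \<in> rhom A P1 M" "g \<in> rhom A P1 M" for f g using rhom_add[OF l(1)] that by simp
  have lract: "l (\<lambda>y\<in>carrier P1. f y \<bullet>\<^bsub>M\<^esub> scalar A c) = c \<otimes>\<^bsub>K\<^esub> l f"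
    if "f \<in> rhom A P1 M" "c \<in> carrier K" for f c
    using rhom_ract[OF l(1), of f c] that lc K.m_comm by (simp add: V_ract)
  \<comment> \<open>the cokernel \<open>Q = D/J\<close> of \<open>Hom(P0, A) \<rightarrow> Hom(P1, A)\<close>, whose dual is the target\<close>
  define D where "D = A_dual A P1"
  have D: "right_module (opp A) D" unfolding D_def by (rule A_dual_right_module[OF A.ring_axioms P1'])
  interpret D: right_module "opp A" D by fact
  have D_simps [simp]: "carrier D = rhom A P1 (regular A)" by (simp add: D_def)
  define J where "J = (\<lambda>f. compose (carrier P1) f p1) ` rhom A P0 (regular A)"
  have J: "rsubmodule (opp A) J D"
  proof (rule D.rsubmoduleI)
    show "J \<subseteq> carrier D" using compose_rhom[OF P1' p1] by (auto simp: J_def)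
    show "\<zero>\<^bsub>D\<^esub> \<in> J" using precompose_image_zero[OF P0 R p1 J_def] by (simp add: D_def)
    fix f assume f: "f \<in> J"
    show "f \<oplus>\<^bsub>D\<^esub> g \<in> J" if "g \<in> J" for g
      using precompose_image_add[OF P0 R p1 J_def f that] by (simp add: D_def)
    obtain u where u: "u \<in> rhom A P0 (regular A)" "f = compose (carrier P1) u p1" using f by (auto simp: J_def)
    show "f \<bullet>\<^bsub>D\<^esub> a \<in> J" if a: "a \<in> carrier (opp A)" for a
    proof -
      interpret D0: right_module "opp A" "A_dual A P0" by (rule A_dual_right_module[OF A.ring_axioms P0])
      have "(\<lambda>x\<in>carrier P0. a \<otimes>\<^bsub>A\<^esub> u x) \<in> rhom A P0 (regular A)"
        using D0.ract_closed[of u a] u(1) a by simp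
      then show ?thesis unfolding J_def D_def
        using rhom_closed[OF p1] u(2)
        by (intro image_eqI[of _ _ "\<lambda>x\<in>carrier P0. a \<otimes>\<^bsub>A\<^esub> u x"])
          (auto simp: compose_def intro!: restrict_ext)
    qed
  qed
  define Q where "Q = AR_transpose A P1 P0 p1"
  have Q_eq: "Q = quot_rmod D J" by (simp add: Q_def AR_transpose_def D_def J_def)
  note Qf = D.quot_rmod_facts[OF J, folded Q_eq]
  have Q_add: "(J +>\<^bsub>D\<^esub> \<psi>) \<oplus>\<^bsub>Q\<^esub> (J +>\<^bsub>D\<^esub> \<chi>) = J +>\<^bsub>D\<^esub> (\<psi> \<oplus>\<^bsub>D\<^esub> \<chi>)"
    if "\<psi> \<in> carrier D" "\<chi> \<in> carrier D" for \<psi> \<chi>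
    using rhom_add[OF Qf(3) that] that D.M.a_closed[OF that] by (simp del: D_simps)
  have Q_ract: "(J +>\<^bsub>D\<^esub> \<psi>) \<bullet>\<^bsub>Q\<^esub> a = J +>\<^bsub>D\<^esub> (\<psi> \<bullet>\<^bsub>D\<^esub> a)"
    if "\<psi> \<in> carrier D" "a \<in> carrier A" for \<psi> a
    using rhom_ract[OF Qf(3) that(1)] that D.ract_closed[OF that(1)] by (simp del: D_simps)
  define \<Theta> where "\<Theta> x \<psi> = (\<lambda>y\<in>carrier P1. x \<bullet>\<^bsub>M\<^esub> \<psi> y)" for x \<psi>
  have \<Theta>: "\<Theta> x \<psi> \<in> rhom A P1 M" if "x \<in> carrier M" "\<psi> \<in> carrier D" for x \<psi>
    unfolding \<Theta>_def using ract_form_rhom[OF M P1'] that by simp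
  have \<psi>c: "\<psi> y \<in> carrier A" if "\<psi> \<in> carrier D" "y \<in> carrier P1" for \<psi> y
    using rhom_closed[of \<psi> A P1 "regular A" y] that by simp
  have \<Theta>_add: "\<Theta> x (\<psi> \<oplus>\<^bsub>D\<^esub> \<chi>) = (\<lambda>y\<in>carrier P1. \<Theta> x \<psi> y \<oplus>\<^bsub>M\<^esub> \<Theta> x \<chi> y)"
    if "x \<in> carrier M" "\<psi> \<in> carrier D" "\<chi> \<in> carrier D" for x \<psi> \<chi>
    using that \<psi>c by (auto simp: \<Theta>_def D_def M.ract_add_right intro!: restrict_ext)
  have \<Theta>_J: "\<Theta> x \<psi> \<in> W" if x: "x \<in> carrier M" and \<psi>: "\<psi> \<in> J" for x \<psi>
  proof -
    from \<psi> obtain u where u: "u \<in> rhom A P0 (regular A)" "\<psi> = compose (carrier P1) u p1" by (auto simp: J_def)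
    show ?thesis unfolding W_def
      using ract_form_rhom[OF M P0 x u(1)] rhom_closed[OF p1] u(2)
      by (intro image_eqI[of _ _ "\<lambda>z\<in>carrier P0. x \<bullet>\<^bsub>M\<^esub> u z"])
        (auto simp: \<Theta>_def compose_def intro!: restrict_ext)
  qed
  define \<Phi> where "\<Phi> x = (\<lambda>C\<in>carrier Q. l (\<Theta> x (SOME \<psi>. \<psi> \<in> C)))" for x
  have QI: "J +>\<^bsub>D\<^esub> \<psi> \<in> carrier Q" if "\<psi> \<in> carrier D" for \<psi> using Qf(2) that by blast
  have \<Phi>_eq: "\<Phi> x (J +>\<^bsub>D\<^esub> \<psi>) = l (\<Theta> x \<psi>)" if x: "x \<in> carrier M" and \<psi>: "\<psi> \<in> carrier D" for x \<psi>
  proof -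
    have "(SOME \<psi>'. \<psi>' \<in> J +>\<^bsub>D\<^esub> \<psi>) \<in> J +>\<^bsub>D\<^esub> \<psi>" using someI[of "\<lambda>c. c \<in> J +>\<^bsub>D\<^esub> \<psi>", OF Qf(5)[OF \<psi>]] .
    then obtain w where w: "w \<in> J" "(SOME \<psi>'. \<psi>' \<in> J +>\<^bsub>D\<^esub> \<psi>) = w \<oplus>\<^bsub>D\<^esub> \<psi>"
      by (auto simp: a_r_coset_def')
    have wD: "w \<in> carrier D" using w(1) rsubmodule_subset[OF J] by blast
    have "l (\<Theta> x (w \<oplus>\<^bsub>D\<^esub> \<psi>)) = l (\<Theta> x w) \<oplus>\<^bsub>K\<^esub> l (\<Theta> x \<psi>)"
      unfolding \<Theta>_add[OF x wD \<psi>] by (rule ladd[OF \<Theta>[OF x wD] \<Theta>[OF x \<psi>]])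
    also have "\<dots> = l (\<Theta> x \<psi>)" using l(3)[OF \<Theta>_J[OF x w(1)]] lc[OF \<Theta>[OF x \<psi>]] by simp
    finally show ?thesis using QI[OF \<psi>] w(2) by (simp add: \<Phi>_def)
  qed
  have Q_cases: "\<exists>\<psi>\<in>carrier D. C = J +>\<^bsub>D\<^esub> \<psi>" if "C \<in> carrier Q" for C using that Qf(2) by auto
  let ?tau = "dual K (opp A) Q"
  have \<Phi>_closed: "\<Phi> x \<in> carrier ?tau" if x: "x \<in> carrier M" for x
  proof -
    have "\<Phi> x C \<in> carrier K" if C: "C \<in> carrier Q" for C
      using Q_cases[OF C] lc[OF \<Theta>[OF x]] \<Phi>_eq[OF x] by auto
    moreover have "\<Phi> x (C \<oplus>\<^bsub>Q\<^esub> C') = \<Phi> x C \<oplus>\<^bsub>K\<^esub> \<Phi> x C'" if C: "C \<in> carrier Q" "C' \<in> carrier Q" for C C'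
    proof -
      obtain \<psi> \<psi>' where \<psi>: "\<psi> \<in> carrier D" "C = J +>\<^bsub>D\<^esub> \<psi>" "\<psi>' \<in> carrier D" "C' = J +>\<^bsub>D\<^esub> \<psi>'"
        using Q_cases C by meson
      show ?thesis unfolding \<psi>(2,4) Q_add[OF \<psi>(1,3)] \<Phi>_eq[OF x \<psi>(1)] \<Phi>_eq[OF x \<psi>(3)]
          \<Phi>_eq[OF x D.M.a_closed[OF \<psi>(1,3)]] \<Theta>_add[OF x \<psi>(1,3)]
        by (rule ladd[OF \<Theta>[OF x \<psi>(1)] \<Theta>[OF x \<psi>(3)]])
    qed
    moreover have "\<Phi> x (C \<bullet>\<^bsub>Q\<^esub> (c \<odot>\<^bsub>opp A\<^esub> \<one>\<^bsub>opp A\<^esub>)) = c \<otimes>\<^bsub>K\<^esub> \<Phi> x C"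
      if C: "C \<in> carrier Q" and c: "c \<in> carrier K" for C c
    proof -
      obtain \<psi> where \<psi>: "\<psi> \<in> carrier D" "C = J +>\<^bsub>D\<^esub> \<psi>" using Q_cases[OF C] by blast
      have s: "c \<odot>\<^bsub>opp A\<^esub> \<one>\<^bsub>opp A\<^esub> = scalar A c" by (simp add: scalar_def)
      have "\<psi> \<bullet>\<^bsub>D\<^esub> scalar A c \<in> carrier D"
        using D.ract_closed[OF \<psi>(1)] scalar_closed[OF c] by simp
      moreover have "\<Theta> x (\<psi> \<bullet>\<^bsub>D\<^esub> scalar A c) = (\<lambda>y\<in>carrier P1. \<Theta> x \<psi> y \<bullet>\<^bsub>M\<^esub> scalar A c)"
        using x \<psi>c[OF \<psi>(1)] scalar_closed[OF c] scalar_central[OF c]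
        by (auto simp: \<Theta>_def D_def M.ract_mult[symmetric] intro!: restrict_ext)
      ultimately show ?thesis
        unfolding s \<psi>(2) Q_ract[OF \<psi>(1) scalar_closed[OF c]] \<Phi>_eq[OF x \<psi>(1)]
        using \<Phi>_eq[OF x] lract[OF \<Theta>[OF x \<psi>(1)] c] by simp
    qed
    ultimately show ?thesis by (auto simp: dual_def \<Phi>_def)
  qed
  have "restrict \<Phi> (carrier M) \<in> rhom A M ?tau"
  proof (rule restrict_rhomI[OF M])
    fix x assume x: "x \<in> carrier M"
    show "\<Phi> x \<in> carrier ?tau" by (rule \<Phi>_closed[OF x])
    show "\<Phi> (x \<oplus>\<^bsub>M\<^esub> x') = \<Phi> x \<oplus>\<^bsub>?tau\<^esub> \<Phi> x'" if x': "x' \<in> carrier M" for x'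
    proof -
      have "\<Phi> (x \<oplus>\<^bsub>M\<^esub> x') C = \<Phi> x C \<oplus>\<^bsub>K\<^esub> \<Phi> x' C" if C: "C \<in> carrier Q" for C
      proof -
        obtain \<psi> where \<psi>: "\<psi> \<in> carrier D" "C = J +>\<^bsub>D\<^esub> \<psi>" using Q_cases[OF C] by blast
        have "\<Theta> (x \<oplus>\<^bsub>M\<^esub> x') \<psi> = (\<lambda>y\<in>carrier P1. \<Theta> x \<psi> y \<oplus>\<^bsub>M\<^esub> \<Theta> x' \<psi> y)"
          using x x' \<psi>c[OF \<psi>(1)] by (auto simp: \<Theta>_def M.ract_add_left intro!: restrict_ext)
        then show ?thesis
          using ladd[OF \<Theta>[OF x \<psi>(1)] \<Theta>[OF x' \<psi>(1)]] x x' \<psi> \<Phi>_eq by simp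
      qed
      then show ?thesis by (auto simp: dual_def \<Phi>_def intro!: restrict_ext)
    qed
    show "\<Phi> (x \<bullet>\<^bsub>M\<^esub> a) = \<Phi> x \<bullet>\<^bsub>?tau\<^esub> a" if a: "a \<in> carrier A" for a
    proof -
      have "\<Phi> (x \<bullet>\<^bsub>M\<^esub> a) C = \<Phi> x (C \<bullet>\<^bsub>Q\<^esub> a)" if C: "C \<in> carrier Q" for C
      proof -
        obtain \<psi> where \<psi>: "\<psi> \<in> carrier D" "C = J +>\<^bsub>D\<^esub> \<psi>" using Q_cases[OF C] by blast
        have "\<psi> \<bullet>\<^bsub>D\<^esub> a \<in> carrier D" using D.ract_closed[OF \<psi>(1)] a by simp
        moreover have "\<Theta> (x \<bullet>\<^bsub>M\<^esub> a) \<psi> = \<Theta> x (\<psi> \<bullet>\<^bsub>D\<^esub> a)"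
          using x a \<psi>c[OF \<psi>(1)] by (auto simp: \<Theta>_def D_def M.ract_mult intro!: restrict_ext)
        ultimately show ?thesis
          unfolding \<psi>(2) Q_ract[OF \<psi>(1) a]
          using x M.ract_closed[OF x a] \<Phi>_eq \<psi>(1) by simp
      qed
      then show ?thesis by (auto simp: dual_def \<Phi>_def intro!: restrict_ext)
    qed
  qed
  then have "restrict \<Phi> (carrier M) = (\<lambda>x\<in>carrier M. \<zero>\<^bsub>?tau\<^esub>)"
    unfolding Q_def rigid by (rule singletonD)
  from fun_cong[OF this] have zero: "\<Phi> x = \<zero>\<^bsub>?tau\<^esub>" if "x \<in> carrier M" for x
    using that by (metis restrict_apply')
  have l_zero: "l (\<Theta> x \<psi>) = \<zero>\<^bsub>K\<^esub>" if "x \<in> carrier M" "\<psi> \<in> carrier D" for x \<psi>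
    using \<Phi>_eq[OF that] zero[OF that(1)] QI[OF that(2)] by (simp add: dual_def)
  obtain n p \<psi> where basis: "\<And>k. k < n \<Longrightarrow> p k \<in> carrier P1"
    "\<And>k. k < n \<Longrightarrow> \<psi> k \<in> rhom A P1 (regular A)"
    "\<And>y. y \<in> carrier P1 \<Longrightarrow> y = (\<Oplus>\<^bsub>P1\<^esub>k\<in>{..<n::nat}. p k \<bullet>\<^bsub>P1\<^esub> \<psi> k y)"
    using dual_basis[OF A.ring_axioms P1] by blast
  have "(\<lambda>y\<in>carrier P1. \<Oplus>\<^bsub>M\<^esub>k\<in>{..<n}. \<Theta> (h (p k)) (\<psi> k) y) \<in> {f \<in> rhom A P1 M. l f = \<zero>\<^bsub>K\<^esub>}"
  proof (rule pointwise_finsum_closed[OF M])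
    show "\<Theta> (h (p k)) (\<psi> k) \<in> {f \<in> rhom A P1 M. l f = \<zero>\<^bsub>K\<^esub>}" if "k \<in> {..<n}" for k
      using that basis(1,2) rhom_closed[OF h] \<Theta> l_zero by simp
    show "(\<lambda>y\<in>carrier P1. \<zero>\<^bsub>M\<^esub>) \<in> {f \<in> rhom A P1 M. l f = \<zero>\<^bsub>K\<^esub>}"
      using zero_rhom[OF P1' M] rhom_zero[OF V _ l(1)] regular_right_module[OF K.ring_axioms] by simp
  qed (use add_rhom[OF P1' M] ladd in auto)
  moreover have "(\<lambda>y\<in>carrier P1. \<Oplus>\<^bsub>M\<^esub>k\<in>{..<n}. \<Theta> (h (p k)) (\<psi> k) y) = h"
  proof -
    have "(\<Oplus>\<^bsub>M\<^esub>k\<in>{..<n}. \<Theta> (h (p k)) (\<psi> k) y) = h y" if "y \<in> carrier P1" for y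
      unfolding \<Theta>_def using that dual_basis_expansion[OF P1' M h basis that] by simp
    then show ?thesis by (intro extensionalityI[OF restrict_extensional rhom_extensional[OF h]]) simp
  qed
  ultimately show False using l(2) by simp
qed

text \<open>
  With \<open>Z = U/W\<close> and \<open>W\<close> generated by images of maps from \<open>T\<close>: lift \<open>g p0\<close> to \<open>q: P0 \<rightarrow> U\<close>.
  The composite \<open>q p1\<close> has image in \<open>W\<close>.  Maps \<open>P1 \<rightarrow> W\<close> are sums of maps \<open>y \<mapsto> f(t) \<psi>(y)\<close> with
  \<open>f: T \<rightarrow> W\<close>, and these factor through \<open>p1\<close> because \<open>y \<mapsto> t \<psi>(y)\<close> does.  So
  \<open>q p1 = u p1\<close> for some \<open>u: P0 \<rightarrow> W\<close>, and \<open>q - u\<close> vanishes on the kernel of \<open>p0\<close> and induces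
  the lift.
\<close>

lemma lift_through_quotient:
  fixes A :: "('k, 'a) module"
  assumes "ring A" and T: "right_module A T" and U: "right_module A U" and Z: "right_module A Z"
    and P0: "in_add A (regular A) P0" and P1: "in_add A (regular A) P1"
    and p0: "p0 \<in> rhom A P0 T" "p0 ` carrier P0 = carrier T"
    and p1: "p1 \<in> rhom A P1 P0" "p1 ` carrier P1 = rker P0 T p0"
    and factor: "\<And>h. h \<in> rhom A P1 T \<Longrightarrow> \<exists>u\<in>rhom A P0 T. \<forall>y\<in>carrier P1. h y = u (p1 y)"
    and W: "rsubmodule A W U" and H: "H \<subseteq> rhom A T U" "\<And>f. f \<in> H \<Longrightarrow> f ` carrier T \<subseteq> W"
    and gen: "W \<subseteq> gen_submodule A U (\<Union>f\<in>H. f ` carrier T)"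
    and \<pi>: "\<pi> \<in> rhom A U Z" "\<pi> ` carrier U = carrier Z"
      "\<And>x. x \<in> carrier U \<Longrightarrow> \<pi> x = \<zero>\<^bsub>Z\<^esub> \<longleftrightarrow> x \<in> W"
    and g: "g \<in> rhom A T Z"
  shows "\<exists>v\<in>rhom A T U. \<forall>t\<in>carrier T. \<pi> (v t) = g t"
proof -
  interpret T: right_module A T by fact
  interpret U: right_module A U by fact
  interpret Z: right_module A Z by fact
  have P0': "right_module A P0" and P1': "right_module A P1"
    using P0 P1 by (simp_all add: in_add_def fg_rmodule_def)
  interpret P0: right_module A P0 by fact
  interpret P1: right_module A P1 by fact
  note Wc = rsubmodule_zero_closed[OF W] rsubmodule_add_closed[OF W]
    rsubmodule_ract_closed[OF W] subsetD[OF rsubmodule_subset[OF W]]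
  have p1c: "p1 y \<in> carrier P0" if "y \<in> carrier P1" for y using rhom_closed[OF p1(1) that] .
  \<comment> \<open>the maps that factor through \<open>p1\<close> by way of a map from \<open>P0\<close> into \<open>W\<close>\<close>
  define E where "E = {f \<in> rhom A P1 U. \<exists>u\<in>rhom A P0 U. u ` carrier P0 \<subseteq> W \<and> (\<forall>y\<in>carrier P1. f y = u (p1 y))}"
  have E_zero: "(\<lambda>y\<in>carrier P1. \<zero>\<^bsub>U\<^esub>) \<in> E"
    using zero_rhom[OF P1' U] zero_rhom[OF P0' U] Wc(1) p1c
    unfolding E_def by (simp, intro bexI[of _ "\<lambda>x\<in>carrier P0. \<zero>\<^bsub>U\<^esub>"]) auto
  have E_add: "(\<lambda>y\<in>carrier P1. f y \<oplus>\<^bsub>U\<^esub> f' y) \<in> E" if f: "f \<in> E" and f': "f' \<in> E" for f f'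
  proof -
    obtain u where u: "u \<in> rhom A P0 U" "u ` carrier P0 \<subseteq> W" "\<forall>y\<in>carrier P1. f y = u (p1 y)"
      using f unfolding E_def by blast
    obtain u' where u': "u' \<in> rhom A P0 U" "u' ` carrier P0 \<subseteq> W" "\<forall>y\<in>carrier P1. f' y = u' (p1 y)"
      using f' unfolding E_def by blast
    have uW: "u y \<in> W" "u' y \<in> W" if "y \<in> carrier P0" for y using u(2) u'(2) that by auto
    have "(\<lambda>y\<in>carrier P1. f y \<oplus>\<^bsub>U\<^esub> f' y) \<in> rhom A P1 U"
      using add_rhom[OF P1' U] f f' by (simp add: E_def)
    moreover have "\<exists>v\<in>rhom A P0 U. v ` carrier P0 \<subseteq> W \<and>
        (\<forall>y\<in>carrier P1. (\<lambda>y\<in>carrier P1. f y \<oplus>\<^bsub>U\<^esub> f' y) y = v (p1 y))"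
      using add_rhom[OF P0' U u(1) u'(1)] Wc(2)[OF uW] u(3) u'(3) p1c
      by (intro bexI[of _ "\<lambda>z\<in>carrier P0. u z \<oplus>\<^bsub>U\<^esub> u' z"]) auto
    ultimately show ?thesis unfolding E_def by blast
  qed
  define L where "L = {x \<in> carrier U. \<forall>\<psi>\<in>rhom A P1 (regular A). (\<lambda>y\<in>carrier P1. x \<bullet>\<^bsub>U\<^esub> \<psi> y) \<in> E}"
  have \<psi>c: "\<psi> y \<in> carrier A" if "\<psi> \<in> rhom A P1 (regular A)" "y \<in> carrier P1" for \<psi> y
    using rhom_closed[OF that] by simp
  have "rsubmodule A L U"
  proof (rule U.rsubmoduleI)
    show "\<zero>\<^bsub>U\<^esub> \<in> L"
      using E_zero by (simp add: L_def \<psi>c cong: restrict_cong)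
    fix x assume x: "x \<in> L"
    then have xU: "x \<in> carrier U" by (simp add: L_def)
    show "x \<oplus>\<^bsub>U\<^esub> x' \<in> L" if x': "x' \<in> L" for x'
    proof -
      have xU': "x' \<in> carrier U" using x' by (simp add: L_def)
      have "(\<lambda>y\<in>carrier P1. (x \<oplus>\<^bsub>U\<^esub> x') \<bullet>\<^bsub>U\<^esub> \<psi> y) \<in> E" if \<psi>: "\<psi> \<in> rhom A P1 (regular A)" for \<psi>
        using E_add[of "\<lambda>y\<in>carrier P1. x \<bullet>\<^bsub>U\<^esub> \<psi> y" "\<lambda>y\<in>carrier P1. x' \<bullet>\<^bsub>U\<^esub> \<psi> y"] x x' \<psi> xU xU'
        by (simp add: L_def U.ract_add_left \<psi>c cong: restrict_cong)
      then show ?thesis using xU xU' by (simp add: L_def)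
    qed
    show "x \<bullet>\<^bsub>U\<^esub> a \<in> L" if a: "a \<in> carrier A" for a
    proof -
      interpret D1: right_module "opp A" "A_dual A P1"
        by (rule A_dual_right_module[OF assms(1) P1'])
      have "(\<lambda>y\<in>carrier P1. (x \<bullet>\<^bsub>U\<^esub> a) \<bullet>\<^bsub>U\<^esub> \<psi> y) \<in> E" if \<psi>: "\<psi> \<in> rhom A P1 (regular A)" for \<psi>
      proof -
        have "(\<lambda>y\<in>carrier P1. a \<otimes>\<^bsub>A\<^esub> \<psi> y) \<in> rhom A P1 (regular A)"
          using D1.ract_closed[of \<psi> a] \<psi> a by simp
        then have "(\<lambda>y\<in>carrier P1. x \<bullet>\<^bsub>U\<^esub> (\<lambda>y\<in>carrier P1. a \<otimes>\<^bsub>A\<^esub> \<psi> y) y) \<in> E"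
          using x unfolding L_def by blast
        then show ?thesis using xU a by (simp add: U.ract_mult[symmetric] \<psi>c[OF \<psi>] cong: restrict_cong)
      qed
      then show ?thesis using U.ract_closed[OF xU a] by (simp add: L_def)
    qed
  qed (simp add: L_def)
  moreover have "f t \<in> L" if f: "f \<in> H" and t: "t \<in> carrier T" for f t
  proof -
    have f': "f \<in> rhom A T U" using f H(1) by blast
    have "(\<lambda>y\<in>carrier P1. f t \<bullet>\<^bsub>U\<^esub> \<psi> y) \<in> E"
      if \<psi>: "\<psi> \<in> rhom A P1 (regular A)" for \<psi>
    proof -
      obtain u where u: "u \<in> rhom A P0 T" "\<forall>y\<in>carrier P1. (\<lambda>y\<in>carrier P1. t \<bullet>\<^bsub>T\<^esub> \<psi> y) y = u (p1 y)"
        using factor[OF ract_form_rhom[OF T P1' t \<psi>]] by blast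
      have "f t \<bullet>\<^bsub>U\<^esub> \<psi> y = compose (carrier P0) f u (p1 y)" if y: "y \<in> carrier P1" for y
      proof -
        have "f t \<bullet>\<^bsub>U\<^esub> \<psi> y = f (t \<bullet>\<^bsub>T\<^esub> \<psi> y)"
          using rhom_ract[OF f' t] rhom_closed[OF \<psi> y] by simp
        then show ?thesis using u(2) y p1c by (simp add: compose_eq)
      qed
      moreover have "compose (carrier P0) f u ` carrier P0 \<subseteq> W"
        using H(2)[OF f] rhom_closed[OF u(1)] by (auto simp: compose_eq)
      ultimately have "\<exists>v\<in>rhom A P0 U. v ` carrier P0 \<subseteq> W \<and>
          (\<forall>y\<in>carrier P1. (\<lambda>y\<in>carrier P1. f t \<bullet>\<^bsub>U\<^esub> \<psi> y) y = v (p1 y))"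
        using compose_rhom[OF P0' u(1) f'] by (intro bexI[of _ "compose (carrier P0) f u"]) simp_all
      then show ?thesis
        using ract_form_rhom[OF U P1' rhom_closed[OF f' t] \<psi>] unfolding E_def by blast
    qed
    then show ?thesis using rhom_closed[OF f' t] by (simp add: L_def)
  qed
  ultimately have "gen_submodule A U (\<Union>f\<in>H. f ` carrier T) \<subseteq> L"
    by (intro gen_submodule_least) auto
  then have WL: "W \<subseteq> L" using gen by blast
  obtain n0 p \<psi> where b0: "\<And>k. k < n0 \<Longrightarrow> p k \<in> carrier P0"
    "\<And>k. k < n0 \<Longrightarrow> \<psi> k \<in> rhom A P0 (regular A)"
    "\<And>y. y \<in> carrier P0 \<Longrightarrow> y = (\<Oplus>\<^bsub>P0\<^esub>k\<in>{..<n0::nat}. p k \<bullet>\<^bsub>P0\<^esub> \<psi> k y)"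
    using dual_basis[OF assms(1) P0] by blast
  obtain n1 b \<chi> where b1: "\<And>k. k < n1 \<Longrightarrow> b k \<in> carrier P1"
    "\<And>k. k < n1 \<Longrightarrow> \<chi> k \<in> rhom A P1 (regular A)"
    "\<And>y. y \<in> carrier P1 \<Longrightarrow> y = (\<Oplus>\<^bsub>P1\<^esub>k\<in>{..<n1::nat}. b k \<bullet>\<^bsub>P1\<^esub> \<chi> k y)"
    using dual_basis[OF assms(1) P1] by blast
  have gp: "compose (carrier P0) g p0 \<in> rhom A P0 Z" by (rule compose_rhom[OF P0' p0(1) g])
  have "\<exists>z\<in>carrier U. \<pi> z = compose (carrier P0) g p0 (p k)" if "k < n0" for k
  proof -
    have "compose (carrier P0) g p0 (p k) \<in> \<pi> ` carrier U"
      unfolding \<pi>(2) by (rule rhom_closed[OF gp b0(1)[OF that]])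
    then show ?thesis by auto
  qed
  then obtain z where z: "\<And>k. k < n0 \<Longrightarrow> z k \<in> carrier U"
    "\<And>k. k < n0 \<Longrightarrow> \<pi> (z k) = compose (carrier P0) g p0 (p k)" by metis
  define q where "q = (\<lambda>y\<in>carrier P0. \<Oplus>\<^bsub>U\<^esub>k\<in>{..<n0}. (\<lambda>y\<in>carrier P0. z k \<bullet>\<^bsub>U\<^esub> \<psi> k y) y)"
  have q: "q \<in> rhom A P0 U" unfolding q_def
  proof (rule pointwise_finsum_closed[OF U])
    show "(\<lambda>y\<in>carrier P0. z k \<bullet>\<^bsub>U\<^esub> \<psi> k y) \<in> rhom A P0 U" if "k \<in> {..<n0}" for k
      using that by (intro ract_form_rhom[OF U P0'] z(1) b0(2)) auto
  qed (use zero_rhom[OF P0' U] add_rhom[OF P0' U] in auto)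
  have \<pi>q: "\<pi> (q y) = g (p0 y)" if y: "y \<in> carrier P0" for y
  proof -
    have c: "\<psi> k y \<in> carrier A" if "k < n0" for k using rhom_closed[OF b0(2)[OF that] y] by simp
    have "\<pi> (q y) = \<pi> (\<Oplus>\<^bsub>U\<^esub>k\<in>{..<n0}. z k \<bullet>\<^bsub>U\<^esub> \<psi> k y)" using y by (simp add: q_def)
    also have "\<dots> = (\<Oplus>\<^bsub>Z\<^esub>k\<in>{..<n0}. \<pi> (z k \<bullet>\<^bsub>U\<^esub> \<psi> k y))"
      using z(1) c by (intro rhom_finsum[OF U Z \<pi>(1)]) (auto intro!: U.ract_closed)
    also have "\<dots> = (\<Oplus>\<^bsub>Z\<^esub>k\<in>{..<n0}. compose (carrier P0) g p0 (p k) \<bullet>\<^bsub>Z\<^esub> \<psi> k y)"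
      using z c rhom_ract[OF \<pi>(1)] rhom_closed[OF gp b0(1)]
      by (intro Z.M.finsum_cong') (auto intro!: Z.ract_closed)
    also have "\<dots> = compose (carrier P0) g p0 y"
      using dual_basis_expansion[OF P0' Z gp b0 y] by simp
    finally show ?thesis using y by (simp add: compose_eq)
  qed
  have p01: "p0 (p1 y) = \<zero>\<^bsub>T\<^esub>" if "y \<in> carrier P1" for y
    using p1(2) that by (auto simp: rker_def)
  define h where "h = compose (carrier P1) q p1"
  have h: "h \<in> rhom A P1 U" unfolding h_def by (rule compose_rhom[OF P1' p1(1) q])
  have hW: "h y \<in> W" if y: "y \<in> carrier P1" for y
    using \<pi>q[OF p1c[OF y]] p01[OF y] rhom_zero[OF T Z g] \<pi>(3) rhom_closed[OF q p1c[OF y]] y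
    by (simp add: h_def compose_eq)
  have "(\<lambda>y\<in>carrier P1. \<Oplus>\<^bsub>U\<^esub>k\<in>{..<n1}. (\<lambda>y\<in>carrier P1. h (b k) \<bullet>\<^bsub>U\<^esub> \<chi> k y) y) \<in> E"
  proof (rule pointwise_finsum_closed[OF U])
    fix k assume "k \<in> {..<n1}"
    then have k: "k < n1" by simp
    have "h (b k) \<in> L" using WL hW[OF b1(1)[OF k]] by blast
    then show "(\<lambda>y\<in>carrier P1. h (b k) \<bullet>\<^bsub>U\<^esub> \<chi> k y) \<in> E"
      using b1(2)[OF k] unfolding L_def by blast
  next
    show "E \<subseteq> rhom A P1 U" by (auto simp: E_def)
  qed (use E_zero E_add in auto)
  then obtain u where u: "u \<in> rhom A P0 U" "u ` carrier P0 \<subseteq> W"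
    "\<forall>y\<in>carrier P1. (\<lambda>y\<in>carrier P1. \<Oplus>\<^bsub>U\<^esub>k\<in>{..<n1}. (\<lambda>y\<in>carrier P1. h (b k) \<bullet>\<^bsub>U\<^esub> \<chi> k y) y) y = u (p1 y)"
    unfolding E_def by blast
  have hu: "q (p1 y) = u (p1 y)" if y: "y \<in> carrier P1" for y
  proof -
    have "h y = u (p1 y)" using u(3) y dual_basis_expansion[OF P1' U h b1 y] by simp
    then show ?thesis using y by (simp add: h_def compose_eq)
  qed
  define w where "w = (\<lambda>y\<in>carrier P0. q y \<ominus>\<^bsub>U\<^esub> u y)"
  have w: "w \<in> rhom A P0 U" unfolding w_def by (rule minus_rhom[OF P0' U q u(1)])
  have ker: "w y = \<zero>\<^bsub>U\<^esub>" if y: "y \<in> carrier P0" "p0 y = \<zero>\<^bsub>T\<^esub>" for y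
  proof -
    have "y \<in> p1 ` carrier P1" unfolding p1(2) using y by (simp add: rker_def)
    then obtain y' where "y' \<in> carrier P1" "y = p1 y'" by auto
    then show ?thesis using hu[of y'] y rhom_closed[OF u(1) y(1)] by (simp add: w_def)
  qed
  obtain v where v: "v \<in> rhom A T U" "\<And>y. y \<in> carrier P0 \<Longrightarrow> v (p0 y) = w y"
    using rhom_factor[OF P0' T U p0 w ker] by blast
  have "\<pi> (v t) = g t" if t: "t \<in> carrier T" for t
  proof -
    have "t \<in> p0 ` carrier P0" using t p0(2) by simp
    then obtain y where y: "y \<in> carrier P0" "t = p0 y" by auto
    have uy: "u y \<in> W" using u(2) y(1) by auto
    have "\<pi> (w y) = \<pi> (q y) \<ominus>\<^bsub>Z\<^esub> \<pi> (u y)"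
      using rhom_minus[OF U Z \<pi>(1) rhom_closed[OF q y(1)] rhom_closed[OF u(1) y(1)]] y(1)
      by (simp add: w_def)
    also have "\<pi> (u y) = \<zero>\<^bsub>Z\<^esub>" using \<pi>(3)[OF Wc(4)[OF uy]] uy by blast
    also have "\<pi> (q y) \<ominus>\<^bsub>Z\<^esub> \<zero>\<^bsub>Z\<^esub> = \<pi> (q y)"
      using rhom_closed[OF \<pi>(1) rhom_closed[OF q y(1)]] by simp
    finally show ?thesis using \<pi>q[OF y(1)] v(2)[OF y(1)] y(2) by simp
  qed
  then show ?thesis using v(1) by blast
qed

subsection \<open>Modules over a factor algebra\<close>

lemma quot_alg_simps [simp]:
  "carrier (quot_alg A I) = carrier (A Quot I)" "\<zero>\<^bsub>quot_alg A I\<^esub> = \<zero>\<^bsub>A Quot I\<^esub>"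
  "\<one>\<^bsub>quot_alg A I\<^esub> = \<one>\<^bsub>A Quot I\<^esub>" "x \<oplus>\<^bsub>quot_alg A I\<^esub> y = x \<oplus>\<^bsub>A Quot I\<^esub> y"
  "x \<otimes>\<^bsub>quot_alg A I\<^esub> y = x \<otimes>\<^bsub>A Quot I\<^esub> y"
  "c \<odot>\<^bsub>quot_alg A I\<^esub> C = (\<Union>x\<in>C. I +>\<^bsub>A\<^esub> (c \<odot>\<^bsub>A\<^esub> x))"
  by (simp_all add: quot_alg_def)

lemma quot_alg_carrier: "carrier (quot_alg A I) = (\<lambda>a. I +>\<^bsub>A\<^esub> a) ` carrier A"
  by (auto simp: FactRing_def A_RCOSETS_def')

lemma quot_alg_ring:
  assumes "ideal I A" shows "ring (quot_alg A I)"
proof -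
  interpret Q: ring "A Quot I" by (rule ideal.quotient_is_ring[OF assms])
  show ?thesis
  proof (rule ringI)
    show "abelian_group (quot_alg A I)" by (rule abelian_group_cong[OF Q.abelian_group_axioms]) simp_all
    show "monoid (quot_alg A I)" by (rule monoidI) (auto simp: Q.m_assoc)
  qed (auto simp: Q.l_distr Q.r_distr)
qed

lemma quot_alg_central_scalars:
  assumes "fd_algebra K A" and I: "ideal I A"
  shows "central_scalars K (quot_alg A I)"
    and "c \<in> carrier K \<Longrightarrow> scalar (quot_alg A I) c = I +>\<^bsub>A\<^esub> scalar A c"
proof -
  interpret fd_algebra K A by fact
  interpret S: central_scalars K A by (rule fd_algebra_central_scalars[OF assms(1)])
  interpret I: ideal I A by fact
  interpret Q: ring "quot_alg A I" by (rule quot_alg_ring[OF I])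
  have one: "\<one>\<^bsub>quot_alg A I\<^esub> = I +>\<^bsub>A\<^esub> \<one>\<^bsub>A\<^esub>" by (simp add: FactRing_def)
  have add: "I +>\<^bsub>A\<^esub> (x \<oplus>\<^bsub>A\<^esub> y) = (I +>\<^bsub>A\<^esub> x) \<oplus>\<^bsub>quot_alg A I\<^esub> (I +>\<^bsub>A\<^esub> y)"
    if "x \<in> carrier A" "y \<in> carrier A" for x y
    using I.a_rcos_sum[OF that] by (simp add: FactRing_def)
  have mult: "I +>\<^bsub>A\<^esub> (x \<otimes>\<^bsub>A\<^esub> y) = (I +>\<^bsub>A\<^esub> x) \<otimes>\<^bsub>quot_alg A I\<^esub> (I +>\<^bsub>A\<^esub> y)"
    if "x \<in> carrier A" "y \<in> carrier A" for x y
    using I.rcoset_mult_add[OF that] by (simp add: FactRing_def)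
  have closed: "I +>\<^bsub>A\<^esub> x \<in> carrier (quot_alg A I)" if "x \<in> carrier A" for x
    using that unfolding quot_alg_carrier by blast
  have surj: "\<exists>x\<in>carrier A. C = I +>\<^bsub>A\<^esub> x" if "C \<in> carrier (quot_alg A I)" for C
    using that by (auto simp: FactRing_def A_RCOSETS_def')
  show scalar: "scalar (quot_alg A I) c = I +>\<^bsub>A\<^esub> scalar A c" if c: "c \<in> carrier K" for c
  proof -
    have "I +>\<^bsub>A\<^esub> (c \<odot>\<^bsub>A\<^esub> x) = I +>\<^bsub>A\<^esub> (c \<odot>\<^bsub>A\<^esub> \<one>\<^bsub>A\<^esub>)" if "x \<in> I +>\<^bsub>A\<^esub> \<one>\<^bsub>A\<^esub>" for x
    proof -
      obtain w where w: "w \<in> I" "x = w \<oplus>\<^bsub>A\<^esub> \<one>\<^bsub>A\<^esub>" using \<open>x \<in> _\<close> by (auto simp: a_r_coset_def')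
      have wA: "w \<in> carrier A" using w(1) I.a_subset by blast
      have "c \<odot>\<^bsub>A\<^esub> w = (c \<odot>\<^bsub>A\<^esub> \<one>\<^bsub>A\<^esub>) \<otimes>\<^bsub>A\<^esub> w" using smult_mult_left[of c "\<one>\<^bsub>A\<^esub>" w] wA c by simp
      then have "c \<odot>\<^bsub>A\<^esub> w \<in> I" using I.I_l_closed[OF w(1)] c by simp
      then have "c \<odot>\<^bsub>A\<^esub> x \<in> I +>\<^bsub>A\<^esub> (c \<odot>\<^bsub>A\<^esub> \<one>\<^bsub>A\<^esub>)"
        using w wA c by (auto simp: a_r_coset_def' smult_r_distr)
      then show ?thesis using I.a_repr_independence'[of _ "c \<odot>\<^bsub>A\<^esub> \<one>\<^bsub>A\<^esub>"] c by simp
    qed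
    moreover have "\<one>\<^bsub>A\<^esub> \<in> I +>\<^bsub>A\<^esub> \<one>\<^bsub>A\<^esub>" by (rule I.a_rcos_self) simp
    ultimately have "(\<Union>x\<in>I +>\<^bsub>A\<^esub> \<one>\<^bsub>A\<^esub>. I +>\<^bsub>A\<^esub> (c \<odot>\<^bsub>A\<^esub> x)) = I +>\<^bsub>A\<^esub> (c \<odot>\<^bsub>A\<^esub> \<one>\<^bsub>A\<^esub>)" by blast
    then show ?thesis unfolding scalar_def one by simp
  qed
  show "central_scalars K (quot_alg A I)"
  proof (unfold_locales)
    fix c d assume c: "c \<in> carrier K" "d \<in> carrier K"
    then have cd: "c \<oplus>\<^bsub>K\<^esub> d \<in> carrier K" "c \<otimes>\<^bsub>K\<^esub> d \<in> carrier K" by simp_all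
    show "scalar (quot_alg A I) (c \<oplus>\<^bsub>K\<^esub> d) = scalar (quot_alg A I) c \<oplus>\<^bsub>quot_alg A I\<^esub> scalar (quot_alg A I) d"
      using c by (simp only: scalar cd S.scalar_add add S.scalar_closed)
    show "scalar (quot_alg A I) (c \<otimes>\<^bsub>K\<^esub> d) = scalar (quot_alg A I) c \<otimes>\<^bsub>quot_alg A I\<^esub> scalar (quot_alg A I) d"
      using c by (simp only: scalar cd S.scalar_mult mult S.scalar_closed)
  next
    show "scalar (quot_alg A I) \<one>\<^bsub>K\<^esub> = \<one>\<^bsub>quot_alg A I\<^esub>"
      using scalar[of "\<one>\<^bsub>K\<^esub>"] by (simp only: one S.scalar_one) simp
    fix c assume c: "c \<in> carrier K"
    show "scalar (quot_alg A I) c \<in> carrier (quot_alg A I)"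
      unfolding scalar[OF c] by (rule closed[OF S.scalar_closed[OF c]])
    fix C assume "C \<in> carrier (quot_alg A I)"
    then obtain x where x: "x \<in> carrier A" "C = I +>\<^bsub>A\<^esub> x" using surj by blast
    show "scalar (quot_alg A I) c \<otimes>\<^bsub>quot_alg A I\<^esub> C = C \<otimes>\<^bsub>quot_alg A I\<^esub> scalar (quot_alg A I) c"
      unfolding scalar[OF c] x(2) mult[OF x(1) S.scalar_closed[OF c], symmetric]
        mult[OF S.scalar_closed[OF c] x(1), symmetric] S.scalar_central[OF c x(1)] ..
  qed
qed

lemma over_quot_simps [simp]:
  "carrier (over_quot M) = carrier M" "\<zero>\<^bsub>over_quot M\<^esub> = \<zero>\<^bsub>M\<^esub>" "x \<oplus>\<^bsub>over_quot M\<^esub> y = x \<oplus>\<^bsub>M\<^esub> y"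
  by (simp_all add: over_quot_def)

lemma over_quot_ract:
  assumes M: "right_module A M" and I: "ideal I A"
    and ann: "\<And>x a. x \<in> carrier M \<Longrightarrow> a \<in> I \<Longrightarrow> x \<bullet>\<^bsub>M\<^esub> a = \<zero>\<^bsub>M\<^esub>"
    and x: "x \<in> carrier M" and a: "a \<in> carrier A"
  shows "x \<bullet>\<^bsub>over_quot M\<^esub> (I +>\<^bsub>A\<^esub> a) = x \<bullet>\<^bsub>M\<^esub> a"
proof -
  interpret M: right_module A M by fact
  interpret I: ideal I A by fact
  have "(SOME b. b \<in> I +>\<^bsub>A\<^esub> a) \<in> I +>\<^bsub>A\<^esub> a"
    using someI[of "\<lambda>b. b \<in> I +>\<^bsub>A\<^esub> a", OF I.a_rcos_self[OF a]] .
  then obtain w where w: "w \<in> I" "(SOME b. b \<in> I +>\<^bsub>A\<^esub> a) = w \<oplus>\<^bsub>A\<^esub> a" by (auto simp: a_r_coset_def')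
  have "w \<in> carrier A" using w(1) I.a_subset by blast
  then show ?thesis
    using w ann[OF x w(1)] x a by (simp add: over_quot_def M.ract_add_right M.ract_closed)
qed

lemma over_quot_right_module:
  assumes M: "right_module A M" and I: "ideal I A"
    and ann: "\<And>x a. x \<in> carrier M \<Longrightarrow> a \<in> I \<Longrightarrow> x \<bullet>\<^bsub>M\<^esub> a = \<zero>\<^bsub>M\<^esub>"
  shows "right_module (quot_alg A I) (over_quot M)"
proof -
  interpret M: right_module A M by fact
  interpret I: ideal I A by fact
  note r = over_quot_ract[OF M I ann]
  have surj: "\<exists>a\<in>carrier A. C = I +>\<^bsub>A\<^esub> a" if "C \<in> carrier (quot_alg A I)" for C
    using that unfolding quot_alg_carrier by auto
  show ?thesis
  proof (rule right_moduleI)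
    show "ring (quot_alg A I)" by (rule quot_alg_ring[OF I])
    show "abelian_group (over_quot M)" by (rule abelian_group_cong[OF M.M.abelian_group_axioms]) simp_all
  next
    fix x C assume x: "x \<in> carrier (over_quot M)" and C: "C \<in> carrier (quot_alg A I)"
    have x': "x \<in> carrier M" using x by simp
    obtain a where a: "a \<in> carrier A" "C = I +>\<^bsub>A\<^esub> a" using surj[OF C] by blast
    show "x \<bullet>\<^bsub>over_quot M\<^esub> C \<in> carrier (over_quot M)" using x' a r M.ract_closed by simp
    show "(x \<oplus>\<^bsub>over_quot M\<^esub> y) \<bullet>\<^bsub>over_quot M\<^esub> C = x \<bullet>\<^bsub>over_quot M\<^esub> C \<oplus>\<^bsub>over_quot M\<^esub> y \<bullet>\<^bsub>over_quot M\<^esub> C"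
      if "y \<in> carrier (over_quot M)" for y
      using x' that a r M.ract_add_left by simp
    fix D assume D: "D \<in> carrier (quot_alg A I)"
    obtain b where b: "b \<in> carrier A" "D = I +>\<^bsub>A\<^esub> b" using surj[OF D] by blast
    have "C \<oplus>\<^bsub>quot_alg A I\<^esub> D = I +>\<^bsub>A\<^esub> (a \<oplus>\<^bsub>A\<^esub> b)"
      using I.a_rcos_sum[OF a(1) b(1)] a b by (simp add: FactRing_def)
    then show "x \<bullet>\<^bsub>over_quot M\<^esub> (C \<oplus>\<^bsub>quot_alg A I\<^esub> D)
        = x \<bullet>\<^bsub>over_quot M\<^esub> C \<oplus>\<^bsub>over_quot M\<^esub> x \<bullet>\<^bsub>over_quot M\<^esub> D"
      using x' a b r M.ract_add_right by (simp del: quot_alg_simps)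
    have "C \<otimes>\<^bsub>quot_alg A I\<^esub> D = I +>\<^bsub>A\<^esub> (a \<otimes>\<^bsub>A\<^esub> b)"
      using I.rcoset_mult_add[OF a(1) b(1)] a b by (simp add: FactRing_def)
    then show "x \<bullet>\<^bsub>over_quot M\<^esub> (C \<otimes>\<^bsub>quot_alg A I\<^esub> D) = (x \<bullet>\<^bsub>over_quot M\<^esub> C) \<bullet>\<^bsub>over_quot M\<^esub> D"
      using x' a b r M.ract_mult M.ract_closed by (simp del: quot_alg_simps)
  next
    fix x assume "x \<in> carrier (over_quot M)"
    moreover have "\<one>\<^bsub>quot_alg A I\<^esub> = I +>\<^bsub>A\<^esub> \<one>\<^bsub>A\<^esub>" by (simp add: FactRing_def)
    ultimately show "x \<bullet>\<^bsub>over_quot M\<^esub> \<one>\<^bsub>quot_alg A I\<^esub> = x"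
      using r[of x "\<one>\<^bsub>A\<^esub>"] M.ract_one by (simp del: quot_alg_simps)
  qed
qed

lemma over_quot_rsubmodule_iff:
  assumes M: "right_module A M" and I: "ideal I A"
    and ann: "\<And>x a. x \<in> carrier M \<Longrightarrow> a \<in> I \<Longrightarrow> x \<bullet>\<^bsub>M\<^esub> a = \<zero>\<^bsub>M\<^esub>"
  shows "rsubmodule (quot_alg A I) L (over_quot M) \<longleftrightarrow> rsubmodule A L M"
proof
  interpret M: right_module A M by fact
  interpret O: right_module "quot_alg A I" "over_quot M" by (rule over_quot_right_module[OF assms])
  note r = over_quot_ract[OF M I ann]
  {
    assume L: "rsubmodule (quot_alg A I) L (over_quot M)"
    note Lc = rsubmodule_subset[OF L] rsubmodule_zero_closed[OF L] rsubmodule_add_closed[OF L]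
      rsubmodule_ract_closed[OF L]
    show "rsubmodule A L M"
    proof (rule M.rsubmoduleI)
      fix x a assume x: "x \<in> L" and a: "a \<in> carrier A"
      show "x \<bullet>\<^bsub>M\<^esub> a \<in> L"
        using Lc(4)[OF x, of "I +>\<^bsub>A\<^esub> a"] r[of x a] x a Lc(1) unfolding quot_alg_carrier by auto
    qed (use Lc in auto)
  next
    assume L: "rsubmodule A L M"
    note Lc = rsubmodule_subset[OF L] rsubmodule_zero_closed[OF L] rsubmodule_add_closed[OF L]
      rsubmodule_ract_closed[OF L]
    show "rsubmodule (quot_alg A I) L (over_quot M)"
    proof (rule O.rsubmoduleI)
      fix x C assume x: "x \<in> L" and C: "C \<in> carrier (quot_alg A I)"
      obtain a where a: "a \<in> carrier A" "C = I +>\<^bsub>A\<^esub> a" using C unfolding quot_alg_carrier by auto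
      show "x \<bullet>\<^bsub>over_quot M\<^esub> C \<in> L" using Lc(4)[OF x a(1)] r[of x a] x a Lc(1) by auto
    qed (use Lc in auto)
  }
qed

lemma over_quot_rhom:
  assumes M: "right_module A M" and N: "right_module A N" and I: "ideal I A"
    and annM: "\<And>x a. x \<in> carrier M \<Longrightarrow> a \<in> I \<Longrightarrow> x \<bullet>\<^bsub>M\<^esub> a = \<zero>\<^bsub>M\<^esub>"
    and annN: "\<And>x a. x \<in> carrier N \<Longrightarrow> a \<in> I \<Longrightarrow> x \<bullet>\<^bsub>N\<^esub> a = \<zero>\<^bsub>N\<^esub>"
  shows "rhom (quot_alg A I) (over_quot M) (over_quot N) = rhom A M N"
proof (intro equalityI subsetI)
  note r = over_quot_ract[OF M I annM] over_quot_ract[OF N I annN]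
  fix f
  {
    assume f: "f \<in> rhom (quot_alg A I) (over_quot M) (over_quot N)"
    note fc = rhom_closed[OF f] rhom_add[OF f] rhom_extensional[OF f]
    show "f \<in> rhom A M N"
    proof (rule rhomI)
      fix x a assume x: "x \<in> carrier M" and a: "a \<in> carrier A"
      have "f (x \<bullet>\<^bsub>over_quot M\<^esub> (I +>\<^bsub>A\<^esub> a)) = f x \<bullet>\<^bsub>over_quot N\<^esub> (I +>\<^bsub>A\<^esub> a)"
        by (rule rhom_ract[OF f]) (use x a in \<open>auto simp: quot_alg_carrier simp del: quot_alg_simps\<close>)
      then show "f (x \<bullet>\<^bsub>M\<^esub> a) = f x \<bullet>\<^bsub>N\<^esub> a" using r x a fc(1) by simp
    qed (use fc in auto)
  next
    assume f: "f \<in> rhom A M N"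
    note fc = rhom_closed[OF f] rhom_add[OF f] rhom_extensional[OF f]
    show "f \<in> rhom (quot_alg A I) (over_quot M) (over_quot N)"
    proof (rule rhomI)
      fix x C assume x: "x \<in> carrier (over_quot M)" and C: "C \<in> carrier (quot_alg A I)"
      obtain a where a: "a \<in> carrier A" "C = I +>\<^bsub>A\<^esub> a" using C unfolding quot_alg_carrier by auto
      show "f (x \<bullet>\<^bsub>over_quot M\<^esub> C) = f x \<bullet>\<^bsub>over_quot N\<^esub> C"
        using r x a fc(1) rhom_ract[OF f, of x a] by simp
    qed (use fc in auto)
  }
qed

text \<open>
  The presentation that computes \<open>\<tau>T\<close> lives over the factor algebra \<open>A/\<langle>e\<rangle>\<close>.  All modules in
  sight are subquotients of \<open>T\<close>, so that they are annihilated by \<open>e\<close> and their submodules and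
  homomorphisms are the same over both algebras.
\<close>

theorem support_tau_tilting_lift:
  assumes "fd_algebra K A" and tilt: "support_tau_tilting K A T" and N: "rsubmodule A N T"
    and H: "H \<subseteq> rhom A T (T\<lparr>carrier := N\<rparr>)"
    and W_def: "W = gen_submodule A (T\<lparr>carrier := N\<rparr>) (\<Union>f\<in>H. f ` carrier T)"
    and g: "g \<in> rhom A T (quot_rmod (T\<lparr>carrier := N\<rparr>) W)"
  shows "\<exists>v\<in>rhom A T (T\<lparr>carrier := N\<rparr>). \<forall>t\<in>carrier T. W +>\<^bsub>T\<lparr>carrier := N\<rparr>\<^esub> v t = g t"
proof -
  interpret fd_algebra K A by fact
  define U where "U = T\<lparr>carrier := N\<rparr>"
  have T: "right_module A T" using tilt by (simp add: support_tau_tilting_def fg_rmodule_def)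
  have U: "right_module A U" unfolding U_def by (rule right_module_submodule[OF T N])
  interpret U: right_module A U by fact
  have HU: "(\<Union>f\<in>H. f ` carrier T) \<subseteq> carrier U"
    using H rhom_closed[of _ A T U] unfolding U_def by blast
  have W: "rsubmodule A W U" unfolding W_def U_def[symmetric] by (rule gen_submodule_rsubmodule[OF U HU])
  note Q = U.quot_rmod_facts[OF W]
  let ?Z = "quot_rmod U W"
  obtain e where e: "e \<in> carrier A" and annT: "\<And>x a. x \<in> carrier T \<Longrightarrow> a \<in> Idl\<^bsub>A\<^esub> {e} \<Longrightarrow> x \<bullet>\<^bsub>T\<^esub> a = \<zero>\<^bsub>T\<^esub>"
    and tau: "tau_tilting K (quot_alg A (Idl\<^bsub>A\<^esub> {e})) (over_quot T)"
    using tilt by (auto simp: support_tau_tilting_def)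
  define I where "I = Idl\<^bsub>A\<^esub> {e}"
  have I: "ideal I A" unfolding I_def using e by (intro A.genideal_ideal) auto
  have IA: "I \<subseteq> carrier A" using I by (rule ideal.Icarr[THEN subsetI])
  note annT = annT[folded I_def]
  have annU: "x \<bullet>\<^bsub>U\<^esub> a = \<zero>\<^bsub>U\<^esub>" if "x \<in> carrier U" "a \<in> I" for x a
    using that annT rsubmodule_subset[OF N] by (auto simp: U_def)
  have annZ: "C \<bullet>\<^bsub>?Z\<^esub> a = \<zero>\<^bsub>?Z\<^esub>" if C: "C \<in> carrier ?Z" and a: "a \<in> I" for C a
  proof -
    obtain x where x: "x \<in> carrier U" "C = W +>\<^bsub>U\<^esub> x" using C Q(2) by auto
    have "W +>\<^bsub>U\<^esub> (x \<bullet>\<^bsub>U\<^esub> a) = (W +>\<^bsub>U\<^esub> x) \<bullet>\<^bsub>?Z\<^esub> a"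
      using rhom_ract[OF Q(3) x(1), of a] x(1) a IA U.ract_closed by auto
    then show ?thesis
      using annU[OF x(1) a] x(2) rhom_zero[OF U Q(1) Q(3)] by simp
  qed
  let ?R = "quot_alg A I"
  interpret R: central_scalars K ?R by (rule quot_alg_central_scalars(1)[OF assms(1) I])
  obtain P1 P0 :: "('b set, nat \<Rightarrow> 'b set) rmodule" and p1 p0 where
    P: "min_proj_presentation ?R P1 P0 p1 p0 (over_quot T)"
    and rigid: "rhom ?R (over_quot T) (dual K (opp ?R) (AR_transpose ?R P1 P0 p1))
      = {\<lambda>x\<in>carrier (over_quot T). \<zero>\<^bsub>dual K (opp ?R) (AR_transpose ?R P1 P0 p1)\<^esub>}"
    using tau unfolding I_def[symmetric] tau_tilting_def tau_rigid_def is_AR_translate_def by blast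
  have P': "in_add ?R (regular ?R) P1" "in_add ?R (regular ?R) P0" "p0 \<in> rhom ?R P0 (over_quot T)"
    "p0 ` carrier P0 = carrier (over_quot T)" "p1 \<in> rhom ?R P1 P0" "p1 ` carrier P1 = rker P0 (over_quot T) p0"
    using P by (simp_all add: min_proj_presentation_def)
  have P0: "right_module ?R P0" using P'(2) by (simp add: in_add_def fg_rmodule_def)
  have oT: "right_module ?R (over_quot T)" by (rule over_quot_right_module[OF T I annT])
  have oU: "right_module ?R (over_quot U)" by (rule over_quot_right_module[OF U I annU])
  have oZ: "right_module ?R (over_quot ?Z)" by (rule over_quot_right_module[OF Q(1) I annZ])
  have hTU: "rhom ?R (over_quot T) (over_quot U) = rhom A T U"
    by (rule over_quot_rhom[OF T U I annT annU])
  have hTZ: "rhom ?R (over_quot T) (over_quot ?Z) = rhom A T ?Z"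
    by (rule over_quot_rhom[OF T Q(1) I annT annZ])
  have hUZ: "rhom ?R (over_quot U) (over_quot ?Z) = rhom A U ?Z"
    by (rule over_quot_rhom[OF U Q(1) I annU annZ])
  have gen_eq: "gen_submodule ?R (over_quot U) Y = gen_submodule A U Y" for Y
    by (simp add: gen_submodule_def over_quot_rsubmodule_iff[OF U I annU])
  have "\<exists>v\<in>rhom ?R (over_quot T) (over_quot U). \<forall>t\<in>carrier (over_quot T).
      (\<lambda>x\<in>carrier U. W +>\<^bsub>U\<^esub> x) (v t) = g t"
  proof (rule lift_through_quotient[OF R.A.ring_axioms oT oU oZ P'(2,1,3,4,5,6), where W = W and H = H])
    fix h assume "h \<in> rhom ?R P1 (over_quot T)"
    then show "\<exists>u\<in>rhom ?R P0 (over_quot T). \<forall>y\<in>carrier P1. h y = u (p1 y)"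
      by (rule R.zero_hom_to_translate_factor[OF oT P'(1) P0 P'(5) rigid])
  next
    show "rsubmodule ?R W (over_quot U)" using W over_quot_rsubmodule_iff[OF U I annU] by blast
    show "H \<subseteq> rhom ?R (over_quot T) (over_quot U)" using H unfolding U_def[symmetric] hTU .
    show "f ` carrier (over_quot T) \<subseteq> W" if "f \<in> H" for f
      using gen_submodule_incl[OF U HU] that unfolding W_def U_def[symmetric] by auto
    show "W \<subseteq> gen_submodule ?R (over_quot U) (\<Union>f\<in>H. f ` carrier (over_quot T))"
      unfolding gen_eq W_def U_def[symmetric] by simp
    show "(\<lambda>x\<in>carrier U. W +>\<^bsub>U\<^esub> x) \<in> rhom ?R (over_quot U) (over_quot ?Z)"
      unfolding hUZ by (rule Q(3))
    show "(\<lambda>x\<in>carrier U. W +>\<^bsub>U\<^esub> x) ` carrier (over_quot U) = carrier (over_quot ?Z)"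
      using Q(2) by simp
    show "(\<lambda>x\<in>carrier U. W +>\<^bsub>U\<^esub> x) x = \<zero>\<^bsub>over_quot ?Z\<^esub> \<longleftrightarrow> x \<in> W"
      if "x \<in> carrier (over_quot U)" for x
      using that Q(4)[of x "\<zero>\<^bsub>U\<^esub>"] rhom_zero[OF U Q(1) Q(3)] by simp
    show "g \<in> rhom ?R (over_quot T) (over_quot ?Z)" using g unfolding U_def[symmetric] hTZ .
  qed
  then obtain v where v: "v \<in> rhom A T U" "\<And>t. t \<in> carrier T \<Longrightarrow> (\<lambda>x\<in>carrier U. W +>\<^bsub>U\<^esub> x) (v t) = g t"
    unfolding hTU by auto
  then have "\<forall>t\<in>carrier T. W +>\<^bsub>U\<^esub> v t = g t" using rhom_closed[OF v(1)] by simp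
  then show ?thesis using v(1) unfolding U_def by blast
qed

section \<open>Direct sums and simple modules\<close>

lemma internal_direct_sum_projections:
  assumes M: "right_module A M" and dec: "internal_direct_sum A M n N"
  obtains e where "\<And>i. i < n \<Longrightarrow> e i \<in> rhom A M (M\<lparr>carrier := N i\<rparr>)"
    and "\<And>i x. i < n \<Longrightarrow> x \<in> N i \<Longrightarrow> e i x = x"
    and "\<And>x. x \<in> carrier M \<Longrightarrow> x = (\<Oplus>\<^bsub>M\<^esub>i\<in>{..<n}. e i x)"
proof -
  interpret M: right_module A M by fact
  have N: "rsubmodule A (N i) M" if "i < n" for i using dec that by (simp add: internal_direct_sum_def)
  let ?P = "\<lambda>x f. f \<in> (\<Pi>\<^sub>E i\<in>{..<n}. N i) \<and> x = (\<Oplus>\<^bsub>M\<^esub>i\<in>{..<n}. f i)"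
  have ex1: "\<exists>!f. ?P x f" if "x \<in> carrier M" for x using dec that by (simp add: internal_direct_sum_def)
  define d where "d x = (THE f. ?P x f)" for x
  have d: "?P x (d x)" if "x \<in> carrier M" for x unfolding d_def by (rule theI'[OF ex1[OF that]])
  have d_eq: "d x = f" if "x \<in> carrier M" "?P x f" for x f
    using ex1[OF that(1)] d[OF that(1)] that(2) by blast
  have NM: "y \<in> carrier M" if "i < n" "y \<in> N i" for i y using rsubmodule_subset[OF N[OF that(1)]] that(2) by blast
  have dN: "d x i \<in> N i" if "x \<in> carrier M" "i < n" for x i using d[OF that(1)] that(2) by auto
  have dM: "d x i \<in> carrier M" if "x \<in> carrier M" "i < n" for x i using NM dN that by blast
  define e where "e i = (\<lambda>x\<in>carrier M. d x i)" for i
  show thesis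
  proof (rule that)
    fix x assume x: "x \<in> carrier M"
    have "(\<Oplus>\<^bsub>M\<^esub>i\<in>{..<n}. d x i) = (\<Oplus>\<^bsub>M\<^esub>i\<in>{..<n}. e i x)"
      using x dM by (intro M.M.finsum_cong') (auto simp: e_def)
    then show "x = (\<Oplus>\<^bsub>M\<^esub>i\<in>{..<n}. e i x)" using d[OF x] by simp
  next
    fix i assume i: "i < n"
    show "e i \<in> rhom A M (M\<lparr>carrier := N i\<rparr>)" unfolding e_def
    proof (rule restrict_rhomI[OF M])
      fix x assume x: "x \<in> carrier M"
      show "d x i \<in> carrier (M\<lparr>carrier := N i\<rparr>)" using dN[OF x i] by simp
      show "d (x \<oplus>\<^bsub>M\<^esub> y) i = d x i \<oplus>\<^bsub>M\<lparr>carrier := N i\<rparr>\<^esub> d y i" if y: "y \<in> carrier M" for y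
      proof -
        have "d (x \<oplus>\<^bsub>M\<^esub> y) = (\<lambda>i\<in>{..<n}. d x i \<oplus>\<^bsub>M\<^esub> d y i)"
        proof (rule d_eq)
          have "(\<Oplus>\<^bsub>M\<^esub>i\<in>{..<n}. d x i \<oplus>\<^bsub>M\<^esub> d y i) = (\<Oplus>\<^bsub>M\<^esub>i\<in>{..<n}. d x i) \<oplus>\<^bsub>M\<^esub> (\<Oplus>\<^bsub>M\<^esub>i\<in>{..<n}. d y i)"
            using dM[OF x] dM[OF y] by (intro M.M.finsum_addf) auto
          moreover have "(\<Oplus>\<^bsub>M\<^esub>i\<in>{..<n}. (\<lambda>i\<in>{..<n}. d x i \<oplus>\<^bsub>M\<^esub> d y i) i) = (\<Oplus>\<^bsub>M\<^esub>i\<in>{..<n}. d x i \<oplus>\<^bsub>M\<^esub> d y i)"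
            using dM[OF x] dM[OF y] by (intro M.M.finsum_cong') auto
          ultimately show "?P (x \<oplus>\<^bsub>M\<^esub> y) (\<lambda>i\<in>{..<n}. d x i \<oplus>\<^bsub>M\<^esub> d y i)"
            using d[OF x] d[OF y] dN[OF x] dN[OF y] rsubmodule_add_closed[OF N] by auto
        qed (use x y in simp)
        then show ?thesis using i by simp
      qed
      show "d (x \<bullet>\<^bsub>M\<^esub> a) i = d x i \<bullet>\<^bsub>M\<lparr>carrier := N i\<rparr>\<^esub> a" if a: "a \<in> carrier A" for a
      proof -
        have h: "(\<lambda>x\<in>carrier M. x \<bullet>\<^bsub>M\<^esub> a) y = y \<bullet>\<^bsub>M\<^esub> a" if "y \<in> carrier M" for y using that by simp
        have "(\<Oplus>\<^bsub>M\<^esub>i\<in>I. d x i) \<bullet>\<^bsub>M\<^esub> a = (\<Oplus>\<^bsub>M\<^esub>i\<in>I. d x i \<bullet>\<^bsub>M\<^esub> a)" if "finite I" "I \<subseteq> {..<n}" for I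
          using that
        proof (induction I)
          case (insert j I)
          then show ?case
            using dM[OF x] a by (subst (1 2) M.M.finsum_insert)
              (auto simp: M.ract_add_left M.ract_closed Pi_def subset_eq intro!: M.M.finsum_closed)
        qed (simp add: M.M.finsum_empty a)
        then have sum: "(\<Oplus>\<^bsub>M\<^esub>i\<in>{..<n}. d x i) \<bullet>\<^bsub>M\<^esub> a = (\<Oplus>\<^bsub>M\<^esub>i\<in>{..<n}. d x i \<bullet>\<^bsub>M\<^esub> a)" by simp
        have "d (x \<bullet>\<^bsub>M\<^esub> a) = (\<lambda>i\<in>{..<n}. d x i \<bullet>\<^bsub>M\<^esub> a)"
        proof (rule d_eq)
          have "(\<Oplus>\<^bsub>M\<^esub>i\<in>{..<n}. (\<lambda>i\<in>{..<n}. d x i \<bullet>\<^bsub>M\<^esub> a) i) = (\<Oplus>\<^bsub>M\<^esub>i\<in>{..<n}. d x i \<bullet>\<^bsub>M\<^esub> a)"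
            using dM[OF x] a by (intro M.M.finsum_cong') (auto intro!: M.ract_closed)
          then show "?P (x \<bullet>\<^bsub>M\<^esub> a) (\<lambda>i\<in>{..<n}. d x i \<bullet>\<^bsub>M\<^esub> a)"
            using sum d[OF x] dN[OF x] rsubmodule_ract_closed[OF N] a by auto
        qed (use x a M.ract_closed in simp)
        then show ?thesis using i by simp
      qed
    qed
    fix x assume x: "x \<in> N i"
    have "d x = (\<lambda>j\<in>{..<n}. if i = j then x else \<zero>\<^bsub>M\<^esub>)"
    proof (rule d_eq[OF NM[OF i x]])
      have "(\<Oplus>\<^bsub>M\<^esub>j\<in>{..<n}. (\<lambda>j\<in>{..<n}. if i = j then x else \<zero>\<^bsub>M\<^esub>) j) = (\<Oplus>\<^bsub>M\<^esub>j\<in>{..<n}. if i = j then x else \<zero>\<^bsub>M\<^esub>)"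
        using NM[OF i x] by (intro M.M.finsum_cong') auto
      also have "\<dots> = x" using M.M.finsum_singleton[of i "{..<n}" "\<lambda>_. x"] NM[OF i x] i by simp
      finally show "?P x (\<lambda>j\<in>{..<n}. if i = j then x else \<zero>\<^bsub>M\<^esub>)"
        using x rsubmodule_zero_closed[OF N] by auto
    qed
    then show "e i x = x" using i NM[OF i x] by (simp add: e_def)
  qed
qed

text \<open>
  The image of the section \<open>w\<close> is a nonzero direct summand of \<open>M\<close>, with complement the kernel of
  \<open>k\<close>.
\<close>

lemma split_epi_indecomposable:
  assumes M: "right_module A M" and L: "right_module A L" and indec: "indecomposable A M"
    and k: "k \<in> rhom A M L" and w: "w \<in> rhom A L M" and kw: "\<And>x. x \<in> carrier L \<Longrightarrow> k (w x) = x"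
    and nz: "carrier L \<noteq> {\<zero>\<^bsub>L\<^esub>}"
  shows "rmod_iso A L M"
proof -
  interpret M: right_module A M by fact
  interpret L: right_module A L by fact
  let ?I = "w ` carrier L" and ?N = "{x \<in> carrier M. k x = \<zero>\<^bsub>L\<^esub>}"
  have I: "rsubmodule A ?I M" by (rule rhom_image_rsubmodule[OF L M w L.rsubmodule_carrier])
  have N: "rsubmodule A ?N M" by (rule rhom_ker_rsubmodule[OF M L k])
  have "direct_summand A ?I M" unfolding direct_summand_def
  proof (intro conjI exI[of _ ?N] I N equalityI subsetI)
    fix x assume "x \<in> ?I \<inter> ?N"
    then obtain y where y: "y \<in> carrier L" "x = w y" "k x = \<zero>\<^bsub>L\<^esub>" by auto
    then show "x \<in> {\<zero>\<^bsub>M\<^esub>}" using kw[OF y(1)] rhom_zero[OF L M w] by simp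
  next
    fix x assume x: "x \<in> carrier M"
    have kx: "k x \<in> carrier L" using rhom_closed[OF k x] .
    have wkx: "w (k x) \<in> carrier M" using rhom_closed[OF w kx] .
    have "k (x \<ominus>\<^bsub>M\<^esub> w (k x)) = \<zero>\<^bsub>L\<^esub>"
      using rhom_minus[OF M L k x wkx] kw[OF kx] kx by simp
    then have "x \<ominus>\<^bsub>M\<^esub> w (k x) \<in> ?N" using x wkx by simp
    moreover have "x = w (k x) \<oplus>\<^bsub>M\<^esub> (x \<ominus>\<^bsub>M\<^esub> w (k x))"
      using x wkx by (simp add: a_minus_def M.M.a_lcomm[of "w (k x)" x] M.M.r_neg)
    ultimately show "x \<in> ?I <+>\<^bsub>M\<^esub> ?N" using kx unfolding set_add_def' by blast
  qed (use rsubmodule_zero_closed[OF I] rsubmodule_zero_closed[OF N]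
      subsetD[OF rsubmodule_subset[OF I]] in \<open>auto simp: set_add_def'\<close>)
  then have "?I = {\<zero>\<^bsub>M\<^esub>} \<or> ?I = carrier M" using indec by (simp add: indecomposable_def)
  moreover have "?I \<noteq> {\<zero>\<^bsub>M\<^esub>}"
  proof
    assume *: "?I = {\<zero>\<^bsub>M\<^esub>}"
    have "x = \<zero>\<^bsub>L\<^esub>" if "x \<in> carrier L" for x
    proof -
      have "w x = \<zero>\<^bsub>M\<^esub>" using * that by blast
      then show ?thesis using kw[OF that] rhom_zero[OF M L k] by simp
    qed
    then show False using nz L.M.zero_closed by blast
  qed
  moreover have "inj_on w (carrier L)" using kw by (rule inj_on_inverseI)
  ultimately show ?thesis using w by (auto simp: rmod_iso_def bij_betw_def)
qed

lemma simple_rmodule_cyclic: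
  assumes "simple_rmodule B Y" "y \<in> carrier Y" "y \<noteq> \<zero>\<^bsub>Y\<^esub>" "z \<in> carrier Y"
  obtains b where "b \<in> carrier B" "z = y \<bullet>\<^bsub>Y\<^esub> b"
proof -
  have Y: "right_module B Y" using assms(1) by (simp add: simple_rmodule_def)
  interpret Y: right_module B Y by fact
  have R: "right_module B (regular B)" by (rule regular_right_module[OF Y.A.ring_axioms])
  interpret R: right_module B "regular B" by fact
  let ?f = "\<lambda>b\<in>carrier B. y \<bullet>\<^bsub>Y\<^esub> b"
  have "restrict (\<lambda>b. y \<bullet>\<^bsub>Y\<^esub> b) (carrier (regular B)) \<in> rhom B (regular B) Y"
    using assms(2) by (intro restrict_rhomI[OF R]) (auto simp: Y.ract_closed Y.ract_add_right Y.ract_mult)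
  then have f: "?f \<in> rhom B (regular B) Y" by simp
  have "rsubmodule B (?f ` carrier B) Y"
    using rhom_image_rsubmodule[OF R Y f R.rsubmodule_carrier] by simp
  moreover have "y \<in> ?f ` carrier B"
    using assms(2) by (intro image_eqI[of _ _ "\<one>\<^bsub>B\<^esub>"]) (auto simp: Y.ract_one)
  ultimately have "?f ` carrier B = carrier Y"
    using assms(1,3) unfolding simple_rmodule_def by blast
  then have "z \<in> ?f ` carrier B" using assms(4) by simp
  then show thesis using that by auto
qed

lemma simple_rmodule_iso:
  assumes M: "simple_rmodule B M" and N: "right_module B N" and iso: "rmod_iso B M N"
  shows "simple_rmodule B N"
proof -
  have M': "right_module B M" using M by (simp add: simple_rmodule_def)
  interpret M: right_module B M by fact
  interpret N: right_module B N by fact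
  obtain f where f: "f \<in> rhom B M N" "bij_betw f (carrier M) (carrier N)" using iso by (auto simp: rmod_iso_def)
  have onto: "f ` carrier M = carrier N" using f(2) by (simp add: bij_betw_def)
  show ?thesis unfolding simple_rmodule_def
  proof (intro conjI allI impI N)
    obtain x where x: "x \<in> carrier M" "x \<noteq> \<zero>\<^bsub>M\<^esub>"
      using M M.M.zero_closed unfolding simple_rmodule_def by blast
    have "f x \<noteq> \<zero>\<^bsub>N\<^esub>"
    proof
      assume "f x = \<zero>\<^bsub>N\<^esub>"
      then have "f x = f \<zero>\<^bsub>M\<^esub>" using rhom_zero[OF M' N f(1)] by simp
      then show False using inj_onD[OF bij_betw_imp_inj_on[OF f(2)]] x M.M.zero_closed by blast
    qed
    then show "carrier N \<noteq> {\<zero>\<^bsub>N\<^esub>}" using rhom_closed[OF f(1) x(1)] by blast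
    fix L assume L: "rsubmodule B L N"
    let ?L = "{x \<in> carrier M. f x \<in> L}"
    have fL: "f ` ?L = L"
    proof (intro equalityI subsetI)
      fix y assume y: "y \<in> L"
      then have "y \<in> f ` carrier M" using rsubmodule_subset[OF L] onto by auto
      then obtain x where "x \<in> carrier M" "y = f x" by auto
      then show "y \<in> f ` ?L" using y by simp
    qed auto
    have "?L = {\<zero>\<^bsub>M\<^esub>} \<or> ?L = carrier M"
      using M rhom_vimage_rsubmodule[OF M' N f(1) L] unfolding simple_rmodule_def by blast
    then show "L = {\<zero>\<^bsub>N\<^esub>} \<or> L = carrier N"
    proof
      assume *: "?L = {\<zero>\<^bsub>M\<^esub>}"
      show ?thesis using fL rhom_zero[OF M' N f(1)] unfolding * by simp
    next
      assume *: "?L = carrier M"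
      show ?thesis using fL onto unfolding * by simp
    qed
  qed
qed

lemma in_Sub_iso:
  fixes M :: "('b, 'm) rmodule" and N :: "('b, 'n) rmodule" and Z :: "('b, 'z) rmodule"
  assumes "in_Sub B Z M" and N: "fg_rmodule B N" and iso: "rmod_iso B N M"
  shows "in_Sub B Z N"
proof -
  obtain n L f where f: "direct_summand B L (power_rmod Z n)"
    "f \<in> rhom B M ((power_rmod Z n)\<lparr>carrier := L\<rparr>)" "inj_on f (carrier M)"
    using assms(1) by (auto simp: in_Sub_def)
  obtain g where g: "g \<in> rhom B N M" "bij_betw g (carrier N) (carrier M)" using iso by (auto simp: rmod_iso_def)
  have N': "right_module B N" using N by (simp add: fg_rmodule_def)
  have "inj_on (f \<circ> g) (carrier N)"
    using comp_inj_on[of g "carrier N" f] g(2) f(3) by (simp add: bij_betw_def)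
  then have "inj_on (compose (carrier N) f g) (carrier N)" by (simp add: inj_on_def compose_eq)
  then show ?thesis
    unfolding in_Sub_def using N f(1) compose_rhom[OF N' g(1) f(2)] by blast
qed

lemma iso_class_cong:
  assumes M: "right_module B M" and N: "right_module B N" and iso: "rmod_iso B M N"
  shows "iso_class K B M = iso_class K B N"
  unfolding iso_class_def
  using rmod_iso_trans[OF M iso] rmod_iso_trans[OF N rmod_iso_sym[OF M N iso]] by blast

text \<open>
  Transport of structure along the coordinates.  Therefore the isomorphism class of a module of
  finite dimension, taken inside the type \<open>nat \<Rightarrow> 'k\<close>, is never empty.
\<close>

lemma (in central_scalars) iso_coordinate_module:
  fixes M :: "('a, 'm) rmodule"
  assumes M: "right_module A M" and sep: "separating K (vect A M) F"
  obtains Y :: "('a, nat \<Rightarrow> 'k) rmodule" where "right_module A Y" "rmod_iso A M Y"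
proof -
  interpret M: right_module A M by fact
  obtain \<chi> where \<chi>: "\<And>i. i < card F \<Longrightarrow> \<chi> i \<in> rhom K (vect A M) (regular K)"
    and zero: "\<And>x. x \<in> carrier (vect A M) \<Longrightarrow> (\<And>i. i < card F \<Longrightarrow> \<chi> i x = \<zero>\<^bsub>K\<^esub>)
      \<Longrightarrow> x = \<zero>\<^bsub>vect A M\<^esub>"
    using separating_enum[OF sep] by blast
  define c where "c x = (\<lambda>i. if i < card F then \<chi> i x else \<zero>\<^bsub>K\<^esub>)" for x
  have inj: "inj_on c (carrier M)"
  proof (rule inj_onI)
    fix x y assume x: "x \<in> carrier M" and y: "y \<in> carrier M" and eq: "c x = c y"
    have "x \<ominus>\<^bsub>M\<^esub> y = \<zero>\<^bsub>vect A M\<^esub>"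
    proof (rule zero)
      fix i assume i: "i < card F"
      have "\<chi> i x = \<chi> i y" using fun_cong[OF eq, of i] i by (simp add: c_def)
      then show "\<chi> i (x \<ominus>\<^bsub>M\<^esub> y) = \<zero>\<^bsub>K\<^esub>"
        using rhom_minus[OF vect_right_module[OF M] regular_right_module[OF K.ring_axioms] \<chi>[OF i], of x y]
          rhom_closed[OF \<chi>[OF i]] x y by simp
    qed (use x y in simp)
    then show "x = y" using x y by simp
  qed
  let ?d = "inv_into (carrier M) c"
  define Y :: "('a, nat \<Rightarrow> 'k) rmodule" where "Y =
    \<lparr>carrier = c ` carrier M, monoid.mult = undefined, one = undefined, ring.zero = c \<zero>\<^bsub>M\<^esub>,
     ring.add = (\<lambda>x y. c (?d x \<oplus>\<^bsub>M\<^esub> ?d y)), ract = (\<lambda>x a. c (?d x \<bullet>\<^bsub>M\<^esub> a))\<rparr>"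
  note d = inv_into_f_f[OF inj]
  have Y: "right_module A Y"
    by (rule right_module_image[OF M, where \<phi> = c]) (simp_all add: Y_def d)
  have "restrict c (carrier M) \<in> rhom A M Y"
    by (rule restrict_rhomI[OF M]) (auto simp: Y_def d)
  moreover have "bij_betw (restrict c (carrier M)) (carrier M) (carrier Y)"
    using inj by (simp add: bij_betw_restrict_eq Y_def bij_betw_def)
  ultimately have "rmod_iso A M Y" unfolding rmod_iso_def by blast
  then show thesis using Y that by blast
qed

lemma rmod_iso_fg:
  assumes "fg_rmodule A M" "right_module A N" "rmod_iso A M N"
  shows "fg_rmodule A N"
proof -
  obtain f where f: "f \<in> rhom A M N" "bij_betw f (carrier M) (carrier N)"
    using assms(3) by (auto simp: rmod_iso_def)
  show ?thesis by (rule fg_rmodule_image[OF assms(1,2) f(1)]) (use f(2) in \<open>simp add: bij_betw_def\<close>)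
qed

section \<open>The right \<open>End T\<close>-module dual to \<open>T\<close>\<close>

lemma hom_rmod_map:
  assumes T: "right_module A T" and Y: "right_module A Y" and Z: "right_module A Z" and f: "f \<in> rhom A Y Z"
  shows "(\<lambda>u\<in>rhom A T Y. compose (carrier T) f u) \<in> rhom (end_alg A T) (hom_rmod A T Y) (hom_rmod A T Z)"
proof -
  have "restrict (compose (carrier T) f) (carrier (hom_rmod A T Y))
      \<in> rhom (end_alg A T) (hom_rmod A T Y) (hom_rmod A T Z)"
  proof (rule restrict_rhomI[OF hom_rmod_right_module[OF T Y]])
    fix u assume u: "u \<in> carrier (hom_rmod A T Y)"
    show "compose (carrier T) f u \<in> carrier (hom_rmod A T Z)" using compose_rhom[OF T _ f] u by simp
    show "compose (carrier T) f (u \<oplus>\<^bsub>hom_rmod A T Y\<^esub> v)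
        = compose (carrier T) f u \<oplus>\<^bsub>hom_rmod A T Z\<^esub> compose (carrier T) f v"
      if "v \<in> carrier (hom_rmod A T Y)" for v
      using u that rhom_closed[of _ A T Y] rhom_add[OF f] by (auto simp: compose_def intro!: restrict_ext)
    show "compose (carrier T) f (u \<bullet>\<^bsub>hom_rmod A T Y\<^esub> b) = compose (carrier T) f u \<bullet>\<^bsub>hom_rmod A T Z\<^esub> b"
      if "b \<in> carrier (end_alg A T)" for b
    proof -
      have b: "b \<in> rhom A T T" using that by simp
      show ?thesis by (simp add: compose_def rhom_closed[OF b] cong: restrict_cong)
    qed
  qed
  then show ?thesis by simp
qed

context central_scalars
begin

lemma dual_end_mod_simps [simp]:
  "\<zero>\<^bsub>dual_end_mod K A T\<^esub> = (\<lambda>y\<in>carrier T. \<zero>\<^bsub>K\<^esub>)"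
  "\<phi> \<oplus>\<^bsub>dual_end_mod K A T\<^esub> \<psi> = (\<lambda>y\<in>carrier T. \<phi> y \<oplus>\<^bsub>K\<^esub> \<psi> y)"
  "\<phi> \<bullet>\<^bsub>dual_end_mod K A T\<^esub> b = (\<lambda>y\<in>carrier T. \<phi> (b y))"
  by (simp_all add: dual_end_mod_def dual_def left_end_mod_def)

lemma dual_end_mod_carrier:
  "carrier (dual_end_mod K A T) = rhom K (vect A T) (regular K)"
proof -
  have s: "c \<odot>\<^bsub>opp (end_alg A T)\<^esub> \<one>\<^bsub>opp (end_alg A T)\<^esub> = (\<lambda>x\<in>carrier T. x \<bullet>\<^bsub>T\<^esub> scalar A c)" for c
    using scalar_end_alg[of T c] by (simp add: scalar_def)
  have comm: "(\<forall>y\<in>carrier T. \<forall>c\<in>carrier K. \<phi> (y \<bullet>\<^bsub>T\<^esub> scalar A c) = c \<otimes>\<^bsub>K\<^esub> \<phi> y) \<longleftrightarrow>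
      (\<forall>y\<in>carrier T. \<forall>c\<in>carrier K. \<phi> (y \<bullet>\<^bsub>T\<^esub> scalar A c) = \<phi> y \<otimes>\<^bsub>K\<^esub> c)"
    if "\<phi> \<in> carrier T \<rightarrow>\<^sub>E carrier K" for \<phi>
    by (intro ball_cong refl) (simp add: K.m_comm[OF _ PiE_mem[OF that]])
  have "carrier (dual_end_mod K A T) = {\<phi> \<in> carrier T \<rightarrow>\<^sub>E carrier K.
      (\<forall>x\<in>carrier T. \<forall>y\<in>carrier T. \<phi> (x \<oplus>\<^bsub>T\<^esub> y) = \<phi> x \<oplus>\<^bsub>K\<^esub> \<phi> y) \<and>
      (\<forall>y\<in>carrier T. \<forall>c\<in>carrier K. \<phi> (y \<bullet>\<^bsub>T\<^esub> scalar A c) = c \<otimes>\<^bsub>K\<^esub> \<phi> y)}"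
    unfolding dual_end_mod_def dual_def s by (simp add: left_end_mod_def)
  also have "\<dots> = rhom K (vect A T) (regular K)"
    unfolding rhom_def using comm by (intro Collect_cong) auto
  finally show ?thesis .
qed

lemma dual_end_mod_right_module:
  assumes T: "right_module A T"
  shows "right_module (end_alg A T) (dual_end_mod K A T)"
proof (rule right_moduleI)
  have V: "right_module K (vect A T)" by (rule vect_right_module[OF T])
  have R: "right_module K (regular K)" by (rule regular_right_module[OF K.ring_axioms])
  note c = rhom_closed[of _ K "vect A T" "regular K", unfolded vect_simps regular_simps]
    and cT = rhom_closed[of _ A T T]
  interpret T: right_module A T by fact
  show "ring (end_alg A T)" by (rule end_alg_ring[OF T])
  show "abelian_group (dual_end_mod K A T)"
    by (rule rhom_pointwise_group(1)[OF V R]) (simp_all add: dual_end_mod_carrier)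
  fix \<phi> assume "\<phi> \<in> carrier (dual_end_mod K A T)"
  then have \<phi>: "\<phi> \<in> rhom K (vect A T) (regular K)" by (simp add: dual_end_mod_carrier)
  show "\<phi> \<bullet>\<^bsub>dual_end_mod K A T\<^esub> \<one>\<^bsub>end_alg A T\<^esub> = \<phi>"
    using rhom_extensional[OF \<phi>] by (intro extensionalityI[of _ "carrier T"]) auto
  fix b assume "b \<in> carrier (end_alg A T)"
  then have b: "b \<in> rhom A T T" by simp
  have "(\<lambda>y\<in>carrier T. \<phi> (b y)) = compose (carrier (vect A T)) \<phi> b" by (simp add: compose_def)
  then show "\<phi> \<bullet>\<^bsub>dual_end_mod K A T\<^esub> b \<in> carrier (dual_end_mod K A T)"
    using compose_rhom[OF V vect_rhom[OF b] \<phi>] by (simp add: dual_end_mod_carrier)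
  show "(\<phi> \<oplus>\<^bsub>dual_end_mod K A T\<^esub> \<psi>) \<bullet>\<^bsub>dual_end_mod K A T\<^esub> b
      = \<phi> \<bullet>\<^bsub>dual_end_mod K A T\<^esub> b \<oplus>\<^bsub>dual_end_mod K A T\<^esub> \<psi> \<bullet>\<^bsub>dual_end_mod K A T\<^esub> b" for \<psi>
    by (simp add: cT[OF b] cong: restrict_cong)
  fix b' assume "b' \<in> carrier (end_alg A T)"
  then have b': "b' \<in> rhom A T T" by simp
  show "\<phi> \<bullet>\<^bsub>dual_end_mod K A T\<^esub> (b \<oplus>\<^bsub>end_alg A T\<^esub> b')
      = \<phi> \<bullet>\<^bsub>dual_end_mod K A T\<^esub> b \<oplus>\<^bsub>dual_end_mod K A T\<^esub> \<phi> \<bullet>\<^bsub>dual_end_mod K A T\<^esub> b'"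
    using rhom_add[OF \<phi>] by (simp add: cT[OF b] cT[OF b'] cong: restrict_cong)
  show "\<phi> \<bullet>\<^bsub>dual_end_mod K A T\<^esub> (b \<otimes>\<^bsub>end_alg A T\<^esub> b')
      = (\<phi> \<bullet>\<^bsub>dual_end_mod K A T\<^esub> b) \<bullet>\<^bsub>dual_end_mod K A T\<^esub> b'"
    by (simp add: compose_def cT[OF b'] cong: restrict_cong)
qed

end

lemma hom_rmod_fd:
  fixes K :: "'k ring"
  assumes fd: "fd_algebra K A" and T: "fg_rmodule A T" and Y: "fg_rmodule A Y"
  obtains F where "separating K (vect (end_alg A T) (hom_rmod A T Y)) F"
proof -
  interpret central_scalars K A by (rule fd_algebra_central_scalars[OF fd])
  have T': "right_module A T" and Y': "right_module A Y" using T Y by (simp_all add: fg_rmodule_def)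
  obtain G where "separating K (vect A Y) G"
    using fg_imp_separating[OF K.field_axioms fd_algebra_fg_vect[OF fd Y]] by blast
  then show thesis
    using hom_rmod_separating[OF T' Y' fd_algebra_fg_vect[OF fd T]] that by blast
qed

lemma hom_rmod_fg:
  fixes K :: "'k ring"
  assumes fd: "fd_algebra K A" and T: "fg_rmodule A T" and Y: "fg_rmodule A Y"
  shows "fg_rmodule (end_alg A T) (hom_rmod A T Y)"
proof -
  interpret central_scalars K A by (rule fd_algebra_central_scalars[OF fd])
  have T': "right_module A T" and Y': "right_module A Y" using T Y by (simp_all add: fg_rmodule_def)
  interpret B: central_scalars K "end_alg A T" by (rule end_alg_central_scalars[OF T'])
  have H: "right_module (end_alg A T) (hom_rmod A T Y)" by (rule hom_rmod_right_module[OF T' Y'])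
  obtain F where "separating K (vect (end_alg A T) (hom_rmod A T Y)) F"
    using hom_rmod_fd[OF fd T Y] by blast
  then show ?thesis
    by (intro B.fg_rmodule_if_vect[OF H] separating_imp_fg[OF K.field_axioms B.vect_right_module[OF H]])
qed

text \<open>
  A coordinate \<open>\<phi>\<close> of \<open>Y\<close> gives the \<open>B\<close>-linear map \<open>f \<mapsto> \<phi> f\<close> from \<open>Hom(T, Y)\<close> to \<open>\<D>T\<close>, and
  together these maps are injective.
\<close>

lemma hom_rmod_in_Sub:
  fixes K :: "'k ring"
  assumes fd: "fd_algebra K A" and T: "fg_rmodule A T" and Y: "fg_rmodule A Y"
  shows "in_Sub (end_alg A T) (dual_end_mod K A T) (hom_rmod A T Y)"
proof -
  interpret central_scalars K A by (rule fd_algebra_central_scalars[OF fd])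
  have T': "right_module A T" and Y': "right_module A Y" using T Y by (simp_all add: fg_rmodule_def)
  have V: "right_module K (vect A T)" by (rule vect_right_module[OF T'])
  obtain G where "separating K (vect A Y) G"
    using fg_imp_separating[OF K.field_axioms fd_algebra_fg_vect[OF fd Y]] by blast
  then have G: "finite G" "G \<subseteq> rhom K (vect A Y) (regular K)"
    "\<And>y. y \<in> carrier Y \<Longrightarrow> \<forall>\<phi>\<in>G. \<phi> y = \<zero>\<^bsub>K\<^esub> \<Longrightarrow> y = \<zero>\<^bsub>Y\<^esub>"
    by (auto simp: separating_def)
  have H: "right_module (end_alg A T) (hom_rmod A T Y)" by (rule hom_rmod_right_module[OF T' Y'])
  let ?\<theta> = "\<lambda>\<phi>. \<lambda>f\<in>rhom A T Y. \<lambda>t\<in>carrier T. \<phi> (f t)"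
  show ?thesis
  proof (rule in_SubI[OF dual_end_mod_right_module[OF T'] hom_rmod_fg[OF fd T Y]])
    show "finite (?\<theta> ` G)" using G(1) by simp
    show "?\<theta> ` G \<subseteq> rhom (end_alg A T) (hom_rmod A T Y) (dual_end_mod K A T)"
    proof safe
      fix \<phi> assume "\<phi> \<in> G"
      then have \<phi>: "\<phi> \<in> rhom K (vect A Y) (regular K)" using G(2) by blast
      have "restrict (\<lambda>f. \<lambda>t\<in>carrier T. \<phi> (f t)) (carrier (hom_rmod A T Y))
          \<in> rhom (end_alg A T) (hom_rmod A T Y) (dual_end_mod K A T)"
      proof (rule restrict_rhomI[OF H])
        fix f assume "f \<in> carrier (hom_rmod A T Y)"
        then have f: "f \<in> rhom A T Y" by simp
        have "(\<lambda>t\<in>carrier T. \<phi> (f t)) = compose (carrier (vect A T)) \<phi> f" by (simp add: compose_def)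
        then show "(\<lambda>t\<in>carrier T. \<phi> (f t)) \<in> carrier (dual_end_mod K A T)"
          using compose_rhom[OF V vect_rhom[OF f] \<phi>] by (simp add: dual_end_mod_carrier)
        show "(\<lambda>t\<in>carrier T. \<phi> ((f \<oplus>\<^bsub>hom_rmod A T Y\<^esub> g) t)) =
            (\<lambda>t\<in>carrier T. \<phi> (f t)) \<oplus>\<^bsub>dual_end_mod K A T\<^esub> (\<lambda>t\<in>carrier T. \<phi> (g t))"
          if "g \<in> carrier (hom_rmod A T Y)" for g
          using that rhom_closed[OF f] rhom_closed[of g A T Y] rhom_add[OF \<phi>] by (auto intro!: restrict_ext)
        show "(\<lambda>t\<in>carrier T. \<phi> ((f \<bullet>\<^bsub>hom_rmod A T Y\<^esub> b) t)) =
            (\<lambda>t\<in>carrier T. \<phi> (f t)) \<bullet>\<^bsub>dual_end_mod K A T\<^esub> b"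
          if "b \<in> carrier (end_alg A T)" for b
        proof -
          have b: "b \<in> rhom A T T" using that by simp
          show ?thesis by (simp add: compose_def rhom_closed[OF b] cong: restrict_cong)
        qed
      qed
      then show "?\<theta> \<phi> \<in> rhom (end_alg A T) (hom_rmod A T Y) (dual_end_mod K A T)" by simp
    qed
    fix f assume "f \<in> carrier (hom_rmod A T Y)" and ann: "\<And>\<theta>. \<theta> \<in> ?\<theta> ` G \<Longrightarrow> \<theta> f = \<zero>\<^bsub>dual_end_mod K A T\<^esub>"
    then have f: "f \<in> rhom A T Y" by simp
    have "f t = \<zero>\<^bsub>Y\<^esub>" if t: "t \<in> carrier T" for t
    proof (rule G(3)[OF rhom_closed[OF f t]], rule ballI)
      fix \<phi> assume "\<phi> \<in> G"
      then have "?\<theta> \<phi> f = (\<lambda>y\<in>carrier T. \<zero>\<^bsub>K\<^esub>)" using ann[of "?\<theta> \<phi>"] by auto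
      then have "?\<theta> \<phi> f t = \<zero>\<^bsub>K\<^esub>" using t by (simp only: restrict_apply')
      then show "\<phi> (f t) = \<zero>\<^bsub>K\<^esub>" using f t by simp
    qed
    then show "f = \<zero>\<^bsub>hom_rmod A T Y\<^esub>" using rhom_eqI[OF f zero_rhom[OF T' Y']] by simp
  qed
qed

section \<open>The semibrick and the simple modules\<close>

lemma finsum_vect: "(\<Oplus>\<^bsub>vect A M\<^esub>i\<in>I. f i) = (\<Oplus>\<^bsub>M\<^esub>i\<in>I. f i)"
  by (simp add: finsum_def finprod_def vect_def)

text \<open>
  The lifting property for \<open>T\<^sub>i \<rightarrow> S\<^sub>i\<close> is isolated as an assumption: all that follows in this
  context is a consequence of it and of the Krull--Schmidt decomposition of \<open>T\<close>.  In the notation of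
  the introduction \<open>U i\<close> is \<open>T\<^sub>i\<close>, \<open>q i\<close> is the projection \<open>T\<^sub>i \<rightarrow> S\<^sub>i\<close> and \<open>e i\<close> is the
  idempotent of \<open>End T\<close> that projects onto \<open>T\<^sub>i\<close>.
\<close>

locale rad_lifting =
  fixes K :: "'k ring" and A :: "('k, 'a) module" and T :: "('a, 't) rmodule"
    and n :: nat and N :: "nat \<Rightarrow> 't set"
  assumes fd: "fd_algebra K A" and T_fg: "fg_rmodule A T" and decomp: "basic_decomposition A T n N"
    and lift: "\<And>i g. i < n \<Longrightarrow> g \<in> rhom A T (rad_quotient A T (N i)) \<Longrightarrow>
      \<exists>v\<in>rhom A T (T\<lparr>carrier := N i\<rparr>). \<forall>t\<in>carrier T.
        gen_submodule A (T\<lparr>carrier := N i\<rparr>) (\<Union>f\<in>rad_hom A T (T\<lparr>carrier := N i\<rparr>). f ` carrier T)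
          +>\<^bsub>T\<lparr>carrier := N i\<rparr>\<^esub> v t = g t"
begin

abbreviation "B \<equiv> end_alg A T"

definition U :: "nat \<Rightarrow> ('a, 't) rmodule" where "U i = T\<lparr>carrier := N i\<rparr>"

definition R :: "nat \<Rightarrow> 't set"
  where "R i = gen_submodule A (U i) (\<Union>f\<in>rad_hom A T (U i). f ` carrier T)"

definition S :: "nat \<Rightarrow> ('a, 't set) rmodule" where "S i = rad_quotient A T (N i)"

definition projections :: "(nat \<Rightarrow> 't \<Rightarrow> 't) \<Rightarrow> bool"
  where "projections e \<longleftrightarrow> (\<forall>i<n. e i \<in> rhom A T (U i) \<and> (\<forall>x\<in>N i. e i x = x)) \<and>
    (\<forall>x\<in>carrier T. x = (\<Oplus>\<^bsub>T\<^esub>i\<in>{..<n}. e i x))"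

definition e :: "nat \<Rightarrow> 't \<Rightarrow> 't" where "e = (SOME e. projections e)"

definition q :: "nat \<Rightarrow> 't \<Rightarrow> 't set" where "q i = (\<lambda>x\<in>N i. R i +>\<^bsub>U i\<^esub> x)"

sublocale scal: central_scalars K A by (rule fd_algebra_central_scalars[OF fd])

lemma S_eq: "S i = quot_rmod (U i) (R i)"
  by (simp add: S_def rad_quotient_def U_def R_def Let_def)

lemma T_module: "right_module A T" using T_fg by (simp add: fg_rmodule_def)

lemma N_sub: "i < n \<Longrightarrow> rsubmodule A (N i) T"
  using decomp by (simp add: basic_decomposition_def internal_direct_sum_def)

lemma U_carrier [simp]: "carrier (U i) = N i" by (simp add: U_def)

lemma U_module: "i < n \<Longrightarrow> right_module A (U i)"
  unfolding U_def by (rule right_module_submodule[OF T_module N_sub])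

lemma U_indec: "i < n \<Longrightarrow> indecomposable A (U i)"
  using decomp by (simp add: basic_decomposition_def U_def)

lemma U_incl: "i < n \<Longrightarrow> f \<in> rhom A M (U i) \<longleftrightarrow> f \<in> rhom A M T \<and> f ` carrier M \<subseteq> N i"
  unfolding U_def by (rule rhom_submodule[OF rsubmodule_subset[OF N_sub]])

lemma projections_e: "projections e"
proof -
  have "internal_direct_sum A T n N" using decomp by (simp add: basic_decomposition_def)
  then obtain e' where "\<And>i. i < n \<Longrightarrow> e' i \<in> rhom A T (T\<lparr>carrier := N i\<rparr>)"
    "\<And>i x. i < n \<Longrightarrow> x \<in> N i \<Longrightarrow> e' i x = x" "\<And>x. x \<in> carrier T \<Longrightarrow> x = (\<Oplus>\<^bsub>T\<^esub>i\<in>{..<n}. e' i x)"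
    using internal_direct_sum_projections[OF T_module] by blast
  then have "projections e'" by (simp add: projections_def U_def)
  then show ?thesis unfolding e_def by (rule someI[of projections])
qed

lemma e_rhom: "i < n \<Longrightarrow> e i \<in> rhom A T (U i)"
  and e_id: "i < n \<Longrightarrow> x \<in> N i \<Longrightarrow> e i x = x"
  and e_sum: "x \<in> carrier T \<Longrightarrow> (\<Oplus>\<^bsub>T\<^esub>i\<in>{..<n}. e i x) = x"
  using projections_e by (auto simp: projections_def)

lemma e_T: "i < n \<Longrightarrow> e i \<in> rhom A T T" using e_rhom U_incl by blast

lemma e_N: "i < n \<Longrightarrow> t \<in> carrier T \<Longrightarrow> e i t \<in> N i" using rhom_closed[OF e_rhom] by simp

lemma N_T: "i < n \<Longrightarrow> x \<in> N i \<Longrightarrow> x \<in> carrier T" using rsubmodule_subset[OF N_sub] by blast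

lemma U_fd:
  assumes i: "i < n" shows "fg_rmodule K (vect A (U i))"
proof (rule fd_algebra_fg_vect[OF fd], rule fg_rmodule_image[OF T_fg U_module[OF i] e_rhom[OF i]])
  have "x \<in> e i ` carrier T" if "x \<in> N i" for x
    by (rule image_eqI[of _ _ x]) (use e_id[OF i that] N_T[OF i that] in simp_all)
  then show "e i ` carrier T = carrier (U i)" using e_N[OF i] by auto
qed

lemma
  assumes i: "i < n"
  shows R_sub: "rsubmodule A (R i) (U i)"
  and R_incl: "f \<in> rad_hom A T (U i) \<Longrightarrow> t \<in> carrier T \<Longrightarrow> f t \<in> R i"
proof -
  have "(\<Union>f\<in>rad_hom A T (U i). f ` carrier T) \<subseteq> carrier (U i)"
    using rhom_closed[of _ A T "U i"] by (auto simp: rad_hom_def)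
  note g = gen_submodule_rsubmodule[OF U_module[OF i] this] gen_submodule_incl[OF U_module[OF i] this]
  show "rsubmodule A (R i) (U i)" unfolding R_def by (rule g(1))
  show "f \<in> rad_hom A T (U i) \<Longrightarrow> t \<in> carrier T \<Longrightarrow> f t \<in> R i" using g(2) unfolding R_def by blast
qed

lemma
  assumes i: "i < n"
  shows S_module: "right_module A (S i)"
  and S_carrier: "carrier (S i) = q i ` N i" and q_rhom: "q i \<in> rhom A (U i) (S i)"
  and q_ker: "x \<in> N i \<Longrightarrow> q i x = \<zero>\<^bsub>S i\<^esub> \<longleftrightarrow> x \<in> R i"
proof -
  interpret U: right_module A "U i" by (rule U_module[OF i])
  note Q = U.quot_rmod_facts[OF R_sub[OF i], folded S_eq]
  show "right_module A (S i)" by (rule Q(1))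
  show "carrier (S i) = q i ` N i" using Q(2) by (simp add: q_def)
  show q: "q i \<in> rhom A (U i) (S i)" using Q(3) by (simp add: q_def)
  show "x \<in> N i \<Longrightarrow> q i x = \<zero>\<^bsub>S i\<^esub> \<longleftrightarrow> x \<in> R i"
    using Q(4)[of x "\<zero>\<^bsub>U i\<^esub>"] rhom_zero[OF U_module[OF i] Q(1) q] U.M.zero_closed by (auto simp: q_def)
qed

lemma lift_q:
  assumes i: "i < n" and g: "g \<in> rhom A T (S i)"
  obtains u where "u \<in> rhom A T (U i)" "g = compose (carrier T) (q i) u"
proof -
  obtain u where u: "u \<in> rhom A T (U i)" "\<forall>t\<in>carrier T. R i +>\<^bsub>U i\<^esub> u t = g t"
    using lift[OF i g[unfolded S_def]] unfolding U_def R_def by blast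
  have "g = compose (carrier T) (q i) u"
    using u rhom_closed[OF u(1)] by (intro rhom_eqI[OF g compose_rhom[OF T_module u(1) q_rhom[OF i]]]) (simp add: compose_eq q_def)
  then show thesis using u(1) that by blast
qed

text \<open>
  A map outside the radical is onto \<open>U i\<close>, so its image is not contained in the proper submodule
  \<open>R i\<close>.
\<close>

lemma rad_iff:
  assumes i: "i < n" and ne: "R i \<noteq> N i" and u: "u \<in> rhom A T (U i)"
  shows "u \<in> rad_hom A T (U i) \<longleftrightarrow> u ` carrier T \<subseteq> R i"
proof
  show "u \<in> rad_hom A T (U i) \<Longrightarrow> u ` carrier T \<subseteq> R i" using R_incl[OF i] by blast
  assume *: "u ` carrier T \<subseteq> R i"
  show "u \<in> rad_hom A T (U i)"
  proof (rule ccontr)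
    assume "u \<notin> rad_hom A T (U i)"
    then obtain g where g: "g \<in> rhom A (U i) T" "\<And>x. x \<in> carrier (U i) \<Longrightarrow> u (g x) = x"
      using scal.not_rad_split[OF T_module U_module[OF i] U_fd[OF i] U_indec[OF i] u] by blast
    have "x \<in> R i" if "x \<in> N i" for x
    proof -
      have "u (g x) \<in> R i" using * rhom_closed[OF g(1), of x] that by auto
      then show ?thesis using g(2)[of x] that by simp
    qed
    then show False using ne rsubmodule_subset[OF R_sub[OF i]] by auto
  qed
qed

lemma S_nonzero_iff:
  assumes i: "i < n" shows "carrier (S i) \<noteq> {\<zero>\<^bsub>S i\<^esub>} \<longleftrightarrow> R i \<noteq> N i"
proof -
  have RN: "R i \<subseteq> N i" using rsubmodule_subset[OF R_sub[OF i]] by simp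
  have z: "q i \<zero>\<^bsub>U i\<^esub> = \<zero>\<^bsub>S i\<^esub>" "\<zero>\<^bsub>U i\<^esub> \<in> N i"
    using rhom_zero[OF U_module[OF i] S_module[OF i] q_rhom[OF i]] rsubmodule_zero_closed[OF R_sub[OF i]] RN by auto
  have "\<zero>\<^bsub>S i\<^esub> \<in> q i ` N i" using z by (intro image_eqI[of _ _ "\<zero>\<^bsub>U i\<^esub>"]) simp_all
  then have "carrier (S i) = {\<zero>\<^bsub>S i\<^esub>} \<longleftrightarrow> (\<forall>x\<in>N i. q i x = \<zero>\<^bsub>S i\<^esub>)"
    unfolding S_carrier[OF i] by auto
  also have "\<dots> \<longleftrightarrow> N i \<subseteq> R i" using q_ker[OF i] by auto
  finally show ?thesis using RN by auto
qed

definition \<pi> :: "nat \<Rightarrow> 't \<Rightarrow> 't set" where "\<pi> i = compose (carrier T) (q i) (e i)"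

lemma
  assumes i: "i < n"
  shows \<pi>_rhom: "\<pi> i \<in> rhom A T (S i)"
  and \<pi>_onto: "\<pi> i ` carrier T = carrier (S i)"
proof -
  show "\<pi> i \<in> rhom A T (S i)" unfolding \<pi>_def by (rule compose_rhom[OF T_module e_rhom[OF i] q_rhom[OF i]])
  have "e i ` carrier T = N i"
  proof (intro equalityI subsetI)
    fix x assume x: "x \<in> N i"
    then show "x \<in> e i ` carrier T" using e_id[OF i x] N_T[OF i x] by (metis image_eqI)
  qed (use e_N[OF i] in auto)
  then show "\<pi> i ` carrier T = carrier (S i)"
    unfolding \<pi>_def S_carrier[OF i] by (rule surj_compose) simp
qed

lemma S_fg: "i < n \<Longrightarrow> fg_rmodule A (S i)"
  by (rule fg_rmodule_image[OF T_fg S_module \<pi>_rhom \<pi>_onto])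

lemma S_in_Fac: "i < n \<Longrightarrow> in_Fac A T (S i)"
  by (rule in_FacI[OF T_module S_fg \<pi>_rhom \<pi>_onto])

lemma hom_S: "i < n \<Longrightarrow> right_module B (hom_rmod A T (S i))"
  by (rule hom_rmod_right_module[OF T_module S_module])

lemma compose_q_zero_iff:
  assumes i: "i < n" and ne: "R i \<noteq> N i" and u: "u \<in> rhom A T (U i)"
  shows "compose (carrier T) (q i) u = \<zero>\<^bsub>hom_rmod A T (S i)\<^esub> \<longleftrightarrow> u \<in> rad_hom A T (U i)"
proof -
  have "compose (carrier T) (q i) u = \<zero>\<^bsub>hom_rmod A T (S i)\<^esub> \<longleftrightarrow> (\<forall>t\<in>carrier T. q i (u t) = \<zero>\<^bsub>S i\<^esub>)"
    by (auto simp: compose_def fun_eq_iff)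
  also have "\<dots> \<longleftrightarrow> (\<forall>t\<in>carrier T. u t \<in> R i)"
    using q_ker[OF i] rhom_closed[OF u] by simp
  finally show ?thesis unfolding rad_iff[OF i ne u] by auto
qed

lemma \<pi>_nonzero:
  assumes i: "i < n" and ne: "R i \<noteq> N i" shows "\<pi> i \<noteq> \<zero>\<^bsub>hom_rmod A T (S i)\<^esub>"
proof
  assume *: "\<pi> i = \<zero>\<^bsub>hom_rmod A T (S i)\<^esub>"
  have "\<pi> i t = \<zero>\<^bsub>S i\<^esub>" if "t \<in> carrier T" for t using that by (simp add: *)
  then have "carrier (S i) \<subseteq> {\<zero>\<^bsub>S i\<^esub>}" using \<pi>_onto[OF i] by auto
  moreover have "\<zero>\<^bsub>S i\<^esub> \<in> carrier (S i)"
  proof -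
    interpret Si: right_module A "S i" by (rule S_module[OF i])
    show ?thesis by (rule Si.M.zero_closed)
  qed
  ultimately show False using S_nonzero_iff[OF i] ne by blast
qed

text \<open>
  A nonzero element \<open>q i \<circ> u\<close> generates: \<open>u\<close> has a section \<open>w\<close>, so every other element
  \<open>q i \<circ> v\<close> equals \<open>(q i \<circ> u) \<circ> (w \<circ> v)\<close>.
\<close>

lemma hom_S_simple:
  assumes i: "i < n" and ne: "R i \<noteq> N i"
  shows "simple_rmodule B (hom_rmod A T (S i))"
  unfolding simple_rmodule_def
proof (intro conjI allI impI hom_S[OF i])
  show "carrier (hom_rmod A T (S i)) \<noteq> {\<zero>\<^bsub>hom_rmod A T (S i)\<^esub>}"
    using \<pi>_nonzero[OF i ne] \<pi>_rhom[OF i] by auto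
  fix L assume L: "rsubmodule B L (hom_rmod A T (S i))"
  show "L = {\<zero>\<^bsub>hom_rmod A T (S i)\<^esub>} \<or> L = carrier (hom_rmod A T (S i))"
  proof (rule disjCI)
    assume "L \<noteq> carrier (hom_rmod A T (S i))"
    have "g = \<zero>\<^bsub>hom_rmod A T (S i)\<^esub>" if g: "g \<in> L" for g
    proof (rule ccontr)
      assume g0: "g \<noteq> \<zero>\<^bsub>hom_rmod A T (S i)\<^esub>"
      have "g \<in> rhom A T (S i)" using rsubmodule_subset[OF L] g by auto
      then obtain u where u: "u \<in> rhom A T (U i)" "g = compose (carrier T) (q i) u"
        using lift_q[OF i] by blast
      have "u \<notin> rad_hom A T (U i)" using g0 compose_q_zero_iff[OF i ne u(1)] u(2) by blast
      then obtain w where w: "w \<in> rhom A (U i) T" "\<And>x. x \<in> carrier (U i) \<Longrightarrow> u (w x) = x"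
        using scal.not_rad_split[OF T_module U_module[OF i] U_fd[OF i] U_indec[OF i] u(1)] by blast
      have "h \<in> L" if h: "h \<in> rhom A T (S i)" for h
      proof -
        obtain v where v: "v \<in> rhom A T (U i)" "h = compose (carrier T) (q i) v"
          using lift_q[OF i h] by blast
        have wv: "compose (carrier T) w v \<in> rhom A T T" by (rule compose_rhom[OF T_module v(1) w(1)])
        have "h = g \<bullet>\<^bsub>hom_rmod A T (S i)\<^esub> compose (carrier T) w v"
          using rhom_closed[OF v(1)] rhom_closed[OF w(1)] w(2)
          by (simp add: u(2) v(2) compose_def cong: restrict_cong)
        then show ?thesis using rsubmodule_ract_closed[OF L g] wv by simp
      qed
      then show False using \<open>L \<noteq> _\<close> rsubmodule_subset[OF L] by auto
    qed
    then show "L = {\<zero>\<^bsub>hom_rmod A T (S i)\<^esub>}" using rsubmodule_zero_closed[OF L] by blast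
  qed
qed

text \<open>
  Lift the image \<open>g\<close> of \<open>\<pi> i\<close> to a map \<open>u: T \<rightarrow> U j\<close>.  As \<open>g = g \<circ> e i\<close>, the map \<open>u \<circ> e i\<close> is also
  a lift.  It is not in the radical, since \<open>g \<noteq> 0\<close>, so the restriction of \<open>u\<close> to \<open>U i\<close> is a split
  epimorphism onto \<open>U j\<close>.
\<close>

lemma hom_S_iso_imp_eq:
  assumes i: "i < n" "R i \<noteq> N i" and j: "j < n" "R j \<noteq> N j"
    and iso: "rmod_iso B (hom_rmod A T (S i)) (hom_rmod A T (S j))"
  shows "i = j"
proof -
  obtain \<theta> where \<theta>: "\<theta> \<in> rhom B (hom_rmod A T (S i)) (hom_rmod A T (S j))"
    "inj_on \<theta> (carrier (hom_rmod A T (S i)))"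
    using iso by (auto simp: rmod_iso_def bij_betw_def)
  have \<pi>i: "\<pi> i \<in> carrier (hom_rmod A T (S i))" using \<pi>_rhom[OF i(1)] by simp
  define g where "g = \<theta> (\<pi> i)"
  have g: "g \<in> rhom A T (S j)" using rhom_closed[OF \<theta>(1) \<pi>i] by (simp add: g_def)
  have "g \<noteq> \<zero>\<^bsub>hom_rmod A T (S j)\<^esub>"
  proof
    interpret Hi: right_module B "hom_rmod A T (S i)" by (rule hom_S[OF i(1)])
    assume "g = \<zero>\<^bsub>hom_rmod A T (S j)\<^esub>"
    then have "\<theta> (\<pi> i) = \<theta> \<zero>\<^bsub>hom_rmod A T (S i)\<^esub>"
      using rhom_zero[OF hom_S[OF i(1)] hom_S[OF j(1)] \<theta>(1)] by (simp only: g_def)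
    then show False
      using inj_onD[OF \<theta>(2) _ \<pi>i Hi.M.zero_closed] \<pi>_nonzero[OF i] by blast
  qed
  have "\<pi> i \<bullet>\<^bsub>hom_rmod A T (S i)\<^esub> e i = \<pi> i"
    using e_N[OF i(1)] e_id[OF i(1)] N_T[OF i(1)]
    by (simp add: \<pi>_def compose_def cong: restrict_cong)
  then have ge: "g = compose (carrier T) g (e i)"
    using rhom_ract[OF \<theta>(1) \<pi>i, of "e i"] e_T[OF i(1)] by (simp add: g_def)
  obtain u where u: "u \<in> rhom A T (U j)" "g = compose (carrier T) (q j) u" using lift_q[OF j(1) g] by blast
  have ue: "compose (carrier T) u (e i) \<in> rhom A T (U j)" by (rule compose_rhom[OF T_module e_T[OF i(1)] u(1)])
  have "g = compose (carrier T) (q j) (compose (carrier T) u (e i))"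
    by (subst ge) (simp add: u(2) compose_def rhom_closed[OF e_T[OF i(1)]] cong: restrict_cong)
  then have "compose (carrier T) u (e i) \<notin> rad_hom A T (U j)"
    using \<open>g \<noteq> _\<close> compose_q_zero_iff[OF j ue] by simp
  then obtain w where w: "w \<in> rhom A (U j) T"
    "\<And>x. x \<in> carrier (U j) \<Longrightarrow> compose (carrier T) u (e i) (w x) = x"
    using scal.not_rad_split[OF T_module U_module[OF j(1)] U_fd[OF j(1)] U_indec[OF j(1)] ue] by blast
  have k: "restrict u (N i) \<in> rhom A (U i) (U j)"
    using restrict_submodule_rhom[OF u(1) T_module N_sub[OF i(1)]] by (simp add: U_def[of i])
  have w': "compose (carrier (U j)) (e i) w \<in> rhom A (U j) (U i)"
    by (rule compose_rhom[OF U_module[OF j(1)] w(1) e_rhom[OF i(1)]])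
  have kw: "restrict u (N i) (compose (carrier (U j)) (e i) w x) = x" if x: "x \<in> carrier (U j)" for x
    using w(2)[OF x] x rhom_closed[OF w(1) x] e_N[OF i(1)] by (simp add: compose_eq)
  have "rmod_iso A (U j) (U i)"
    by (rule split_epi_indecomposable[OF U_module[OF i(1)] U_module[OF j(1)] U_indec[OF i(1)] k w' kw])
      (use U_indec[OF j(1)] in \<open>auto simp: indecomposable_def\<close>)
  then show "i = j" using decomp i(1) j(1) unfolding basic_decomposition_def U_def by blast
qed

text \<open>
  A map \<open>\<theta>: Y \<rightarrow> \<D>T\<close> that is not zero yields an element \<open>y = y e\<^sub>i \<noteq> 0\<close> of \<open>Y\<close> for which
  \<open>\<theta> y\<close> is not zero on \<open>U i\<close>.  Acting on \<open>y\<close>, the maps \<open>T \<rightarrow> U i\<close> in the radical give zero (the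
  element \<open>1 - u b\<close> is invertible) and the others do not (they split), so \<open>u \<mapsto> y u\<close> makes \<open>Y\<close> the
  quotient of \<open>Hom(T, U i)\<close> by the radical maps.
\<close>

lemma simple_in_Sub:
  fixes Y :: "('t \<Rightarrow> 't, 'y) rmodule"
  assumes simple: "simple_rmodule B Y" and sub: "in_Sub B (dual_end_mod K A T) Y"
  obtains i where "i < n" "R i \<noteq> N i" "rmod_iso B (hom_rmod A T (S i)) Y"
proof -
  have Y: "right_module B Y" using simple by (simp add: simple_rmodule_def)
  interpret Y: right_module B Y by fact
  interpret T: right_module A T by (rule T_module)
  have D: "right_module B (dual_end_mod K A T)" by (rule scal.dual_end_mod_right_module[OF T_module])
  have KK: "right_module K (regular K)" by (rule regular_right_module[OF scal.K.ring_axioms])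
  obtain y0 where y0: "y0 \<in> carrier Y" "y0 \<noteq> \<zero>\<^bsub>Y\<^esub>"
    using simple Y.M.zero_closed unfolding simple_rmodule_def by blast
  obtain \<theta> where \<theta>: "\<theta> \<in> rhom B Y (dual_end_mod K A T)" "\<theta> y0 \<noteq> \<zero>\<^bsub>dual_end_mod K A T\<^esub>"
    using in_SubD[OF D sub y0] by blast
  define \<phi> where "\<phi> = \<theta> y0"
  have \<phi>: "\<phi> \<in> rhom K (vect A T) (regular K)"
    using rhom_closed[OF \<theta>(1) y0(1)] by (simp add: \<phi>_def scal.dual_end_mod_carrier)
  have "\<exists>t\<in>carrier T. \<phi> t \<noteq> \<zero>\<^bsub>K\<^esub>"
  proof (rule ccontr)
    assume "\<not> (\<exists>t\<in>carrier T. \<phi> t \<noteq> \<zero>\<^bsub>K\<^esub>)"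
    then have "\<phi> = (\<lambda>t\<in>carrier T. \<zero>\<^bsub>K\<^esub>)"
      using rhom_extensional[OF \<phi>] by (intro extensionalityI[of _ "carrier T"]) auto
    then show False using \<theta>(2) by (simp add: \<phi>_def)
  qed
  then obtain t where t: "t \<in> carrier T" "\<phi> t \<noteq> \<zero>\<^bsub>K\<^esub>" by blast
  have "\<exists>i<n. \<phi> (e i t) \<noteq> \<zero>\<^bsub>K\<^esub>"
  proof (rule ccontr)
    assume *: "\<not> (\<exists>i<n. \<phi> (e i t) \<noteq> \<zero>\<^bsub>K\<^esub>)"
    have "\<phi> t = \<phi> (\<Oplus>\<^bsub>vect A T\<^esub>i\<in>{..<n}. e i t)" using e_sum[OF t(1)] by (simp add: finsum_vect)
    also have "\<dots> = (\<Oplus>\<^bsub>K\<^esub>i\<in>{..<n}. \<phi> (e i t))"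
      using rhom_finsum[OF scal.vect_right_module[OF T_module] KK \<phi>, of "{..<n}" "\<lambda>i. e i t"]
        rhom_closed[OF e_T t(1)] by (simp add: finsum_regular)
    also have "\<dots> = (\<Oplus>\<^bsub>K\<^esub>i\<in>{..<n}. \<zero>\<^bsub>K\<^esub>)" using * by (intro scal.K.finsum_cong') auto
    also have "\<dots> = \<zero>\<^bsub>K\<^esub>" by (rule scal.K.finsum_zero)
    finally show False using t(2) by simp
  qed
  then obtain i where i: "i < n" and \<phi>i: "\<phi> (e i t) \<noteq> \<zero>\<^bsub>K\<^esub>" by blast
  have eB: "e i \<in> carrier B" using e_T[OF i] by simp
  define y where "y = y0 \<bullet>\<^bsub>Y\<^esub> e i"
  have y: "y \<in> carrier Y" unfolding y_def by (rule Y.ract_closed[OF y0(1) eB])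
  have \<theta>y: "\<theta> y = (\<lambda>s\<in>carrier T. \<phi> (e i s))"
    using rhom_ract[OF \<theta>(1) y0(1) eB] by (simp add: y_def \<phi>_def)
  have y_ne: "y \<noteq> \<zero>\<^bsub>Y\<^esub>"
  proof
    assume "y = \<zero>\<^bsub>Y\<^esub>"
    then have "\<theta> y = \<zero>\<^bsub>dual_end_mod K A T\<^esub>" using rhom_zero[OF Y D \<theta>(1)] by simp
    then have "(\<lambda>s\<in>carrier T. \<phi> (e i s)) t = (\<lambda>s\<in>carrier T. \<zero>\<^bsub>K\<^esub>) t" unfolding \<theta>y by simp
    then show False using \<phi>i t(1) by simp
  qed
  have "compose (carrier T) (e i) (e i) = e i"
    using e_N[OF i] e_id[OF i] rhom_extensional[OF e_T[OF i]]
    by (intro extensionalityI[of _ "carrier T"]) (auto simp: compose_eq compose_def)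
  then have ye: "y \<bullet>\<^bsub>Y\<^esub> e i = y"
    using Y.ract_mult[OF y0(1) eB eB] by (simp add: y_def)
  have uB: "u \<in> carrier B" if "u \<in> rhom A T (U i)" for u using U_incl[OF i, of u T] that by simp
  have rad_zero: "y \<bullet>\<^bsub>Y\<^esub> u = \<zero>\<^bsub>Y\<^esub>" if u: "u \<in> rad_hom A T (U i)" for u
  proof (rule ccontr)
    assume ne: "y \<bullet>\<^bsub>Y\<^esub> u \<noteq> \<zero>\<^bsub>Y\<^esub>"
    have u': "u \<in> carrier B" using u uB by (simp add: rad_hom_def)
    obtain b where b: "b \<in> carrier B" "y = (y \<bullet>\<^bsub>Y\<^esub> u) \<bullet>\<^bsub>Y\<^esub> b"
      using simple_rmodule_cyclic[OF simple Y.ract_closed[OF y u'] ne y] by blast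
    let ?c = "\<one>\<^bsub>B\<^esub> \<ominus>\<^bsub>B\<^esub> u \<otimes>\<^bsub>B\<^esub> b"
    have "?c \<in> Units B"
      using rad_hom_one_minus_Units[OF T_module N_sub[OF i] u[unfolded U_def], of b] b(1) by simp
    then obtain c where c: "c \<in> carrier B" "?c \<otimes>\<^bsub>B\<^esub> c = \<one>\<^bsub>B\<^esub>" "?c \<in> carrier B" unfolding Units_def by blast
    have ub: "u \<otimes>\<^bsub>B\<^esub> b \<in> carrier B" by (rule Y.A.m_closed[OF u' b(1)])
    have "y \<bullet>\<^bsub>Y\<^esub> ?c = y \<ominus>\<^bsub>Y\<^esub> y \<bullet>\<^bsub>Y\<^esub> (u \<otimes>\<^bsub>B\<^esub> b)"
      using Y.ract_minus_right[OF y Y.A.one_closed ub] Y.ract_one[OF y] by simp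
    also have "y \<bullet>\<^bsub>Y\<^esub> (u \<otimes>\<^bsub>B\<^esub> b) = y" using Y.ract_mult[OF y u' b(1)] b(2) by simp
    also have "y \<ominus>\<^bsub>Y\<^esub> y = \<zero>\<^bsub>Y\<^esub>" using y by simp
    finally have "y \<bullet>\<^bsub>Y\<^esub> ?c = \<zero>\<^bsub>Y\<^esub>" .
    then have "y \<bullet>\<^bsub>Y\<^esub> (?c \<otimes>\<^bsub>B\<^esub> c) = \<zero>\<^bsub>Y\<^esub>"
      using Y.ract_mult[OF y c(3,1)] Y.ract_zero_left[OF c(1)] by (simp only:)
    then show False using Y.ract_one[OF y] y_ne by (simp only: c(2))
  qed
  have nonrad: "y \<bullet>\<^bsub>Y\<^esub> u \<noteq> \<zero>\<^bsub>Y\<^esub>" if u: "u \<in> rhom A T (U i)" "u \<notin> rad_hom A T (U i)" for u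
  proof
    assume *: "y \<bullet>\<^bsub>Y\<^esub> u = \<zero>\<^bsub>Y\<^esub>"
    obtain w where w: "w \<in> rhom A (U i) T" "\<And>x. x \<in> carrier (U i) \<Longrightarrow> u (w x) = x"
      using scal.not_rad_split[OF T_module U_module[OF i] U_fd[OF i] U_indec[OF i] u] by blast
    have we: "compose (carrier T) w (e i) \<in> carrier B" using compose_rhom[OF T_module e_rhom[OF i] w(1)] by simp
    have "compose (carrier T) u (compose (carrier T) w (e i)) = e i"
      using e_N[OF i] w(2) rhom_closed[OF w(1)] rhom_extensional[OF e_T[OF i]]
      by (intro extensionalityI[of _ "carrier T"]) (auto simp: compose_eq compose_def)
    then have "y \<bullet>\<^bsub>Y\<^esub> e i = (y \<bullet>\<^bsub>Y\<^esub> u) \<bullet>\<^bsub>Y\<^esub> compose (carrier T) w (e i)"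
      using Y.ract_mult[OF y uB[OF u(1)] we] by simp
    also have "\<dots> = \<zero>\<^bsub>Y\<^esub>" unfolding * by (rule Y.ract_zero_left[OF we])
    finally show False using ye y_ne by simp
  qed
  \<comment> \<open>The kernel of \<open>\<phi>\<close> is only a subspace, so \<open>R i\<close> is compared with the largest submodule of
    \<open>U i\<close> on which \<open>\<phi>\<close> vanishes; it is not all of \<open>U i\<close>.\<close>
  let ?L = "{x \<in> N i. \<forall>a\<in>carrier A. \<phi> (x \<bullet>\<^bsub>T\<^esub> a) = \<zero>\<^bsub>K\<^esub>}"
  have "rsubmodule A ?L (U i)"
  proof -
    interpret Ui: right_module A "U i" by (rule U_module[OF i])
    have Nc: "x \<oplus>\<^bsub>T\<^esub> x' \<in> N i" "x \<bullet>\<^bsub>T\<^esub> a \<in> N i" "\<zero>\<^bsub>T\<^esub> \<in> N i"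
      if "x \<in> N i" "x' \<in> N i" "a \<in> carrier A" for x x' a
      using rsubmodule_add_closed[OF N_sub[OF i]] rsubmodule_ract_closed[OF N_sub[OF i]]
        rsubmodule_zero_closed[OF N_sub[OF i]] that by auto
    have \<phi>0: "\<phi> \<zero>\<^bsub>T\<^esub> = \<zero>\<^bsub>K\<^esub>" using rhom_zero[OF scal.vect_right_module[OF T_module] KK \<phi>] by simp
    have \<phi>add: "\<phi> (x \<oplus>\<^bsub>T\<^esub> x') = \<phi> x \<oplus>\<^bsub>K\<^esub> \<phi> x'" if "x \<in> carrier T" "x' \<in> carrier T" for x x'
      using rhom_add[OF \<phi>] that by simp
    show ?thesis
    proof (rule Ui.rsubmoduleI)
      show "\<zero>\<^bsub>U i\<^esub> \<in> ?L" using \<phi>0 rsubmodule_zero_closed[OF N_sub[OF i]] by (simp add: U_def)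
      fix x assume x: "x \<in> ?L"
      then have xN: "x \<in> N i" by simp
      show "x \<oplus>\<^bsub>U i\<^esub> x' \<in> ?L" if x': "x' \<in> ?L" for x'
        using x x' Nc(1)[OF xN _ scal.A.one_closed] N_T[OF i] T.ract_closed
        by (simp add: U_def T.ract_add_left \<phi>add)
      show "x \<bullet>\<^bsub>U i\<^esub> a \<in> ?L" if a: "a \<in> carrier A" for a
        using x Nc(2)[OF xN xN a] N_T[OF i] a by (simp add: U_def T.ract_mult[symmetric])
    qed auto
  qed
  moreover have "u s \<in> ?L" if u: "u \<in> rad_hom A T (U i)" and s: "s \<in> carrier T" for u s
  proof -
    have u': "u \<in> rhom A T (U i)" using u by (simp add: rad_hom_def)
    have us: "u s \<in> N i" using rhom_closed[OF u' s] by simp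
    have "\<phi> (u s' ) = \<zero>\<^bsub>K\<^esub>" if s': "s' \<in> carrier T" for s'
    proof -
      have "\<theta> (y \<bullet>\<^bsub>Y\<^esub> u) = \<zero>\<^bsub>dual_end_mod K A T\<^esub>" using rad_zero[OF u] rhom_zero[OF Y D \<theta>(1)] by simp
      then have "(\<lambda>s\<in>carrier T. \<theta> y (u s)) = (\<lambda>s\<in>carrier T. \<zero>\<^bsub>K\<^esub>)"
        using rhom_ract[OF \<theta>(1) y uB[OF u']] by simp
      from fun_cong[OF this, of s'] have "\<theta> y (u s') = \<zero>\<^bsub>K\<^esub>" using s' by simp
      moreover have "u s' \<in> N i" using rhom_closed[OF u' s'] by simp
      ultimately show ?thesis using e_id[OF i] N_T[OF i] by (simp add: \<theta>y)
    qed
    moreover have "u s \<bullet>\<^bsub>T\<^esub> a = u (s \<bullet>\<^bsub>T\<^esub> a)" if "a \<in> carrier A" for a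
      using rhom_ract[OF u' s that] by (simp add: U_def)
    ultimately show ?thesis using us T.ract_closed[OF s] by simp
  qed
  ultimately have RL: "R i \<subseteq> ?L" unfolding R_def by (intro gen_submodule_least) auto
  have "e i t \<notin> ?L"
    using \<phi>i T.ract_one[OF N_T[OF i e_N[OF i t(1)]]] scal.A.one_closed by force
  then have ne: "R i \<noteq> N i" using RL e_N[OF i t(1)] by blast
  \<comment> \<open>both \<open>Hom(T, S i)\<close> and \<open>Y\<close> are \<open>Hom(T, U i)\<close> modulo the radical\<close>
  have hU: "right_module B (hom_rmod A T (U i))" by (rule hom_rmod_right_module[OF T_module U_module[OF i]])
  let ?p = "\<lambda>u\<in>rhom A T (U i). compose (carrier T) (q i) u"
  let ?w = "\<lambda>u\<in>rhom A T (U i). y \<bullet>\<^bsub>Y\<^esub> u"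
  have p: "?p \<in> rhom B (hom_rmod A T (U i)) (hom_rmod A T (S i))"
    by (rule hom_rmod_map[OF T_module U_module[OF i] S_module[OF i] q_rhom[OF i]])
  have p_onto: "?p ` carrier (hom_rmod A T (U i)) = carrier (hom_rmod A T (S i))"
  proof (intro equalityI subsetI)
    fix g assume "g \<in> carrier (hom_rmod A T (S i))"
    then obtain u where "u \<in> rhom A T (U i)" "g = compose (carrier T) (q i) u"
      using lift_q[OF i] by auto
    then show "g \<in> ?p ` carrier (hom_rmod A T (U i))" by (intro image_eqI[of _ _ u]) auto
  qed (use rhom_closed[OF p] in auto)
  have Uadd: "x \<oplus>\<^bsub>U i\<^esub> x' = x \<oplus>\<^bsub>T\<^esub> x'" for x x' by (simp add: U_def)
  have "restrict (\<lambda>u. y \<bullet>\<^bsub>Y\<^esub> u) (carrier (hom_rmod A T (U i))) \<in> rhom B (hom_rmod A T (U i)) Y"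
  proof (rule restrict_rhomI[OF hU])
    fix u assume "u \<in> carrier (hom_rmod A T (U i))"
    then have u: "u \<in> carrier B" using uB by simp
    show "y \<bullet>\<^bsub>Y\<^esub> u \<in> carrier Y" by (rule Y.ract_closed[OF y u])
    show "y \<bullet>\<^bsub>Y\<^esub> (u \<oplus>\<^bsub>hom_rmod A T (U i)\<^esub> v) = y \<bullet>\<^bsub>Y\<^esub> u \<oplus>\<^bsub>Y\<^esub> y \<bullet>\<^bsub>Y\<^esub> v"
      if "v \<in> carrier (hom_rmod A T (U i))" for v
      using Y.ract_add_right[OF y u, of v] uB[of v] that by (simp add: Uadd)
    show "y \<bullet>\<^bsub>Y\<^esub> (u \<bullet>\<^bsub>hom_rmod A T (U i)\<^esub> b) = (y \<bullet>\<^bsub>Y\<^esub> u) \<bullet>\<^bsub>Y\<^esub> b" if "b \<in> carrier B" for b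
      using Y.ract_mult[OF y u that] by simp
  qed
  then have w: "?w \<in> rhom B (hom_rmod A T (U i)) Y" by simp
  have ker: "?w u = \<zero>\<^bsub>Y\<^esub>" if "u \<in> carrier (hom_rmod A T (U i))" "?p u = \<zero>\<^bsub>hom_rmod A T (S i)\<^esub>" for u
    using that compose_q_zero_iff[OF i ne, of u] rad_zero[of u] by simp
  obtain v where v: "v \<in> rhom B (hom_rmod A T (S i)) Y"
    "\<And>u. u \<in> carrier (hom_rmod A T (U i)) \<Longrightarrow> v (?p u) = ?w u"
    using rhom_factor[OF hU hom_S[OF i] Y p p_onto w ker] by blast
  have v_q: "v (compose (carrier T) (q i) u) = y \<bullet>\<^bsub>Y\<^esub> u" if "u \<in> rhom A T (U i)" for u
    using v(2)[of u] that by simp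
  have "inj_on v (carrier (hom_rmod A T (S i)))"
  proof (rule rhom_inj_onI[OF hom_S[OF i] Y v(1)])
    fix g assume "g \<in> carrier (hom_rmod A T (S i))" and *: "v g = \<zero>\<^bsub>Y\<^esub>"
    then obtain u where u: "u \<in> rhom A T (U i)" "g = compose (carrier T) (q i) u"
      using lift_q[OF i] by auto
    have "u \<in> rad_hom A T (U i)" using nonrad[OF u(1)] v_q[OF u(1)] * u(2) by metis
    then show "g = \<zero>\<^bsub>hom_rmod A T (S i)\<^esub>" using compose_q_zero_iff[OF i ne u(1)] u(2) by blast
  qed
  moreover have "v ` carrier (hom_rmod A T (S i)) = carrier Y"
  proof (intro equalityI subsetI)
    fix z assume z: "z \<in> carrier Y"
    obtain b where b: "b \<in> carrier B" "z = y \<bullet>\<^bsub>Y\<^esub> b" using simple_rmodule_cyclic[OF simple y y_ne z] by blast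
    have eb: "compose (carrier T) (e i) b \<in> rhom A T (U i)"
      using compose_rhom[OF T_module _ e_rhom[OF i]] b(1) by simp
    have "z = y \<bullet>\<^bsub>Y\<^esub> compose (carrier T) (e i) b"
      using Y.ract_mult[OF y eB b(1)] ye b(2) by simp
    then have "z = v (compose (carrier T) (q i) (compose (carrier T) (e i) b))" using v_q[OF eb] by simp
    then show "z \<in> v ` carrier (hom_rmod A T (S i))" using compose_rhom[OF T_module eb q_rhom[OF i]] by auto
  qed (use rhom_closed[OF v(1)] in auto)
  ultimately have "rmod_iso B (hom_rmod A T (S i)) Y"
    using v(1) by (auto simp: rmod_iso_def bij_betw_def)
  then show thesis using that i ne by blast
qed

lemma semibrick_summands_eq: "semibrick_summands A T n N = S ` {i. i < n \<and> R i \<noteq> N i}"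
  using S_nonzero_iff by (auto simp: semibrick_summands_def S_def[symmetric])

lemma hom_S_coordinate_module:
  assumes i: "i < n"
  obtains Y :: "('t \<Rightarrow> 't, nat \<Rightarrow> 'k) rmodule"
  where "fg_rmodule B Y" "rmod_iso B (hom_rmod A T (S i)) Y"
proof -
  interpret B: central_scalars K B by (rule scal.end_alg_central_scalars[OF T_module])
  obtain F where F: "separating K (vect B (hom_rmod A T (S i))) F"
    using hom_rmod_fd[OF fd T_fg S_fg[OF i]] by blast
  obtain Y :: "('t \<Rightarrow> 't, nat \<Rightarrow> 'k) rmodule"
    where Y: "right_module B Y" "rmod_iso B (hom_rmod A T (S i)) Y"
    using B.iso_coordinate_module[OF hom_S[OF i] F] by blast
  show thesis
    by (rule that[OF rmod_iso_fg[OF hom_rmod_fg[OF fd T_fg S_fg[OF i]] Y] Y(2)])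
qed

lemma hom_S_bij:
  "bij_betw (\<lambda>S. iso_class K B (hom_rmod A T S)) (semibrick_summands A T n N)
    {iso_class K B Y | Y :: ('t \<Rightarrow> 't, nat \<Rightarrow> 'k) rmodule.
       simple_rmodule B Y \<and> in_Sub B (dual_end_mod K A T) Y}"
proof -
  let ?F = "\<lambda>S. iso_class K B (hom_rmod A T S)"
  have "i = j" if i: "i < n" "R i \<noteq> N i" and j: "j < n" "R j \<noteq> N j" and eq: "?F (S i) = ?F (S j)" for i j
  proof -
    obtain Y :: "('t \<Rightarrow> 't, nat \<Rightarrow> 'k) rmodule"
      where Y: "fg_rmodule B Y" "rmod_iso B (hom_rmod A T (S i)) Y"
      using hom_S_coordinate_module[OF i(1)] by blast
    then have "Y \<in> ?F (S i)" by (simp add: iso_class_def)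
    then have "Y \<in> ?F (S j)" unfolding eq .
    then have "rmod_iso B (hom_rmod A T (S j)) Y" by (simp add: iso_class_def)
    moreover have "right_module B Y" using Y(1) by (simp add: fg_rmodule_def)
    ultimately have "rmod_iso B Y (hom_rmod A T (S j))"
      using rmod_iso_sym[OF hom_S[OF j(1)]] by blast
    then show ?thesis
      using hom_S_iso_imp_eq[OF i j] rmod_iso_trans[OF hom_S[OF i(1)] Y(2)] by blast
  qed
  then have "inj_on ?F (semibrick_summands A T n N)"
    unfolding semibrick_summands_eq by (intro inj_onI) auto
  moreover have "?F ` semibrick_summands A T n N = {iso_class K B Y | Y :: ('t \<Rightarrow> 't, nat \<Rightarrow> 'k) rmodule.
       simple_rmodule B Y \<and> in_Sub B (dual_end_mod K A T) Y}" (is "_ = ?C")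
  proof (intro equalityI subsetI)
    fix c assume "c \<in> ?F ` semibrick_summands A T n N"
    then obtain i where i: "i < n" "R i \<noteq> N i" and c: "c = ?F (S i)"
      unfolding semibrick_summands_eq by auto
    obtain Y :: "('t \<Rightarrow> 't, nat \<Rightarrow> 'k) rmodule"
      where Y: "fg_rmodule B Y" "rmod_iso B (hom_rmod A T (S i)) Y"
      using hom_S_coordinate_module[OF i(1)] by blast
    have Y': "right_module B Y" using Y(1) by (simp add: fg_rmodule_def)
    have "simple_rmodule B Y" by (rule simple_rmodule_iso[OF hom_S_simple[OF i] Y' Y(2)])
    moreover have "in_Sub B (dual_end_mod K A T) Y"
      by (rule in_Sub_iso[OF hom_rmod_in_Sub[OF fd T_fg S_fg[OF i(1)]] Y(1)
            rmod_iso_sym[OF hom_S[OF i(1)] Y' Y(2)]])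
    moreover have "c = iso_class K B Y" unfolding c by (rule iso_class_cong[OF hom_S[OF i(1)] Y' Y(2)])
    ultimately show "c \<in> ?C" by blast
  next
    fix c assume "c \<in> ?C"
    then obtain Y :: "('t \<Rightarrow> 't, nat \<Rightarrow> 'k) rmodule" where Y: "simple_rmodule B Y"
      "in_Sub B (dual_end_mod K A T) Y" and c: "c = iso_class K B Y" by blast
    have Y': "right_module B Y" using Y(1) by (simp add: simple_rmodule_def)
    obtain i where i: "i < n" "R i \<noteq> N i" "rmod_iso B (hom_rmod A T (S i)) Y"
      using simple_in_Sub[OF Y] by blast
    have "c = ?F (S i)" unfolding c using iso_class_cong[OF hom_S[OF i(1)] Y' i(3)] by simp
    then show "c \<in> ?F ` semibrick_summands A T n N" unfolding semibrick_summands_eq using i by blast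
  qed
  ultimately show ?thesis unfolding bij_betw_def by (rule conjI)
qed

end

theorem theorem1p3:
  fixes K :: "'k ring" and A :: "('k, 'a) module" and T :: "('a, 't) rmodule"
    and n :: nat and N :: "nat \<Rightarrow> 't set"
  assumes "algebraically_closed K"
    and "fd_algebra K A"
    and "basic_algebra A"
    and "support_tau_tilting K A T"
    and "basic_decomposition A T n N"
  shows "(\<forall>Y :: ('a, 'x) rmodule.
            in_Fac A T Y \<longrightarrow> in_Sub (end_alg A T) (dual_end_mod K A T) (hom_rmod A T Y))
    \<and> (\<forall>S \<in> semibrick_summands A T n N. in_Fac A T S)
    \<and> bij_betw (\<lambda>S. iso_class K (end_alg A T) (hom_rmod A T S))
        (semibrick_summands A T n N)
        {iso_class K (end_alg A T) Y | Y :: ('t \<Rightarrow> 't, nat \<Rightarrow> 'k) rmodule.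
           simple_rmodule (end_alg A T) Y
           \<and> in_Sub (end_alg A T) (dual_end_mod K A T) Y}"
proof -
  have T_fg: "fg_rmodule A T" using assms(4) by (simp add: support_tau_tilting_def)
  have "rad_lifting K A T n N"
  proof (rule rad_lifting.intro)
    fix i g assume i: "i < n" and g: "g \<in> rhom A T (rad_quotient A T (N i))"
    have N: "rsubmodule A (N i) T"
      using assms(5) i by (simp add: basic_decomposition_def internal_direct_sum_def)
    show "\<exists>v\<in>rhom A T (T\<lparr>carrier := N i\<rparr>). \<forall>t\<in>carrier T.
        gen_submodule A (T\<lparr>carrier := N i\<rparr>) (\<Union>f\<in>rad_hom A T (T\<lparr>carrier := N i\<rparr>). f ` carrier T)
          +>\<^bsub>T\<lparr>carrier := N i\<rparr>\<^esub> v t = g t"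
      using g by (intro support_tau_tilting_lift[OF assms(2,4) N _ refl])
        (auto simp: rad_hom_def rad_quotient_def Let_def)
  qed (rule assms(2) T_fg assms(5))+
  then interpret rad_lifting K A T n N .
  show ?thesis
  proof (intro conjI allI impI ballI hom_S_bij)
    fix Y :: "('a, 'x) rmodule" assume "in_Fac A T Y"
    then have "fg_rmodule A Y" by (simp add: in_Fac_def)
    then show "in_Sub (end_alg A T) (dual_end_mod K A T) (hom_rmod A T Y)"
      by (rule hom_rmod_in_Sub[OF assms(2) T_fg])
  next
    fix S' assume "S' \<in> semibrick_summands A T n N"
    then show "in_Fac A T S'" unfolding semibrick_summands_eq using S_in_Fac by auto
  qed
qed

end
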